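(* Let $\mathfrak{F}_N:=\{x\in J_N(K)\mid \delta_N x=x\}$ be the group of points of $J_N(K)$ fixed by $\delta_N$ (equivalently, by the group of $N$-th roots of unity acting on $J_N$), and let $\mathfrak{G}_N\subseteq \mathrm{Pic}^0(C_{f,N})=J_N(K)$ be the subgroup of linear equivalence classes of divisors of degree zero of the form $b\infty+\sum_{i=1}^n a_iQ_i$ with $b,a_i\in\mathbb{Z}$ and $b+\sum_{i=1}^n a_i=0$. Then $\mathfrak{F}_N=\mathfrak{G}_N\simeq (\mathbb{Z}/N\mathbb{Z})^{n-1}$.
   Context: $K$ is an algebraically closed field and $N>1$ is an integer coprime to the characteristic of $K$ (i.e. nonzero in $K$). $\xi_N\in K$ is a primitive $N$-th root of unity. $f(X)=\prod_{i=1}^n (X-\alpha_i)^{e_i}\in K[X]$ is a monic polynomial with pairwise distinct roots $\alpha_i$ and multiplicities $e_i\ge 1$, such that $\gcd(\deg f,N)=1$ and $\gcd(e_i,N)=1$ for all $1\le i\le n$. $C_{f,N}$ is the smooth projective curve over $K$ defined by the affine equation $Y^N=f(X)$ (the smooth projective model), and $J_N=\mathrm{Jac}(C_{f,N})$ is its Jacobian. $\delta_N$ denotes the automorphism $(X,Y)\mapsto (X,\xi_N Y)$ of $C_{f,N}$ and also the automorphism of $J_N$ it induces by Albanese functoriality (push-forward of divisor classes of degree zero). Under the hypotheses on $f$ there is exactly one point $Q_i\in C_{f,N}(K)$ corresponding to the point $(\alpha_i,0)$ of the affine curve $Y^N=f(X)$, and exactly one point $\infty\in C_{f,N}(K)$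 above the point at infinity of $\mathbb{P}^1$ under the map $C_{f,N}\to\mathbb{P}^1$, $(X,Y)\mapsto X$. *)

theory Defs
  imports
    "HOL-Computational_Algebra.Polynomial_Factorial"
    "HOL-Algebra.Ring"
    "HOL-Algebra.Free_Abelian_Groups"
    "HOL-Algebra.Product_Groups"
    "HOL-Algebra.Elementary_Groups"
begin

text \<open>
  The smooth projective model of \<open>Y^N = f(X)\<close> over an algebraically closed field \<open>K\<close> is
  rendered as the abstract nonsingular curve of its function field
  \<open>K(X)[Y] / (Y^N - f(X))\<close>: its points are the discrete valuations of the function
  field over \<open>K\<close>.
\<close>

definition primitive_root_of_unity :: "nat \<Rightarrow> 'a :: field \<Rightarrow> bool" where
  "primitive_root_of_unity N z \<longleftrightarrow> 0 < N \<and> z ^ N = 1 \<and> (\<forall>k. 0 < k \<and> k < N \<longrightarrow> z ^ k \<noteq> 1)"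

definition curve_poly :: "'a :: field poly \<Rightarrow> nat \<Rightarrow> 'a poly fract poly" where
  "curve_poly f N = monom 1 N - [:to_fract f:]"

text \<open>
  The quotient ring \<open>K(X)[Y] / (Y^N - f)\<close>, on the representatives of \<open>Y\<close>-degree less than
  \<open>N\<close>. It is a field whenever \<open>Y^N - f\<close> is irreducible over \<open>K(X)\<close>, which the coprimality
  conditions on the multiplicities of \<open>f\<close> ensure.
\<close>
definition function_field :: "'a :: field poly \<Rightarrow> nat \<Rightarrow> 'a poly fract poly ring" where
  "function_field f N =
     \<lparr>carrier = {h. degree h < N},
      monoid.mult = (\<lambda>g h. (g * h) mod curve_poly f N),
      one = 1, ring.zero = 0, ring.add = (+)\<rparr>"

definition nonzero_functions :: "'a :: field poly \<Rightarrow> nat \<Rightarrow> 'a poly fract poly set" where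
  "nonzero_functions f N = carrier (function_field f N) - {0}"

definition const_fun :: "'a :: field \<Rightarrow> 'a poly fract poly" where
  "const_fun c = [:to_fract [:c:]:]"

definition X_fun :: "'a :: field poly fract poly" where
  "X_fun = [:to_fract [:0, 1:]:]"

definition Y_fun :: "'a :: field poly fract poly" where
  "Y_fun = [:0, 1:]"

text \<open>
  A point is represented by its order function \<open>h \<mapsto> ord\<^sub>P h\<close>, a normalised (i.e. surjective)
  discrete valuation that is trivial on \<open>K\<close>. Instead of taking the value \<open>\<infinity>\<close> at \<open>0\<close>, it is
  considered on nonzero functions only; extensionality makes equality of points equality of
  valuations.
\<close>
type_synonym 'a point = "'a poly fract poly \<Rightarrow> int"

definition curve_points :: "'a :: field poly \<Rightarrow> nat \<Rightarrow> 'a point set" where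
  "curve_points f N =
     {v \<in> extensional (nonzero_functions f N).
        (\<forall>g \<in> nonzero_functions f N. \<forall>h \<in> nonzero_functions f N.
           v (g \<otimes>\<^bsub>function_field f N\<^esub> h) = v g + v h) \<and>
        (\<forall>g \<in> nonzero_functions f N. \<forall>h \<in> nonzero_functions f N.
           g + h \<noteq> 0 \<longrightarrow> min (v g) (v h) \<le> v (g + h)) \<and>
        (\<forall>c. c \<noteq> 0 \<longrightarrow> v (const_fun c) = 0) \<and>
        v ` nonzero_functions f N = UNIV}"

definition affine_point :: "'a :: field poly \<Rightarrow> nat \<Rightarrow> 'a \<Rightarrow> 'a \<Rightarrow> 'a point" where
  "affine_point f N a b =
     (THE P. P \<in> curve_points f N \<and>
             P (X_fun - const_fun a) > 0 \<and> P (Y_fun - const_fun b) > 0)"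

text \<open>
  A point lies above \<open>\<infinity> \<in> \<P>\<^sup>1\<close> iff \<open>X\<close> has a pole there.
\<close>
definition infinity_point :: "'a :: field poly \<Rightarrow> nat \<Rightarrow> 'a point" where
  "infinity_point f N = (THE P. P \<in> curve_points f N \<and> P X_fun < 0)"

definition divisor_degree :: "('p \<Rightarrow>\<^sub>0 int) \<Rightarrow> int" where
  "divisor_degree D = (\<Sum>P\<in>Poly_Mapping.keys D. Poly_Mapping.lookup D P)"

definition degree_zero_divisors :: "'a :: field poly \<Rightarrow> nat \<Rightarrow> ('a point \<Rightarrow>\<^sub>0 int) monoid" where
  "degree_zero_divisors f N =
     (free_Abelian_group (curve_points f N))
       \<lparr>carrier := {D \<in> carrier (free_Abelian_group (curve_points f N)). divisor_degree D = 0}\<rparr>"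

definition principal_divisors :: "'a :: field poly \<Rightarrow> nat \<Rightarrow> ('a point \<Rightarrow>\<^sub>0 int) set" where
  "principal_divisors f N =
     {D \<in> carrier (free_Abelian_group (curve_points f N)).
        \<exists>h \<in> nonzero_functions f N. \<forall>P \<in> curve_points f N. Poly_Mapping.lookup D P = P h}"

text \<open>The group \<open>J\<^sub>N(K) = Pic\<^sup>0(C)\<close>; its elements are the linear equivalence classes, as sets
  of divisors.\<close>
definition Pic0 :: "'a :: field poly \<Rightarrow> nat \<Rightarrow> ('a point \<Rightarrow>\<^sub>0 int) set monoid" where
  "Pic0 f N = degree_zero_divisors f N Mod principal_divisors f N"

definition divisor_class ::
  "'a :: field poly \<Rightarrow> nat \<Rightarrow> ('a point \<Rightarrow>\<^sub>0 int) \<Rightarrow> ('a point \<Rightarrow>\<^sub>0 int) set" where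
  "divisor_class f N D = principal_divisors f N #>\<^bsub>degree_zero_divisors f N\<^esub> D"

text \<open>The pullback \<open>h(X, Y) \<mapsto> h(X, \<xi> Y)\<close> of functions along \<open>\<delta> : (X, Y) \<mapsto> (X, \<xi> Y)\<close>; it
  preserves the \<open>Y\<close>-degree, hence needs no reduction modulo \<open>Y^N - f\<close>.\<close>
definition delta_pullback :: "'a :: field \<Rightarrow> 'a poly fract poly \<Rightarrow> 'a poly fract poly" where
  "delta_pullback \<xi> h = pcompose h [:0, to_fract [:\<xi>:]:]"

text \<open>On points, \<open>\<delta>\<close> is determined by \<open>ord\<^bsub>\<delta> P\<^esub> h = ord\<^sub>P (h \<circ> \<delta>)\<close>.\<close>
definition delta_point :: "'a :: field poly \<Rightarrow> nat \<Rightarrow> 'a \<Rightarrow> 'a point \<Rightarrow> 'a point" where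
  "delta_point f N \<xi> P = restrict (\<lambda>h. P (delta_pullback \<xi> h)) (nonzero_functions f N)"

definition delta_divisor ::
  "'a :: field poly \<Rightarrow> nat \<Rightarrow> 'a \<Rightarrow> ('a point \<Rightarrow>\<^sub>0 int) \<Rightarrow> ('a point \<Rightarrow>\<^sub>0 int)" where
  "delta_divisor f N \<xi> = frag_extend (\<lambda>P. frag_of (delta_point f N \<xi> P))"

text \<open>Push-forward permutes the principal divisors, so the image of a linear equivalence class
  is again one.\<close>
definition delta_jac ::
  "'a :: field poly \<Rightarrow> nat \<Rightarrow> 'a \<Rightarrow> ('a point \<Rightarrow>\<^sub>0 int) set \<Rightarrow> ('a point \<Rightarrow>\<^sub>0 int) set" where
  "delta_jac f N \<xi> x = delta_divisor f N \<xi> ` x"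

definition fixed_classes ::
  "'a :: field poly \<Rightarrow> nat \<Rightarrow> 'a \<Rightarrow> ('a point \<Rightarrow>\<^sub>0 int) set set" where
  "fixed_classes f N \<xi> = {x \<in> carrier (Pic0 f N). delta_jac f N \<xi> x = x}"

definition branch_classes ::
  "'a :: field poly \<Rightarrow> nat \<Rightarrow> nat \<Rightarrow> (nat \<Rightarrow> 'a) \<Rightarrow> ('a point \<Rightarrow>\<^sub>0 int) set set" where
  "branch_classes f N n \<alpha> =
     {divisor_class f N
        (frag_cmul b (frag_of (infinity_point f N)) +
         (\<Sum>i=1..n. frag_cmul (a i) (frag_of (affine_point f N (\<alpha> i) 0)))) | b a.
        b + (\<Sum>i=1..n. a i) = 0}"

end

theory Submission
  imports Defs "HOL-Computational_Algebra.Formal_Laurent_Series"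
begin

text \<open>
  \<^emph>\<open>Fixed classes are classes of branch divisors.\<close> If the class of \<open>D\<close> is fixed by \<open>\<delta>\<close>, then
  \<open>\<delta> D - D\<close> is the divisor of a function \<open>h\<close>. The divisor of the norm \<open>\<Prod>k<N. (\<delta>\<^sup>*)\<^sup>k h\<close> telescopes to
  zero; the norm is a rational function of \<open>X\<close>, so it is constant, and since \<open>K\<close> is algebraically
  closed \<open>h\<close> can be scaled to have norm \<open>1\<close>. Hilbert's theorem 90 (\<open>hilbert_90\<close>) writes
  \<open>h = g / \<delta>\<^sup>* g\<close>, and \<open>D - div (\<delta>\<^sup>* g)\<close> is a divisor in the same class that is itself invariant under
  \<open>\<delta>\<close> (\<open>invariant_representative\<close>). Away from the points \<open>Q i\<close> and \<open>\<infinity>\<close> the powers of \<open>\<delta>\<close> permute every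
  fibre of \<open>X\<close> simply transitively, so an invariant divisor is constant on such a fibre and the
  divisor of a rational function of \<open>X\<close> removes it
  (\<open>invariant_divisor_equivalent_to_branch\<close>). What is left is supported on the \<open>Q i\<close> and \<open>\<infinity>\<close>.
  The converse holds because \<open>\<delta>\<close> fixes these points.

  \<^emph>\<open>Structure of the group.\<close> The divisor \<open>\<Sum>i. a i (Q i - \<infinity>)\<close> is principal if and only if
  \<open>a i = N m i + j e i\<close> for some integers \<open>j\<close> and \<open>m i\<close> (\<open>branch_divisor_principal_iff\<close>). Such a
  divisor belongs to \<open>(\<Prod>i. (X - \<alpha> i)^(m i)) Y^j\<close>. Conversely, if \<open>div h\<close> is invariant under \<open>\<delta>\<close>, then every
  nonzero component \<open>h\<^sub>j Y^j\<close> of \<open>h\<close> is a combination of the functions \<open>(\<delta>\<^sup>*)\<^sup>k h\<close>, all of which have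
  the same divisor as \<open>h\<close>; so its divisor is at least \<open>div h\<close>, and they agree because both have degree
  zero. The group is therefore the quotient of \<open>(\<int>/N)\<^sup>n\<close> by the multiples of \<open>(e 1, \<dots>, e n)\<close>, and since
  \<open>e n\<close> is a unit modulo \<open>N\<close> every class has exactly one representative with \<open>a n = 0\<close>.

  \<^emph>\<open>The points.\<close> All of this rests on a description of the discrete valuations of the function
  field. They exist because the field embeds into Laurent series: \<open>X\<close> goes to \<open>\<alpha> i + t^N\<close>, to \<open>t^(-N)\<close>,
  or to \<open>a + t\<close> when \<open>f(a) \<noteq> 0\<close>, and \<open>Y\<close> to an \<open>N\<close>-th root of the image of \<open>f\<close>
  (\<open>embedding_exists\<close>). The first two kinds are the only valuations over \<open>\<alpha> i\<close> and \<open>\<infinity>\<close>: by the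
  coprimality conditions the terms \<open>h\<^sub>j Y^j\<close> of a function have values in distinct classes modulo \<open>N\<close>,
  so the value of a sum is the least value of its terms (\<open>branch_place_unique\<close>). The same
  observation shows that \<open>Y^N - f\<close> is prime (\<open>c_prime\<close>). Over \<open>a\<close> with \<open>f(a) \<noteq> 0\<close>, a valuation is
  determined by the value \<open>b\<close> of \<open>Y\<close>, because \<open>Y - b\<close> is a multiple of \<open>X - a\<close> by an element regular
  at \<open>(a, b)\<close> (\<open>unbranched_place_unique\<close>). Adding up the orders of \<open>h\<close> over a fibre gives the order
  of its norm on the projective line (\<open>sum_fibre\<close>), whence principal divisors have degree zero.

  Functions are represented throughout by arbitrary elements of \<open>K(X)[Y]\<close>, with \<open>Y^N - f\<close> written \<open>c\<close>,
  and compared modulo \<open>c\<close>, so that products of functions are products of polynomials; \<open>nz h\<close> says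
  that \<open>h\<close> represents a nonzero function.
\<close>

section \<open>Extending homomorphisms to polynomials and fractions\<close>

locale comm_ring_map =
  fixes \<phi> :: "'b :: comm_ring_1 \<Rightarrow> 'c :: comm_ring_1"
  assumes map_1 [simp]: "\<phi> 1 = 1"
    and map_add [simp]: "\<phi> (a + b) = \<phi> a + \<phi> b"
    and map_mult [simp]: "\<phi> (a * b) = \<phi> a * \<phi> b"
begin

lemma map_0 [simp]: "\<phi> 0 = 0"
  using map_add[of 0 0] by simp

lemma map_minus [simp]: "\<phi> (- a) = - \<phi> a"
  using map_add[of a "- a"] by (simp add: eq_neg_iff_add_eq_0 add.commute)

lemma map_diff [simp]: "\<phi> (a - b) = \<phi> a - \<phi> b"
  using map_add[of a "- b"] by simp

lemma map_power [simp]: "\<phi> (a ^ k) = \<phi> a ^ k"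
  by (induction k) auto

lemma map_sum: "\<phi> (sum g A) = (\<Sum>i\<in>A. \<phi> (g i))"
  by (induction A rule: infinite_finite_induct) auto

lemma map_prod: "\<phi> (prod g A) = (\<Prod>i\<in>A. \<phi> (g i))"
  by (induction A rule: infinite_finite_induct) auto

text \<open>Extend \<open>\<phi>\<close> to coefficients and evaluate at \<open>y\<close>. With \<open>\<phi>\<close> the constants this gives \<open>X \<mapsto> x\<close> on
  \<open>K[X]\<close>; with \<open>\<phi>\<close> a map on \<open>K(X)\<close> it gives \<open>Y \<mapsto> y\<close> on \<open>K(X)[Y]\<close>.\<close>
lemma poly_eval: "comm_ring_map (\<lambda>p. poly (map_poly \<phi> p) y)"
proof -
  have add: "map_poly \<phi> (p + q) = map_poly \<phi> p + map_poly \<phi> q" for p q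
    by (intro poly_eqI) (simp add: coeff_map_poly)
  have smult: "map_poly \<phi> (smult a q) = smult (\<phi> a) (map_poly \<phi> q)" for a q
    by (intro poly_eqI) (simp add: coeff_map_poly)
  have mult: "poly (map_poly \<phi> (p * q)) y = poly (map_poly \<phi> p) y * poly (map_poly \<phi> q) y" for p q
    by (induction p)
       (simp_all add: mult_pCons_left add smult map_poly_pCons algebra_simps)
  show ?thesis
    by unfold_locales (simp_all add: add mult)
qed

end

text \<open>The numerator and denominator are chosen arbitrarily, as this needs no notion of reduced
  fraction. The result does not depend on the choice when \<open>\<phi>\<close> is injective.\<close>
definition fract_extension :: "('b :: idom \<Rightarrow> 'c :: field) \<Rightarrow> 'b fract \<Rightarrow> 'c" where
  "fract_extension \<phi> q = (let ab = (SOME ab. snd ab \<noteq> 0 \<and> q = Fract (fst ab) (snd ab))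
     in \<phi> (fst ab) / \<phi> (snd ab))"

lemma
  fixes \<phi> :: "'a :: idom \<Rightarrow> 'b :: field"
  assumes "comm_ring_map \<phi>" and inj: "\<And>a. \<phi> a = 0 \<Longrightarrow> a = 0"
  shows fract_extension_Fract: "b \<noteq> 0 \<Longrightarrow> fract_extension \<phi> (Fract a b) = \<phi> a / \<phi> b"
    and fract_extension_to_fract: "fract_extension \<phi> (to_fract a) = \<phi> a"
    and fract_extension_hom: "comm_ring_map (fract_extension \<phi>)"
proof -
  interpret comm_ring_map \<phi> by fact
  have nz: "\<phi> b \<noteq> 0" if "b \<noteq> 0" for b
    using inj that by blast
  show Fr: "fract_extension \<phi> (Fract a b) = \<phi> a / \<phi> b" if b: "b \<noteq> 0" for a b
  proof -
    define P where "P = (\<lambda>ab. snd ab \<noteq> 0 \<and> Fract a b = Fract (fst ab) (snd ab))"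
    define cd where "cd = (SOME ab. P ab)"
    have "P (a, b)"
      using b by (simp add: P_def)
    hence "P cd"
      unfolding cd_def by (rule someI)
    hence cd1: "snd cd \<noteq> 0" and cd: "a * snd cd = fst cd * b"
      using b eq_fract(1)[OF b, of "snd cd" a "fst cd"] by (auto simp: P_def)
    have "\<phi> a * \<phi> (snd cd) = \<phi> (fst cd) * \<phi> b"
      using cd by (metis map_mult)
    hence "\<phi> (fst cd) / \<phi> (snd cd) = \<phi> a / \<phi> b"
      using nz[OF b] nz[OF cd1] by (simp add: field_simps)
    moreover have "fract_extension \<phi> (Fract a b) = \<phi> (fst cd) / \<phi> (snd cd)"
      by (simp add: fract_extension_def Let_def cd_def P_def)
    ultimately show ?thesis
      by simp
  qed
  show "fract_extension \<phi> (to_fract a) = \<phi> a"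
    by (simp add: to_fract_def Fr)
  show "comm_ring_map (fract_extension \<phi>)"
  proof
    show "fract_extension \<phi> 1 = 1"
      by (simp add: One_fract_def Fr)
    fix u v :: "'a fract"
    obtain a b where u: "u = Fract a b" "b \<noteq> 0" by (cases u)
    obtain c d where v: "v = Fract c d" "d \<noteq> 0" by (cases v)
    show "fract_extension \<phi> (u + v) = fract_extension \<phi> u + fract_extension \<phi> v"
      using u v nz by (simp add: Fr divide_simps)
    show "fract_extension \<phi> (u * v) = fract_extension \<phi> u * fract_extension \<phi> v"
      using u v nz by (simp add: Fr divide_simps)
  qed
qed

section \<open>Orders of rational functions on the projective line\<close>

text \<open>Over an algebraically closed field \<open>K(X)\<^sup>*\<close> is generated by the constants and the \<open>X - r\<close>. This is
  how all valuations of \<open>K(X)\<close> are identified below. The polynomial version only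
  looks at the roots of \<open>p\<close>, which is needed to sum orders over a finite set of points.\<close>
lemma additive_fract_eqI:
  fixes w w' :: "'a :: alg_closed_field poly fract \<Rightarrow> int"
  assumes add: "\<And>u v. u \<noteq> 0 \<Longrightarrow> v \<noteq> 0 \<Longrightarrow> w (u * v) = w u + w v"
    and add': "\<And>u v. u \<noteq> 0 \<Longrightarrow> v \<noteq> 0 \<Longrightarrow> w' (u * v) = w' u + w' v"
    and const: "\<And>k. k \<noteq> 0 \<Longrightarrow> w (to_fract [:k:]) = w' (to_fract [:k:])"
  shows additive_fract_eqI_poly:
     "p \<noteq> 0 \<Longrightarrow> (\<And>r. poly p r = 0 \<Longrightarrow> w (to_fract [:-r, 1:]) = w' (to_fract [:-r, 1:])) \<Longrightarrow>
        w (to_fract p) = w' (to_fract p)"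
    and "u \<noteq> 0 \<Longrightarrow> (\<And>r. w (to_fract [:-r, 1:]) = w' (to_fract [:-r, 1:])) \<Longrightarrow> w u = w' u"
proof -
  show *: "w (to_fract p) = w' (to_fract p)"
    if p: "p \<noteq> 0" and lin: "\<And>r. poly p r = 0 \<Longrightarrow> w (to_fract [:-r, 1:]) = w' (to_fract [:-r, 1:])"
    for p
    using p lin
  proof (induction "degree p" arbitrary: p)
    case 0
    then obtain k where "p = [:k:]" "k \<noteq> 0"
      by (metis degree_0_id degree_eq_zeroE pCons_0_0)
    thus ?case using const by simp
  next
    case (Suc d)
    obtain r where r: "poly p r = 0"
      using alg_closed_imp_poly_has_root[of p] Suc.hyps by auto
    then obtain q where q: "p = [:-r, 1:] * q"
      by (auto simp: poly_eq_0_iff_dvd)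
    have "q \<noteq> 0"
      using q Suc.prems by auto
    moreover have "degree p = degree [:-r, 1:] + degree q"
      unfolding q by (rule degree_mult_eq) (use \<open>q \<noteq> 0\<close> in auto)
    hence "d = degree q"
      using Suc.hyps(2) by simp
    moreover have "w (to_fract [:-s, 1:]) = w' (to_fract [:-s, 1:])" if "poly q s = 0" for s
      using Suc.prems(2)[of s] q that by simp
    ultimately have "w (to_fract q) = w' (to_fract q)"
      using Suc.hyps(1)[of q] by blast
    moreover have "to_fract p = to_fract [:-r, 1:] * to_fract q"
      unfolding q by (rule to_fract_mult)
    ultimately show ?case
      using add[of "to_fract [:-r, 1:]" "to_fract q"] add'[of "to_fract [:-r, 1:]" "to_fract q"]
        Suc.prems(2)[OF r] \<open>q \<noteq> 0\<close> by simp
  qed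
  assume u: "u \<noteq> 0" and lin: "\<And>r. w (to_fract [:-r, 1:]) = w' (to_fract [:-r, 1:])"
  obtain p q where pq: "u = Fract p q" "q \<noteq> 0" by (cases u)
  have "p \<noteq> 0"
    using u pq by (auto simp: fract_collapse)
  have eq: "u * to_fract q = to_fract p"
    using pq by (simp add: Fract_conv_to_fract)
  have "w u + w (to_fract q) = w' u + w' (to_fract q)"
    using add[of u "to_fract q"] add'[of u "to_fract q"] *[OF \<open>p \<noteq> 0\<close> lin] u pq(2)
    by (simp add: eq)
  thus "w u = w' u"
    using *[OF \<open>q \<noteq> 0\<close> lin] by simp
qed

lemma comm_ring_map_fls_const: "comm_ring_map (fls_const :: 'a :: comm_ring_1 \<Rightarrow> 'a fls)"
  by unfold_locales (simp_all add: fls_plus_const)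

text \<open>The homomorphism \<open>X \<mapsto> x\<close> from \<open>K(X)\<close> to Laurent series, for \<open>x\<close> not constant.\<close>
definition fract_at :: "'a :: field fls \<Rightarrow> 'a poly fract \<Rightarrow> 'a fls" where
  "fract_at x = fract_extension (\<lambda>p. poly (map_poly fls_const p) x)"

lemma
  fixes x :: "'a :: alg_closed_field fls"
  assumes x: "\<And>r. x \<noteq> fls_const r"
  shows fract_at_hom: "comm_ring_map (fract_at x)"
    and fract_at_const: "fract_at x (to_fract [:k:]) = fls_const k"
    and fract_at_linear: "fract_at x (to_fract [:-r, 1:]) = x - fls_const r"
    and fract_at_X: "fract_at x (to_fract [:0, 1:]) = x"
    and fract_at_eq_0_iff [simp]: "fract_at x u = 0 \<longleftrightarrow> u = 0"
proof -
  interpret c: comm_ring_map "fls_const :: 'a \<Rightarrow> 'a fls"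
    by (rule comm_ring_map_fls_const)
  interpret p: comm_ring_map "\<lambda>p. poly (map_poly (fls_const :: 'a \<Rightarrow> 'a fls) p) x"
    by (rule c.poly_eval)
  have nz: "p = 0" if "poly (map_poly (fls_const :: 'a \<Rightarrow> 'a fls) p) x = 0" for p
  proof (rule ccontr)
    assume "p \<noteq> 0"
    then obtain A where A: "p = smult (lead_coeff p) (\<Prod>r\<in>#A. [:-r, 1:])"
      using alg_closed_imp_factorization by blast
    have "poly (map_poly fls_const (\<Prod>r\<in>#A. [:-r, 1:])) x \<noteq> 0"
    proof (induction A)
      case (add r A)
      have "poly (map_poly fls_const [:-r, 1:]) x \<noteq> 0"
        using x[of r] by (simp add: map_poly_pCons)
      thus ?case
        using add.IH by (simp only: image_mset_add_mset prod_mset.add_mset p.map_mult) simp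
    qed simp
    moreover have "p = [:lead_coeff p:] * (\<Prod>r\<in>#A. [:-r, 1:])"
      using A by simp
    hence "poly (map_poly fls_const p) x = poly (map_poly fls_const [:lead_coeff p:]) x *
            poly (map_poly fls_const (\<Prod>r\<in>#A. [:-r, 1:])) x"
      by (metis p.map_mult)
    ultimately show False
      using that \<open>p \<noteq> 0\<close> by (simp add: map_poly_pCons)
  qed
  show hom: "comm_ring_map (fract_at x)"
    unfolding fract_at_def by (rule fract_extension_hom[OF p.comm_ring_map_axioms nz])
  have tf: "fract_at x (to_fract a) = poly (map_poly fls_const a) x" for a
    unfolding fract_at_def by (rule fract_extension_to_fract[OF p.comm_ring_map_axioms nz])
  show "fract_at x (to_fract [:k:]) = fls_const k"
    "fract_at x (to_fract [:-r, 1:]) = x - fls_const r"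
    "fract_at x (to_fract [:0, 1:]) = x"
    by (simp_all add: tf map_poly_pCons)
  interpret F: comm_ring_map "fract_at x" by (rule hom)
  show "fract_at x u = 0 \<longleftrightarrow> u = 0"
    by (metis F.map_0 F.map_1 F.map_mult mult_zero_left right_inverse zero_neq_one)
qed

text \<open>Points of the projective line are options, \<open>None\<close> being \<open>\<infinity>\<close>. The series is the expansion of \<open>X\<close> in
  an \<open>m\<close>-th root of a local parameter: \<open>m = 1\<close> on the line itself and \<open>m = N\<close> at the branch points of the
  curve.\<close>
definition local_coord :: "nat \<Rightarrow> 'a option \<Rightarrow> 'a :: field fls" where
  "local_coord m p = (case p of None \<Rightarrow> fls_X_inv ^ m | Some a \<Rightarrow> fls_const a + fls_X ^ m)"

definition order_at :: "'a option \<Rightarrow> 'a :: field poly fract \<Rightarrow> int" where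
  "order_at p u = fls_subdegree (fract_at (local_coord 1 p) u)"

text \<open>The order of \<open>X - r\<close> at \<open>p\<close>.\<close>
definition linear_order :: "'a option \<Rightarrow> 'a \<Rightarrow> int" where
  "linear_order p r = (case p of None \<Rightarrow> -1 | Some a \<Rightarrow> if a = r then 1 else 0)"

lemma subdegree_local_coord:
  assumes m: "m > 0"
  shows "fls_subdegree (local_coord m p - fls_const r) = int m * linear_order p r"
    and "local_coord m p \<noteq> fls_const r"
proof -
  have *: "fls_subdegree (local_coord m p - fls_const r) = int m * linear_order p r \<and>
    local_coord m p \<noteq> fls_const r"
  proof (cases p)
    case None
    have sd: "fls_subdegree (fls_X_inv ^ m :: 'a fls) = - int m"
      by simp
    hence "fls_subdegree (fls_X_inv ^ m - fls_const r) = - int m"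
      using m by (subst fls_subdegree_diff_eq1) auto
    thus ?thesis
      using None m sd by (auto simp: local_coord_def linear_order_def)
  next
    case (Some a)
    have sd: "fls_subdegree (fls_X ^ m :: 'a fls) = int m"
      by simp
    show ?thesis
    proof (cases "a = r")
      case True
      thus ?thesis
        using Some by (simp add: local_coord_def linear_order_def)
    next
      case False
      have "local_coord m p - fls_const r = fls_const (a - r) + fls_X ^ m"
        using Some fls_plus_const[of "a - r" r] by (simp add: local_coord_def algebra_simps)
      moreover have "fls_subdegree (fls_const (a - r) + fls_X ^ m) = 0"
        using False m by (subst fls_subdegree_add_eq1) auto
      moreover have "fls_nth (fls_const (a - r) + fls_X ^ m) 0 \<noteq> 0"
        using False m fls_eq0_below_subdegree[of 0 "fls_X ^ m :: 'a fls"] by (simp add: sd)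
      moreover from this have "fls_const (a - r) + fls_X ^ m \<noteq> 0"
        by (rule fls_nonzeroI)
      ultimately show ?thesis
        using Some False by (auto simp: linear_order_def)
    qed
  qed
  from * show "fls_subdegree (local_coord m p - fls_const r) = int m * linear_order p r"
    and "local_coord m p \<noteq> fls_const r" by blast+
qed

lemma subdegree_fract_at_local_coord:
  fixes u :: "'a :: alg_closed_field poly fract"
  assumes m: "m > 0" and "u \<noteq> 0"
  shows "fls_subdegree (fract_at (local_coord m p) u) = int m * order_at p u"
proof (rule additive_fract_eqI(2)[OF _ _ _ \<open>u \<noteq> 0\<close>,
    where w = "\<lambda>u. fls_subdegree (fract_at (local_coord m p) u)" and w' = "\<lambda>u. int m * order_at p u"])
  note nc = subdegree_local_coord(2)[OF m, of p]
  note nc1 = subdegree_local_coord(2)[of 1 p, simplified]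
  interpret F: comm_ring_map "fract_at (local_coord m p)"
    by (rule fract_at_hom[OF nc])
  interpret F1: comm_ring_map "fract_at (local_coord 1 p)"
    by (rule fract_at_hom) (use nc1 in simp)
  show "fls_subdegree (fract_at (local_coord m p) (u * v)) =
      fls_subdegree (fract_at (local_coord m p) u) + fls_subdegree (fract_at (local_coord m p) v)"
    if "u \<noteq> 0" "v \<noteq> 0" for u v
    using that nc by simp
  show "int m * order_at p (u * v) = int m * order_at p u + int m * order_at p v"
    if "u \<noteq> 0" "v \<noteq> 0" for u v
    using that nc1 F1.map_mult by (simp add: order_at_def distrib_left)
  show "fls_subdegree (fract_at (local_coord m p) (to_fract [:k:])) = int m * order_at p (to_fract [:k:])" for k
    using nc nc1 by (simp add: order_at_def fract_at_const)
  show "fls_subdegree (fract_at (local_coord m p) (to_fract [:- r, 1:])) = int m * order_at p (to_fract [:- r, 1:])"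
    for r
    using nc nc1 subdegree_local_coord(1)[OF m] subdegree_local_coord(1)[of 1 p r]
    by (simp add: order_at_def fract_at_linear)
qed

lemma
  fixes u v :: "'a :: alg_closed_field poly fract"
  shows order_at_mult: "u \<noteq> 0 \<Longrightarrow> v \<noteq> 0 \<Longrightarrow> order_at p (u * v) = order_at p u + order_at p v"
    and order_at_const: "order_at p (to_fract [:k:]) = 0"
    and order_at_linear: "order_at p (to_fract [:-r, 1:]) = linear_order p r"
proof -
  note nc1 = subdegree_local_coord(2)[of 1 p, simplified]
  interpret F1: comm_ring_map "fract_at (local_coord 1 p)"
    by (rule fract_at_hom) (use nc1 in simp)
  show "u \<noteq> 0 \<Longrightarrow> v \<noteq> 0 \<Longrightarrow> order_at p (u * v) = order_at p u + order_at p v"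
    "order_at p (to_fract [:k:]) = 0" "order_at p (to_fract [:-r, 1:]) = linear_order p r"
    using nc1 F1.map_mult subdegree_local_coord(1)[of 1 p r]
    by (simp_all add: order_at_def fract_at_const fract_at_linear)
qed

lemma order_at_1 [simp]: "order_at p 1 = (0 :: int)" for p :: "'a :: alg_closed_field option"
  by (metis order_at_const one_pCons to_fract_1)

lemma order_at_inverse:
  "u \<noteq> 0 \<Longrightarrow> order_at p (inverse u) = - order_at p u" for u :: "'a :: alg_closed_field poly fract"
  using order_at_mult[of u "inverse u" p] by simp

lemma order_at_power: "u \<noteq> 0 \<Longrightarrow> order_at p (u ^ k) = int k * order_at p u"
  for u :: "'a :: alg_closed_field poly fract"
  by (induction k) (simp_all add: order_at_mult algebra_simps)

lemma order_at_prod: "finite A \<Longrightarrow> (\<And>i. i \<in> A \<Longrightarrow> u i \<noteq> 0) \<Longrightarrow>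
   order_at p (\<Prod>i\<in>A. u i) = (\<Sum>i\<in>A. order_at p (u i))"
  for u :: "'i \<Rightarrow> 'a :: alg_closed_field poly fract"
  by (induction A rule: finite_induct) (simp_all add: order_at_mult)

lemma order_at_poly_nonroot:
  fixes p :: "'a :: alg_closed_field poly"
  assumes "poly p a \<noteq> 0"
  shows "order_at (Some a) (to_fract p) = 0"
proof (rule additive_fract_eqI_poly[where w' = "\<lambda>_. 0" and w = "order_at (Some a)"])
  show "p \<noteq> 0"
    using assms by auto
  show "order_at (Some a) (to_fract [:- r, 1:]) = 0" if "poly p r = 0" for r
    using that assms by (auto simp: order_at_linear linear_order_def)
qed (simp_all add: order_at_mult order_at_const)

text \<open>A rational function has as many zeros as poles: both sides are additive, so it suffices to look at
  \<open>X - r\<close>, with its zero at \<open>r\<close> and its pole at \<open>\<infinity>\<close>.\<close>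
lemma fract_product_formula:
  fixes u :: "'a :: alg_closed_field poly fract"
  assumes "u \<noteq> 0"
  shows "finite {p. order_at p u \<noteq> 0}" and "(\<Sum>p | order_at p u \<noteq> 0. order_at p u) = 0"
proof -
  have polysum: "(\<Sum>i\<in>Z. order_at i (to_fract p)) = 0"
    if Z: "finite Z" "None \<in> Z" "Some ` {a. poly p a = 0} \<subseteq> Z" and p: "p \<noteq> 0"
    for p :: "'a poly" and Z
  proof (rule additive_fract_eqI_poly[where w' = "\<lambda>_. 0" and w = "\<lambda>p. (\<Sum>i\<in>Z. order_at i p)"])
    show "p \<noteq> 0" by fact
    show "(\<Sum>i\<in>Z. order_at i (to_fract [:- r, 1:])) = 0" if "poly p r = 0" for r
    proof -
      have "(\<Sum>i\<in>Z. order_at i (to_fract [:- r, 1:])) = (\<Sum>i\<in>{None, Some r}. order_at i (to_fract [:- r, 1:]))"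
        by (rule sum.mono_neutral_right)
           (use Z that in \<open>auto simp: order_at_linear linear_order_def split: option.splits\<close>)
      thus ?thesis by (simp add: order_at_linear linear_order_def)
    qed
  qed (auto simp: order_at_mult sum.distrib order_at_const)
  obtain p q where pq: "u = Fract p q" "q \<noteq> 0" by (cases u)
  have "p \<noteq> 0"
    using assms pq by (auto simp: fract_collapse)
  have "u * to_fract q = to_fract p"
    using pq by (simp add: Fract_conv_to_fract)
  hence ord: "order_at i u = order_at i (to_fract p) - order_at i (to_fract q)" for i
    using order_at_mult[of u "to_fract q" i] pq assms by simp
  define Z where "Z = insert None (Some ` ({a. poly p a = 0} \<union> {a. poly q a = 0}))"
  have fin: "finite Z"
    using \<open>p \<noteq> 0\<close> \<open>q \<noteq> 0\<close> by (simp add: Z_def poly_roots_finite)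
  have sub: "{i. order_at i u \<noteq> 0} \<subseteq> Z"
  proof
    fix i assume i: "i \<in> {i. order_at i u \<noteq> 0}"
    show "i \<in> Z"
    proof (cases i)
      case (Some a)
      thus ?thesis
        using i order_at_poly_nonroot[of p a] order_at_poly_nonroot[of q a] by (cases "poly p a = 0"; cases "poly q a = 0") (auto simp: Z_def ord)
    qed (simp add: Z_def)
  qed
  show "finite {p. order_at p u \<noteq> 0}"
    using finite_subset[OF sub fin] .
  have "(\<Sum>p | order_at p u \<noteq> 0. order_at p u) = (\<Sum>i\<in>Z. order_at i u)"
    by (rule sum.mono_neutral_left) (use sub fin in auto)
  also have "\<dots> = (\<Sum>i\<in>Z. order_at i (to_fract p)) - (\<Sum>i\<in>Z. order_at i (to_fract q))"
    by (simp add: ord sum_subtractf)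
  also have "\<dots> = 0"
  proof -
    have "None \<in> Z" "Some ` {a. poly p a = 0} \<subseteq> Z" "Some ` {a. poly q a = 0} \<subseteq> Z"
      by (auto simp: Z_def)
    thus ?thesis
      using polysum[OF fin, of p] polysum[OF fin, of q] \<open>p \<noteq> 0\<close> \<open>q \<noteq> 0\<close> by simp
  qed
  finally show "(\<Sum>p | order_at p u \<noteq> 0. order_at p u) = 0" .
qed

lemma order_at_poly_nonneg:
  fixes q :: "'a :: alg_closed_field poly"
  shows "0 \<le> order_at (Some a) (to_fract q)"
proof -
  define x where "x = (local_coord 1 (Some a) :: 'a fls)"
  have nc: "x \<noteq> fls_const r" for r
    unfolding x_def by (rule subdegree_local_coord(2)) simp
  interpret F: comm_ring_map "fract_at x"
    by (rule fract_at_hom[OF nc])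
  have add: "0 \<le> fls_subdegree (g + h)" if "0 \<le> fls_subdegree g" "0 \<le> fls_subdegree h" for g h :: "'a fls"
    using fls_plus_subdegree[of g h] that by (cases "g + h = 0") auto
  have mult: "0 \<le> fls_subdegree (g * h)" if "0 \<le> fls_subdegree g" "0 \<le> fls_subdegree h" for g h :: "'a fls"
    using that by (cases "g = 0 \<or> h = 0") auto
  have x: "0 \<le> fls_subdegree x"
    unfolding x_def local_coord_def option.case by (rule add) auto
  have "0 \<le> fls_subdegree (fract_at x (to_fract q))"
  proof (induction q)
    case (pCons k q)
    have "pCons k q = [:k:] + [:0, 1:] * q"
      by simp
    hence "to_fract (pCons k q) = to_fract [:k:] + to_fract [:0, 1:] * to_fract q"
      by (metis to_fract_add to_fract_mult)
    hence "fract_at x (to_fract (pCons k q)) = fls_const k + x * fract_at x (to_fract q)"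
      by (simp add: fract_at_const[OF nc] fract_at_X[OF nc])
    thus ?case
      using add mult x pCons.IH by simp
  qed simp
  thus ?thesis
    by (simp add: order_at_def x_def)
qed

lemma order_at_poly_factor:
  fixes q :: "'a :: alg_closed_field poly"
  assumes "q \<noteq> 0"
  shows "order_at p (to_fract ([:-a, 1:] * q)) = linear_order p a + order_at p (to_fract q)"
  using assms order_at_mult[of "to_fract [:-a, 1:]" "to_fract q" p]
  by (simp add: order_at_linear del: mult_pCons_left flip: to_fract_mult)

text \<open>Common roots are removed one at a time, as numerator and denominator of a fraction are not
  assumed coprime.\<close>
lemma same_orders_imp_const_multiple:
  fixes p q :: "'a :: alg_closed_field poly"
  assumes "p \<noteq> 0" "q \<noteq> 0" "\<And>a. order_at (Some a) (to_fract p) = order_at (Some a) (to_fract q)"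
  shows "\<exists>k. k \<noteq> 0 \<and> p = smult k q"
  using assms
proof (induction "degree p" arbitrary: p q)
  case 0
  then obtain k where k: "p = [:k:]" "k \<noteq> 0"
    by (metis degree_eq_zeroE pCons_0_0)
  have "degree q = 0"
  proof (rule ccontr)
    assume "degree q \<noteq> 0"
    then obtain a where "poly q a = 0"
      using alg_closed_imp_poly_has_root[of q] by auto
    then obtain q' where q': "q = [:-a, 1:] * q'"
      by (auto simp: poly_eq_0_iff_dvd)
    hence "q' \<noteq> 0" using 0 by auto
    from order_at_poly_factor[OF this, of "Some a" a] show False
      using 0(4)[of a] k order_at_poly_nonneg[of a q'] q'
      by (simp add: linear_order_def order_at_const del: mult_pCons_left)
  qed
  then obtain l where "q = [:l:]" "l \<noteq> 0"
    using 0 by (metis degree_eq_zeroE pCons_0_0)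
  thus ?case
    using k by (intro exI[of _ "k / l"]) simp
next
  case (Suc d)
  obtain a where a: "poly p a = 0"
    using alg_closed_imp_poly_has_root[of p] Suc.hyps by auto
  then obtain p' where p': "p = [:-a, 1:] * p'"
    by (auto simp: poly_eq_0_iff_dvd)
  have "p' \<noteq> 0" using p' Suc.prems by auto
  have "order_at (Some a) (to_fract p) > 0"
    using order_at_poly_factor[OF \<open>p' \<noteq> 0\<close>, of "Some a" a] order_at_poly_nonneg[of a p']
    by (simp add: p' linear_order_def del: mult_pCons_left)
  hence "poly q a = 0"
    using order_at_poly_nonroot[of q a] Suc.prems(3)[of a] by auto
  then obtain q' where q': "q = [:-a, 1:] * q'"
    by (auto simp: poly_eq_0_iff_dvd)
  have "q' \<noteq> 0" using q' Suc.prems by auto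
  have "degree p = degree [:-a, 1:] + degree p'"
    unfolding p' by (rule degree_mult_eq) (use \<open>p' \<noteq> 0\<close> in auto)
  hence "d = degree p'"
    using Suc.hyps(2) by simp
  moreover have "order_at (Some b) (to_fract p') = order_at (Some b) (to_fract q')" for b
    using Suc.prems(3)[of b] order_at_poly_factor[OF \<open>p' \<noteq> 0\<close>, of "Some b" a]
      order_at_poly_factor[OF \<open>q' \<noteq> 0\<close>, of "Some b" a] unfolding p' q' by simp
  ultimately obtain k where "k \<noteq> 0" "p' = smult k q'"
    using Suc.hyps(1)[of p' q'] \<open>p' \<noteq> 0\<close> \<open>q' \<noteq> 0\<close> by blast
  thus ?case
    unfolding p' q' by (intro exI[of _ k]) (simp only: mult_smult_right simp_thms)
qed

lemma fract_without_zeros_const: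
  fixes u :: "'a :: alg_closed_field poly fract"
  assumes "u \<noteq> 0" "\<And>a. order_at (Some a) u = 0"
  obtains k where "k \<noteq> 0" "u = to_fract [:k:]"
proof -
  obtain p q where pq: "u = Fract p q" "q \<noteq> 0" by (cases u)
  have "p \<noteq> 0"
    using assms pq by (auto simp: fract_collapse)
  have eq: "u * to_fract q = to_fract p"
    using pq by (simp add: Fract_conv_to_fract)
  have "order_at (Some a) (to_fract p) = order_at (Some a) (to_fract q)" for a
    using order_at_mult[of u "to_fract q" "Some a"] assms pq(2) by (simp add: eq)
  then obtain k where k: "k \<noteq> 0" "p = smult k q"
    using same_orders_imp_const_multiple \<open>p \<noteq> 0\<close> \<open>q \<noteq> 0\<close> by blast
  have "p = [:k:] * q"
    using k by simp
  hence "u * to_fract q = to_fract [:k:] * to_fract q"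
    unfolding eq by (simp only: to_fract_mult)
  hence "u = to_fract [:k:]"
    using pq(2) by simp
  thus ?thesis
    using that k by blast
qed

lemma fract_with_orders:
  fixes m :: "'a :: alg_closed_field \<Rightarrow> int"
  assumes "finite A"
  shows "\<exists>u. u \<noteq> 0 \<and> (\<forall>b. order_at (Some b) u = (if b \<in> A then m b else 0))"
  using assms
proof (induction A rule: finite_induct)
  case empty
  show ?case
    by (rule exI[of _ 1]) simp
next
  case (insert a A)
  then obtain u where u: "u \<noteq> 0" "\<And>b. order_at (Some b) u = (if b \<in> A then m b else 0)"
    by blast
  define l where "l = to_fract [:-a, 1:]"
  define v where "v = (if m a \<ge> 0 then l ^ nat (m a) else inverse l ^ nat (- m a))"
  have l: "l \<noteq> 0" "order_at (Some b) l = (if b = a then 1 else 0)" for b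
    by (simp_all add: l_def order_at_linear linear_order_def)
  have v: "v \<noteq> 0" "order_at (Some b) v = (if b = a then m a else 0)" for b
    using l by (auto simp: v_def order_at_power order_at_inverse)
  show ?case
    using insert.hyps u v by (intro exI[of _ "u * v"]) (auto simp: order_at_mult)
qed

section \<open>Roots of Laurent series\<close>

text \<open>Hensel's lemma for \<open>r^N = u\<close>. The derivative \<open>N r^(N-1)\<close> has constant term \<open>N b^(N-1) \<noteq> 0\<close>, so a
  root modulo \<open>t^(k+1)\<close> lifts to one modulo \<open>t^(k+2)\<close>. Binomial series are not an option, as the
  characteristic may be positive.\<close>
lemma fps_root_exists:
  fixes u :: "'a :: field fps"
  assumes N: "of_nat N \<noteq> (0 :: 'a)" and b: "b ^ N = fps_nth u 0" and "b \<noteq> 0"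
  shows "\<exists>r. r ^ N = u"
proof -
  have "N > 0"
    using N by (cases N) auto
  define Q where "Q = (\<lambda>k r. fps_nth r 0 = b \<and> fps_X ^ Suc k dvd r ^ N - u)"
  have dvd_iff: "fps_X ^ k dvd g \<longleftrightarrow> (\<forall>i<k. fps_nth g i = 0)" for k and g :: "'a fps"
  proof
    assume "\<forall>i<k. fps_nth g i = 0"
    hence "g = fps_X ^ k * fps_shift k g"
      by (intro fps_ext) (simp add: fps_X_power_mult_nth)
    thus "fps_X ^ k dvd g" by (rule dvdI)
  qed (auto simp: fps_X_power_mult_nth)
  have "\<exists>r. \<forall>k. Q k (r k) \<and> fps_X ^ Suc k dvd r (Suc k) - r k"
  proof (rule dependent_nat_choice)
    show "\<exists>r. Q 0 r"
      by (rule exI[of _ "fps_const b"]) (use b dvd_iff[of 1] in \<open>simp add: Q_def fps_const_power\<close>)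
    fix r k assume r: "Q k r"
    obtain q where q: "r ^ N - u = fps_X ^ Suc k * q"
      using r by (auto simp: Q_def)
    \<comment> \<open>Newton's step: this coefficient cancels the constant term of \<open>q\<close>.\<close>
    define c where "c = - fps_nth q 0 / (of_nat N * b ^ (N - 1))"
    define r' where "r' = r + fps_X ^ Suc k * fps_const c"
    define S where "S = (\<Sum>i<N. r ^ (N - Suc i) * r' ^ i)"
    have r0: "fps_nth r 0 = b" "fps_nth r' 0 = b"
      using r by (simp_all add: Q_def r'_def)
    have "r' ^ N - r ^ N = (r' - r) * S"
      unfolding S_def by (rule power_diff_sumr2)
    hence "r' ^ N - u = fps_X ^ Suc k * (fps_const c * S + q)"
      using q by (simp add: r'_def algebra_simps)
    moreover have "fps_nth S 0 = of_nat N * b ^ (N - 1)"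
    proof -
      have "fps_nth S 0 = (\<Sum>i<N. b ^ (N - Suc i) * b ^ i)"
        by (simp add: S_def fps_sum_nth r0 fps_nth_power_0)
      also have "\<dots> = (\<Sum>i<N. b ^ (N - 1))"
        by (intro sum.cong) (simp_all flip: power_add)
      finally show ?thesis by simp
    qed
    hence "fps_nth (fps_const c * S + q) 0 = 0"
      using N \<open>b \<noteq> 0\<close> by (simp add: c_def)
    hence "fps_X dvd fps_const c * S + q"
      using dvd_iff[of 1] by simp
    ultimately have "fps_X ^ Suc (Suc k) dvd r' ^ N - u"
      using mult_dvd_mono[OF dvd_refl, of fps_X _ "fps_X ^ Suc k"] by (simp only: power_Suc2)
    hence "Q (Suc k) r' \<and> fps_X ^ Suc k dvd r' - r"
      using r0 by (simp add: Q_def r'_def)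
    thus "\<exists>r'. Q (Suc k) r' \<and> fps_X ^ Suc k dvd r' - r" by blast
  qed
  then obtain r where r: "\<And>k. Q k (r k)" "\<And>k. fps_X ^ Suc k dvd r (Suc k) - r k"
    by blast
  \<comment> \<open>The coefficient of \<open>t^k\<close> no longer changes from the \<open>k\<close>-th approximation on.\<close>
  define R where "R = Abs_fps (\<lambda>k. fps_nth (r k) k)"
  have stable: "fps_nth (r (k + j)) k = fps_nth (r k) k" for k j
  proof (induction j)
    case (Suc j)
    thus ?case
      using r(2)[of "k + j", unfolded dvd_iff] by simp
  qed simp
  have "fps_nth (R ^ N) k = fps_nth u k" for k
  proof -
    have "fps_X ^ Suc k dvd R - r k"
      unfolding dvd_iff
    proof (intro allI impI)
      fix i assume "i < Suc k"
      thus "fps_nth (R - r k) i = 0"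
        using stable[of i "k - i"] by (simp add: R_def)
    qed
    moreover have "R - r k dvd R ^ N - r k ^ N"
      by (simp add: power_diff_sumr2)
    ultimately have "fps_X ^ Suc k dvd (R ^ N - r k ^ N) + (r k ^ N - u)"
      using r(1)[of k] by (intro dvd_add) (auto simp: Q_def intro: dvd_trans)
    thus ?thesis
      unfolding dvd_iff by simp
  qed
  thus ?thesis
    by (intro exI[of _ R] fps_ext) auto
qed

lemma fls_root_exists:
  fixes g :: "'a :: alg_closed_field fls"
  assumes N: "of_nat N \<noteq> (0 :: 'a)" and "g \<noteq> 0" and dvd: "int N dvd fls_subdegree g"
  shows "\<exists>y. y ^ N = g"
proof -
  have "N > 0"
    using N by (cases N) auto
  obtain k where k: "fls_subdegree g = int N * k"
    using dvd by blast
  define u where "u = fls_base_factor_to_fps g"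
  obtain b where b: "b ^ N = fps_nth u 0"
    using nth_root_exists[OF \<open>N > 0\<close>] by blast
  have u0: "fps_nth u 0 \<noteq> 0"
    using \<open>g \<noteq> 0\<close> by (simp add: u_def)
  hence "b \<noteq> 0"
    using b \<open>N > 0\<close> by (auto simp: zero_power)
  then obtain r where r: "r ^ N = u"
    using fps_root_exists[OF N b] by blast
  have "(fls_shift (- k) (fps_to_fls r)) ^ N = fls_shift (- (int N * k)) (fps_to_fls u)"
    by (simp add: fls_shifted_pow fps_to_fls_power flip: r)
  also have "\<dots> = g"
    using fls_conv_base_factor_to_fps_shift_subdegree[of g] by (simp add: u_def k)
  finally show ?thesis by blast
qed

section \<open>Valuations\<close>

text \<open>A valuation of the fraction field of \<open>R/I\<close>, seen on representatives in \<open>R\<close>; here \<open>I\<close> is the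
  complement of \<open>nz\<close>. For \<open>I = 0\<close> this is an ordinary valuation, as with Laurent series; on
  \<open>K(X)[Y]\<close> the ideal is \<open>(c)\<close>.\<close>
locale valuation =
  fixes nz :: "'r :: comm_ring_1 \<Rightarrow> bool" and w :: "'r \<Rightarrow> int"
  assumes nz_mult [simp]: "nz (g * h) \<longleftrightarrow> nz g \<and> nz h"
    and nz_0 [simp]: "\<not> nz 0" and nz_1 [simp]: "nz 1"
    and nz_add_null: "\<not> nz g \<Longrightarrow> nz (g + h) \<longleftrightarrow> nz h"
    and w_mult: "nz g \<Longrightarrow> nz h \<Longrightarrow> w (g * h) = w g + w h"
    and w_add: "nz g \<Longrightarrow> nz h \<Longrightarrow> nz (g + h) \<Longrightarrow> min (w g) (w h) \<le> w (g + h)"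
    and w_add_null: "\<not> nz g \<Longrightarrow> nz h \<Longrightarrow> w (g + h) = w h"
begin

lemma w_1 [simp]: "w 1 = 0"
  using w_mult[of 1 1] by simp

lemma nz_minus [simp]: "nz (- h) \<longleftrightarrow> nz h"
  using nz_mult[of "-1" h] nz_mult[of "-1" "-1"] by simp

lemma w_minus: "nz h \<Longrightarrow> w (- h) = w h"
  using w_mult[of "-1" "-1"] w_mult[of "-1" h] by simp

lemma nz_power [simp]: "nz (h ^ k) \<longleftrightarrow> nz h \<or> k = 0"
  by (induction k) auto

lemma w_power: "nz h \<Longrightarrow> w (h ^ k) = int k * w h"
  by (induction k) (simp_all add: w_mult algebra_simps)

lemma nz_prod: "finite A \<Longrightarrow> nz (\<Prod>i\<in>A. g i) \<longleftrightarrow> (\<forall>i\<in>A. nz (g i))"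
  by (induction A rule: finite_induct) auto

lemma w_prod: "finite A \<Longrightarrow> (\<And>i. i \<in> A \<Longrightarrow> nz (g i)) \<Longrightarrow> w (\<Prod>i\<in>A. g i) = (\<Sum>i\<in>A. w (g i))"
  by (induction A rule: finite_induct) (simp_all add: w_mult nz_prod)

text \<open>The inequality \<open>k \<le> w h\<close> with the convention that null elements have value \<open>\<infinity>\<close>; unlike the
  inequality itself it is stable under all sums.\<close>
definition at_least :: "int \<Rightarrow> 'r \<Rightarrow> bool" where
  "at_least k h \<longleftrightarrow> (nz h \<longrightarrow> k \<le> w h)"

lemma at_least_0 [simp]: "at_least k 0"
  by (simp add: at_least_def)

lemma at_least_add: "at_least k g \<Longrightarrow> at_least k h \<Longrightarrow> at_least k (g + h)"
  unfolding at_least_def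
  by (metis add.commute min_le_iff_disj nz_add_null order_trans w_add w_add_null)

lemma at_least_minus: "at_least k g \<Longrightarrow> at_least k (- g)"
  by (auto simp: at_least_def w_minus)

lemma at_least_mult: "at_least k g \<Longrightarrow> at_least l h \<Longrightarrow> at_least (k + l) (g * h)"
  by (auto simp: at_least_def w_mult)

lemma at_least_sum: "(\<And>i. i \<in> A \<Longrightarrow> at_least k (g i)) \<Longrightarrow> at_least k (\<Sum>i\<in>A. g i)"
  by (induction A rule: infinite_finite_induct) (auto simp: at_least_add)

lemma at_least_1_mult_cases: "at_least 1 (g * h) \<Longrightarrow> at_least 1 g \<or> at_least 1 h"
  by (auto simp: at_least_def w_mult)

text \<open>The strict triangle equality: if the sum were smaller or null, \<open>g\<close> would be the sum of two elements
  of larger value.\<close>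
lemma dominant_add:
  assumes g: "nz g" and h: "at_least (w g + 1) h"
  shows "nz (g + h)" and "w (g + h) = w g"
proof -
  have "nz (g + h) \<and> w (g + h) = w g"
  proof (cases "nz h")
    case False
    thus ?thesis
      using nz_add_null[of h g] w_add_null[of h g] g by (simp add: add.commute)
  next
    case True
    hence less: "w g < w h"
      using h by (simp add: at_least_def)
    have eq: "g = (g + h) + - h" by simp
    have nz: "nz (g + h)"
    proof (rule ccontr)
      assume "\<not> nz (g + h)"
      hence "w g = w (- h)"
        using w_add_null[of "g + h" "- h"] True by simp
      thus False
        using less True by (simp add: w_minus)
    qed
    moreover have "min (w (g + h)) (w (- h)) \<le> w g"
      using w_add[of "g + h" "- h"] nz True g by simp
    moreover have "min (w g) (w h) \<le> w (g + h)"
      using w_add g True nz by blast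
    ultimately show ?thesis
      using less True by (simp add: w_minus)
  qed
  thus "nz (g + h)" "w (g + h) = w g" by blast+
qed

lemma dominant_sum:
  assumes "finite A" "j \<in> A" "nz (g j)"
    and "\<And>i. i \<in> A \<Longrightarrow> i \<noteq> j \<Longrightarrow> at_least (w (g j) + 1) (g i)"
  shows "nz (\<Sum>i\<in>A. g i)" and "w (\<Sum>i\<in>A. g i) = w (g j)"
proof -
  have eq: "(\<Sum>i\<in>A. g i) = g j + (\<Sum>i\<in>A - {j}. g i)"
    using assms by (simp add: sum.remove)
  have "at_least (w (g j) + 1) (\<Sum>i\<in>A - {j}. g i)"
    by (rule at_least_sum) (use assms in auto)
  thus "nz (\<Sum>i\<in>A. g i)" "w (\<Sum>i\<in>A. g i) = w (g j)"
    unfolding eq using dominant_add[OF assms(3)] by blast+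
qed

end

lemma valuation_fls_subdegree:
  assumes "comm_ring_map \<phi>" and nz: "\<And>h. nz h \<longleftrightarrow> \<phi> h \<noteq> 0"
  shows "valuation nz (\<lambda>h. fls_subdegree (\<phi> h :: 'a :: field fls))"
proof -
  interpret comm_ring_map \<phi> by fact
  show ?thesis
    by unfold_locales (use fls_plus_subdegree in \<open>auto simp: nz\<close>)
qed

section \<open>Degrees of divisors\<close>

lemma divisor_degree_superset:
  "finite S \<Longrightarrow> Poly_Mapping.keys D \<subseteq> S \<Longrightarrow> divisor_degree D = (\<Sum>P\<in>S. Poly_Mapping.lookup D P)"
  unfolding divisor_degree_def by (rule sum.mono_neutral_left) (auto simp: in_keys_iff)

lemma divisor_degree_add: "divisor_degree (D + E) = divisor_degree D + divisor_degree E"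
proof -
  define S where "S = Poly_Mapping.keys D \<union> Poly_Mapping.keys E"
  have "finite S" "Poly_Mapping.keys D \<subseteq> S" "Poly_Mapping.keys E \<subseteq> S" "Poly_Mapping.keys (D + E) \<subseteq> S"
    using Poly_Mapping.keys_add[of D E] by (auto simp: S_def)
  thus ?thesis
    by (simp add: divisor_degree_superset[of S] lookup_add sum.distrib)
qed

lemma divisor_degree_0 [simp]: "divisor_degree 0 = 0"
  by (simp add: divisor_degree_def)

lemma divisor_degree_minus [simp]: "divisor_degree (- D) = - divisor_degree D"
  using divisor_degree_add[of D "- D"] by simp

lemma divisor_degree_frag_of [simp]: "divisor_degree (frag_of P) = 1"
  by (simp add: divisor_degree_def)

lemma divisor_degree_cmul [simp]: "divisor_degree (frag_cmul k D) = k * divisor_degree D"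
proof -
  have "divisor_degree (frag_cmul k D) = (\<Sum>P\<in>Poly_Mapping.keys D. Poly_Mapping.lookup (frag_cmul k D) P)"
    by (rule divisor_degree_superset) (auto simp: keys_cmul)
  thus ?thesis
    by (simp add: divisor_degree_def sum_distrib_left)
qed

lemma divisor_degree_sum: "divisor_degree (\<Sum>i\<in>A. D i) = (\<Sum>i\<in>A. divisor_degree (D i))"
  by (induction A rule: infinite_finite_induct) (simp_all add: divisor_degree_add)

section \<open>The function field and its Laurent embeddings\<close>

locale superelliptic =
  fixes f :: "'a :: alg_closed_field poly"
    and N n :: nat
    and \<xi> :: 'a
    and \<alpha> :: "nat \<Rightarrow> 'a"
    and e :: "nat \<Rightarrow> nat"
  assumes N_gt_1: "N > 1" and of_nat_N: "of_nat N \<noteq> (0 :: 'a)"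
    and xi: "primitive_root_of_unity N \<xi>"
    and inj_alpha: "inj_on \<alpha> {1..n}"
    and e_pos: "\<And>i. i \<in> {1..n} \<Longrightarrow> e i \<ge> 1"
    and f_eq: "f = (\<Prod>i=1..n. [:- \<alpha> i, 1:] ^ e i)"
    and coprime_degree: "coprime (degree f) N"
    and coprime_e: "\<And>i. i \<in> {1..n} \<Longrightarrow> coprime (e i) N"
begin

abbreviation "c \<equiv> curve_poly f N"

abbreviation Y :: "'a poly fract poly" where "Y \<equiv> [:0, 1:]"

definition nz :: "'a poly fract poly \<Rightarrow> bool" where
  "nz h \<longleftrightarrow> \<not> c dvd h"

text \<open>The points of the projective line over which the covering by \<open>X\<close> is totally ramified.\<close>
definition branch :: "'a option \<Rightarrow> bool" where
  "branch p \<longleftrightarrow> p = None \<or> (\<exists>i\<in>{1..n}. p = Some (\<alpha> i))"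

lemma f_nonzero [simp]: "f \<noteq> 0"
  by (simp add: f_eq)

lemma degree_f: "degree f = (\<Sum>i=1..n. e i)"
proof -
  have "degree f = (\<Sum>i=1..n. degree ([:- \<alpha> i, 1:] ^ e i))"
    unfolding f_eq by (rule degree_prod_eq_sum_degree) simp
  thus ?thesis by (simp add: degree_linear_power)
qed

lemma order_at_f: "order_at p (to_fract f) = (\<Sum>i=1..n. int (e i) * linear_order p (\<alpha> i))"
proof -
  have tf: "to_fract (\<Prod>i\<in>A. [:- \<alpha> i, 1:] ^ e i) = (\<Prod>i\<in>A. to_fract [:- \<alpha> i, 1:] ^ e i)" for A
  proof (induction A rule: infinite_finite_induct)
    have pow: "to_fract (g ^ k) = to_fract g ^ k" for g :: "'a poly" and k
      by (induction k) simp_all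
    case (insert i A)
    thus ?case by (simp add: pow del: mult_pCons_left mult_pCons_right)
  qed simp_all
  show ?thesis
    unfolding f_eq tf by (subst order_at_prod) (simp_all add: order_at_power order_at_linear)
qed

lemma order_at_f_None: "order_at None (to_fract f) = - int (degree f)"
  by (simp add: order_at_f degree_f linear_order_def sum_negf)

lemma order_at_f_alpha: "i \<in> {1..n} \<Longrightarrow> order_at (Some (\<alpha> i)) (to_fract f) = int (e i)"
proof -
  assume i: "i \<in> {1..n}"
  have "(\<Sum>j=1..n. int (e j) * linear_order (Some (\<alpha> i)) (\<alpha> j)) =
      (\<Sum>j=1..n. if i = j then int (e j) else 0)"
    by (intro sum.cong) (use inj_alpha i in \<open>auto simp: linear_order_def inj_on_eq_iff\<close>)
  thus ?thesis
    using i by (simp add: order_at_f)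
qed

lemma order_at_f_unbranched: "\<not> branch p \<Longrightarrow> order_at p (to_fract f) = 0"
  unfolding order_at_f
  by (intro sum.neutral) (auto simp: branch_def linear_order_def split: option.splits)

text \<open>This puts \<open>\<infinity>\<close>, where the order of \<open>f\<close> is minus its degree, on the same footing as the roots.\<close>
lemma order_at_f_branch: "branch p \<Longrightarrow> coprime (order_at p (to_fract f)) (int N)"
  using coprime_degree coprime_e by (auto simp: branch_def order_at_f_None order_at_f_alpha)

lemma poly_f_unbranched: "\<not> branch (Some a) \<Longrightarrow> poly f a \<noteq> 0"
  by (auto simp: f_eq poly_prod branch_def)

lemma n_pos: "n > 0"
  using coprime_degree N_gt_1 by (cases n) (auto simp: f_eq)

lemma degree_c [simp]: "degree c = N"
proof -
  have "degree (monom 1 N + - [:to_fract f:]) = degree (monom (1 :: 'a poly fract) N)"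
    using N_gt_1 by (intro degree_add_eq_left) (simp add: degree_monom_eq)
  thus ?thesis
    unfolding curve_poly_def diff_conv_add_uminus by (simp only: degree_monom_eq one_neq_zero not_False_eq_True)
qed

lemma c_nonzero [simp]: "c \<noteq> 0"
  using degree_c N_gt_1 by fastforce

lemma Y_power: "Y ^ k = monom 1 k"
  by (simp add: monom_altdef)

lemma monom_eq: "monom u j = [:u:] * Y ^ j"
  by (simp add: Y_power smult_monom)

lemma c_eq: "c = Y ^ N - [:to_fract f:]"
  by (simp add: curve_poly_def Y_power)

lemma degree_mod_c: "degree (h mod c) < N"
  using degree_mod_less'[of c h] degree_mod_less[of c h] N_gt_1 by fastforce

lemma mod_c_eq: "degree h < N \<Longrightarrow> h mod c = h"
  by (simp add: mod_poly_less)

lemma low_degree_sum: "degree h < N \<Longrightarrow> h = (\<Sum>j<N. [:coeff h j:] * Y ^ j)"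
  using poly_as_sum_of_monoms'[of h "N - 1"] N_gt_1
  by (simp add: monom_eq lessThan_Suc_atMost[symmetric] del: mult_pCons_left)

text \<open>In \<open>K((t))\<close> the image of \<open>f\<close> has order \<open>N ord f\<close> at a branch point and order zero elsewhere. Both are
  divisible by \<open>N\<close>, so \<open>f\<close> acquires an \<open>N\<close>-th root \<open>y\<close> there, to which \<open>Y\<close> is mapped.\<close>
lemma embedding_exists:
  fixes p :: "'a option"
  defines "m \<equiv> (if branch p then N else 1)"
  obtains \<phi> :: "'a poly fract poly \<Rightarrow> 'a fls" where "comm_ring_map \<phi>" "\<phi> c = 0"
    "\<And>u. \<phi> [:u:] = 0 \<longleftrightarrow> u = 0"
    "\<And>u. u \<noteq> 0 \<Longrightarrow> fls_subdegree (\<phi> [:u:]) = int m * order_at p u"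
proof -
  have m: "m > 0"
    using N_gt_1 by (simp add: m_def)
  define F where "F = fract_at (local_coord m p)"
  note nc = subdegree_local_coord(2)[OF m, of p]
  interpret F: comm_ring_map F
    unfolding F_def by (rule fract_at_hom[OF nc])
  have F0: "F u = 0 \<longleftrightarrow> u = 0" for u
    unfolding F_def using fract_at_eq_0_iff[OF nc] by simp
  have sd: "fls_subdegree (F u) = int m * order_at p u" if "u \<noteq> 0" for u
    unfolding F_def by (rule subdegree_fract_at_local_coord[OF m that])
  have "int N dvd fls_subdegree (F (to_fract f))"
    using order_at_f_unbranched[of p] by (auto simp: sd m_def)
  then obtain y where y: "y ^ N = F (to_fract f)"
    using fls_root_exists[OF of_nat_N, of "F (to_fract f)"] F0 by auto
  define \<phi> where "\<phi> = (\<lambda>h. poly (map_poly F h) y)"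
  interpret \<phi>: comm_ring_map \<phi>
    unfolding \<phi>_def by (rule F.poly_eval)
  have const: "\<phi> [:u:] = F u" for u
    by (simp add: \<phi>_def map_poly_pCons)
  have Y: "\<phi> Y = y"
    by (simp add: \<phi>_def map_poly_pCons)
  show ?thesis
  proof (rule that[of \<phi>])
    show "comm_ring_map \<phi>" by (rule \<phi>.comm_ring_map_axioms)
    show "\<phi> c = 0"
      unfolding c_eq by (simp only: \<phi>.map_diff \<phi>.map_power const Y y) simp
  qed (simp_all add: const F0 sd)
qed

text \<open>Modulo \<open>N\<close> the values are \<open>j ord f\<close> and \<open>k ord f\<close>, and \<open>ord f\<close> is a unit.\<close>
lemma distinct_orders:
  assumes j: "branch p" "j < N" "k < N" "int N * x + int j * order_at p (to_fract f) =
     int N * y + int k * order_at p (to_fract f)"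
  shows "j = k"
proof -
  have "int N dvd (int j - int k) * order_at p (to_fract f)"
    using j(4) by (intro dvdI[of _ _ "y - x"]) (simp add: algebra_simps)
  hence "int N dvd int j - int k"
    using order_at_f_branch[OF j(1)] coprime_commute coprime_dvd_mult_left_iff by blast
  thus ?thesis
    using j(2,3) zdvd_imp_le[of "int N" "int j - int k"] zdvd_imp_le[of "int N" "int k - int j"]
    by (cases j k rule: linorder_cases) (auto simp: dvd_diff_commute)
qed

lemma dominant_term:
  assumes p: "branch p" and h: "degree h < N" "h \<noteq> 0"
  obtains j where "j < N" "coeff h j \<noteq> 0"
    "\<And>i. i < N \<Longrightarrow> i \<noteq> j \<Longrightarrow> coeff h i \<noteq> 0 \<Longrightarrow>
       int N * order_at p (coeff h j) + int j * order_at p (to_fract f) <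
       int N * order_at p (coeff h i) + int i * order_at p (to_fract f)"
proof -
  define A where "A = {j. j < N \<and> coeff h j \<noteq> 0}"
  define t where "t = (\<lambda>j. int N * order_at p (coeff h j) + int j * order_at p (to_fract f))"
  have A: "finite A" "A \<noteq> {}"
    using h by (auto simp: A_def intro!: exI[of _ "degree h"])
  define j where "j = arg_min_on t A"
  have j: "j \<in> A" and le: "\<And>i. i \<in> A \<Longrightarrow> t j \<le> t i"
    unfolding j_def using arg_min_if_finite[OF A, of t] by (auto simp: not_less)
  have "t j < t i" if i: "i < N" "i \<noteq> j" "coeff h i \<noteq> 0" for i
  proof -
    have "t j \<le> t i"
      using le[of i] i by (simp add: A_def)
    moreover have "t j \<noteq> t i"
      unfolding t_def using distinct_orders[OF p, of j i] i j by (auto simp: A_def)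
    ultimately show ?thesis by simp
  qed
  thus ?thesis
    using that[of j] j by (simp add: A_def t_def)
qed

text \<open>Over a branch point every valuation is computed by the same formula: \<open>N w(Y) = w(f)\<close> fixes the
  values of the terms up to the scale \<open>m\<close>, and the unique least term determines the value of
  \<open>h\<close>. Stating this for an arbitrary null ideal lets it apply to an embedding before its kernel is
  known.\<close>
lemma valuation_dominant_term:
  fixes w :: "'a poly fract poly \<Rightarrow> int"
  assumes w: "valuation nz' w" and c0: "\<not> nz' c" and nz': "\<And>u. nz' [:u:] \<longleftrightarrow> u \<noteq> 0"
    and p: "branch p" and m: "m > 0" and over: "\<And>u. u \<noteq> 0 \<Longrightarrow> w [:u:] = m * order_at p u"
    and h: "degree h < N" and j: "j < N" "coeff h j \<noteq> 0"
    "\<And>i. i < N \<Longrightarrow> i \<noteq> j \<Longrightarrow> coeff h i \<noteq> 0 \<Longrightarrow>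
       int N * order_at p (coeff h j) + int j * order_at p (to_fract f) <
       int N * order_at p (coeff h i) + int i * order_at p (to_fract f)"
  shows "nz' h" and "int N * w h = m * (int N * order_at p (coeff h j) + int j * order_at p (to_fract f))"
proof -
  interpret valuation nz' w by (rule w)
  have YN: "Y ^ N = c + [:to_fract f:]"
    by (simp add: c_eq)
  have nzY: "nz' Y"
    using nz_add_null[OF c0, of "[:to_fract f:]"] nz_power[of Y N] N_gt_1
    by (simp add: nz' flip: YN)
  have wY: "int N * w Y = m * order_at p (to_fract f)"
  proof -
    have "w (Y ^ N) = w [:to_fract f:]"
      unfolding YN by (rule w_add_null[OF c0]) (simp add: nz')
    thus ?thesis
      using w_power[OF nzY, of N] over[of "to_fract f"] by simp
  qed
  have termval: "int N * w ([:u:] * Y ^ i) = m * (int N * order_at p u + int i * order_at p (to_fract f))"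
    if "u \<noteq> 0" for u i
  proof -
    have "int N * w ([:u:] * Y ^ i) = int N * (m * order_at p u) + int i * (int N * w Y)"
      using that nzY by (simp add: w_mult nz' w_power over algebra_simps del: mult_pCons_left)
    thus ?thesis
      by (simp add: wY algebra_simps)
  qed
  define g where "g = (\<lambda>i. [:coeff h i:] * Y ^ i)"
  have hg: "h = (\<Sum>i<N. g i)"
    unfolding g_def by (rule low_degree_sum[OF h])
  have less: "w (g j) < w (g i)" if "i < N" "i \<noteq> j" "coeff h i \<noteq> 0" for i
  proof -
    have "int N * w (g j) < int N * w (g i)"
      unfolding g_def using termval j that m by simp
    thus ?thesis
      using N_gt_1 by simp
  qed
  have gj: "nz' (g j)"
    using j nzY by (simp add: g_def nz' del: mult_pCons_left)
  have al: "at_least (w (g j) + 1) (g i)" if "i \<in> {..<N}" "i \<noteq> j" for i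
    using less[of i] that by (cases "coeff h i = 0") (auto simp: g_def at_least_def)
  note dom = dominant_sum[of "{..<N}" j g, OF _ _ gj al]
  show "nz' h"
    unfolding hg using dom j by simp
  have "w h = w (g j)"
    unfolding hg using dom j by simp
  thus "int N * w h = m * (int N * order_at p (coeff h j) + int j * order_at p (to_fract f))"
    using termval j by (simp add: g_def)
qed

text \<open>A nonzero \<open>h\<close> of degree below \<open>N\<close> has a term of least order, which survives in the image.\<close>
lemma embedding_nonzero:
  assumes "comm_ring_map \<phi>" "\<phi> c = 0" "\<And>u. \<phi> [:u:] = (0 :: 'a fls) \<longleftrightarrow> u = 0"
    "\<And>u. u \<noteq> 0 \<Longrightarrow> fls_subdegree (\<phi> [:u:]) = int m * order_at p u" "branch p" "m > 0"
  shows "\<phi> h = 0 \<longleftrightarrow> c dvd h"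
proof -
  interpret comm_ring_map \<phi> by fact
  have "\<phi> h = \<phi> (h div c * c + h mod c)"
    by (simp only: div_mult_mod_eq)
  also have "\<dots> = \<phi> (h mod c)"
    by (simp only: map_add map_mult assms(2)) simp
  finally have *: "\<phi> h = \<phi> (h mod c)" .
  have "\<phi> (h mod c) \<noteq> 0" if nonzero: "h mod c \<noteq> 0"
  proof -
    obtain j where j: "j < N" "coeff (h mod c) j \<noteq> 0"
      "\<And>i. i < N \<Longrightarrow> i \<noteq> j \<Longrightarrow> coeff (h mod c) i \<noteq> 0 \<Longrightarrow>
         int N * order_at p (coeff (h mod c) j) + int j * order_at p (to_fract f) <
         int N * order_at p (coeff (h mod c) i) + int i * order_at p (to_fract f)"
      using dominant_term[OF assms(5) degree_mod_c nonzero] by metis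
    have val: "valuation (\<lambda>h. \<phi> h \<noteq> 0) (\<lambda>h. fls_subdegree (\<phi> h))"
      by (rule valuation_fls_subdegree[OF assms(1)]) simp
    show ?thesis
      using valuation_dominant_term(1)[OF val _ _ assms(5) _ _ degree_mod_c j, of "int m"] assms
      by simp
  qed
  thus ?thesis
    using * by (auto simp: dvd_eq_mod_eq_0)
qed

text \<open>\<open>c\<close> generates the kernel of a homomorphism into a field, namely of the embedding at \<open>\<infinity>\<close>.\<close>
lemma c_prime: "c dvd g * h \<longleftrightarrow> c dvd g \<or> c dvd h"
proof -
  obtain \<phi> :: "'a poly fract poly \<Rightarrow> 'a fls" where \<phi>: "comm_ring_map \<phi>" "\<phi> c = 0"
    "\<And>u. \<phi> [:u:] = 0 \<longleftrightarrow> u = 0"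
    "\<And>u. u \<noteq> 0 \<Longrightarrow> fls_subdegree (\<phi> [:u:]) = int N * order_at None u"
    by (rule embedding_exists[of None]) (auto simp: branch_def)
  have "\<phi> h = 0 \<longleftrightarrow> c dvd h" for h
    by (rule embedding_nonzero[OF \<phi>]) (use N_gt_1 in \<open>auto simp: branch_def\<close>)
  thus ?thesis
    using comm_ring_map.map_mult[OF \<phi>(1), of g h] by (metis mult_eq_0_iff)
qed

lemma nz_mult [simp]: "nz (g * h) \<longleftrightarrow> nz g \<and> nz h"
  by (simp add: nz_def c_prime)

lemma nz_low_degree: "degree h < N \<Longrightarrow> nz h \<longleftrightarrow> h \<noteq> 0"
  by (simp add: nz_def dvd_eq_mod_eq_0 mod_c_eq)

lemma nz_const [simp]: "nz [:u:] \<longleftrightarrow> u \<noteq> 0"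
  using N_gt_1 by (subst nz_low_degree) auto

lemma nz_Y [simp]: "nz Y"
  using N_gt_1 by (subst nz_low_degree) auto

lemma nz_1 [simp]: "nz 1"
  using N_gt_1 by (subst nz_low_degree) auto

lemma nz_Y_power [simp]: "nz (Y ^ j)"
  by (induction j) (simp_all del: mult_pCons_left)

lemma nz_mod [simp]: "nz (h mod c) \<longleftrightarrow> nz h"
  by (simp add: nz_def dvd_eq_mod_eq_0)

lemma nz_iff_mod: "nz h \<longleftrightarrow> h mod c \<noteq> 0"
  by (simp add: nz_def dvd_eq_mod_eq_0)

lemma nz_cong: "c dvd g - h \<Longrightarrow> nz g \<longleftrightarrow> nz h"
  by (metis nz_iff_mod mod_eq_dvd_iff)

section \<open>The automorphism and the norm\<close>

text \<open>The pull-back \<open>\<delta>\<^sup>*\<close> of functions, as a ring endomorphism of \<open>K(X)[Y]\<close> that fixes \<open>c\<close>.\<close>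
definition s :: "'a poly fract poly \<Rightarrow> 'a poly fract poly" where
  "s = delta_pullback \<xi>"

lemma xi_power: "\<xi> ^ N = 1" "0 < k \<Longrightarrow> k < N \<Longrightarrow> \<xi> ^ k \<noteq> 1"
  using xi by (auto simp: primitive_root_of_unity_def)

lemma xi_nonzero [simp]: "\<xi> \<noteq> 0"
  using xi_power(1) N_gt_1 by (auto simp: zero_power)

lemma to_fract_const_1 [simp]: "to_fract [:1:] = 1"
  by (metis one_pCons to_fract_1)

lemma to_fract_const_power: "to_fract [:k:] ^ j = to_fract [:k ^ j :: 'a:]"
  by (induction j) (simp_all flip: to_fract_mult)

lemma const_xi_power: "to_fract [:\<xi>:] ^ j = to_fract [:\<xi> ^ j:]"
  by (rule to_fract_const_power)

sublocale s: comm_ring_map s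
proof
  show "s 1 = 1"
    by (simp only: s_def delta_pullback_def one_pCons pcompose_const)
qed (simp_all add: s_def delta_pullback_def pcompose_add pcompose_mult)

lemma coeff_s: "coeff (s h) j = to_fract [:\<xi> ^ j:] * coeff h j"
  by (simp add: s_def delta_pullback_def coeff_pcompose_linear const_xi_power)

lemma s_const [simp]: "s [:u:] = [:u:]"
  by (simp add: s_def delta_pullback_def)

lemma s_Y: "s Y = [:to_fract [:\<xi>:]:] * Y"
  by (simp add: s_def delta_pullback_def pcompose_pCons)

lemma s_c [simp]: "s c = c"
proof -
  have "(s Y) ^ N = Y ^ N"
    by (simp only: s_Y power_mult_distrib poly_const_pow const_xi_power xi_power(1)) simp
  thus ?thesis
    by (simp only: c_eq s.map_diff s.map_power s_const)
qed

lemma degree_s [simp]: "degree (s h) = degree h"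
  by (simp add: s_def delta_pullback_def degree_pcompose)

lemma coeff_s_power: "coeff ((s ^^ k) h) j = to_fract [:\<xi> ^ (j * k):] * coeff h j"
  by (induction k) (simp_all add: coeff_s power_add mult.assoc flip: to_fract_mult)

lemma s_power_N [simp]: "(s ^^ N) h = h"
  by (intro poly_eqI) (simp add: coeff_s_power mult.commute[of _ N] power_mult xi_power one_pCons[symmetric])

lemma s_mod: "s (h mod c) = s h mod c"
proof -
  have "s h = s (h div c) * c + s (h mod c)"
    by (metis div_mult_mod_eq s.map_add s.map_mult s_c)
  hence "s h mod c = s (h mod c) mod c"
    by simp
  thus ?thesis
    using degree_mod_c[of h] by (simp add: mod_c_eq)
qed

lemma nz_s [simp]: "nz (s h) \<longleftrightarrow> nz h"
proof -
  have "s g = 0 \<longleftrightarrow> g = 0" for g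
    by (simp add: poly_eq_iff[of "s g"] poly_eq_iff[of g] coeff_s)
  thus ?thesis
    by (simp add: nz_iff_mod flip: s_mod)
qed

lemma nz_s_power [simp]: "nz ((s ^^ k) h) \<longleftrightarrow> nz h"
  by (induction k) auto

text \<open>The norm to \<open>K(X)\<close>: the function field is a Galois extension with group generated by \<open>s\<close>.\<close>
definition norm :: "'a poly fract poly \<Rightarrow> 'a poly fract poly" where
  "norm h = (\<Prod>k<N. (s ^^ k) h)"

lemma nz_prod [simp]: "finite A \<Longrightarrow> nz (\<Prod>i\<in>A. g i) \<longleftrightarrow> (\<forall>i\<in>A. nz (g i))"
  by (induction A rule: finite_induct) auto

lemma s_norm: "s (norm h) = norm h"
proof -
  obtain M where M: "N = Suc M"
    using N_gt_1 by (cases N) auto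
  have "s (norm h) = (\<Prod>k<N. (s ^^ Suc k) h)"
    by (simp add: norm_def s.map_prod)
  also have "\<dots> = (\<Prod>k<M. (s ^^ Suc k) h) * (s ^^ N) h"
    by (simp only: M prod.lessThan_Suc)
  also have "\<dots> = (s ^^ 0) h * (\<Prod>k<M. (s ^^ Suc k) h)"
    by simp
  also have "\<dots> = (\<Prod>k<Suc M. (s ^^ k) h)"
    by (rule prod.lessThan_Suc_shift[symmetric])
  also have "\<dots> = norm h"
    unfolding norm_def M[symmetric] ..
  finally show ?thesis .
qed

text \<open>The reduction of the norm modulo \<open>c\<close> is invariant under \<open>\<delta>\<^sup>*\<close>, which multiplies the coefficient of
  \<open>Y^j\<close> by \<open>\<xi>^j \<noteq> 1\<close> for \<open>0 < j < N\<close>.\<close>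
lemma norm_rational: "\<exists>r. c dvd norm h - [:r:]"
proof -
  define g where "g = norm h mod c"
  have "s g = g"
    by (simp add: g_def s_mod s_norm)
  have "coeff g j = 0" if "0 < j" for j
  proof (cases "j < N")
    case True
    have "(to_fract [:\<xi> ^ j:] - 1) * coeff g j = 0"
      using \<open>s g = g\<close> coeff_s[of g j] by (simp add: algebra_simps)
    moreover have "to_fract [:\<xi> ^ j:] \<noteq> 1"
      using xi_power(2)[OF that True] by (metis one_pCons pCons_eq_iff to_fract_1 to_fract_eq_iff)
    ultimately show ?thesis by simp
  next
    case False
    thus ?thesis
      using degree_mod_c[of "norm h"] by (intro coeff_eq_0) (simp add: g_def)
  qed
  hence "g = [:coeff g 0:]"
    by (intro poly_eqI) (simp add: coeff_pCons split: nat.split)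
  moreover have "c dvd norm h - g"
    by (simp add: g_def minus_mod_eq_mult_div)
  ultimately show ?thesis by metis
qed

definition rational_norm :: "'a poly fract poly \<Rightarrow> 'a poly fract" where
  "rational_norm h = (SOME r. c dvd norm h - [:r:])"

lemma rational_norm: "c dvd norm h - [:rational_norm h:]"
  unfolding rational_norm_def using norm_rational by (rule someI_ex)

lemma rational_norm_nonzero: "nz h \<Longrightarrow> rational_norm h \<noteq> 0"
  using nz_cong[OF rational_norm, of h] by (simp add: norm_def)

text \<open>The product of the other conjugates, divided by the norm, is an inverse. So the function field is
  indeed a field.\<close>
lemma inverse_exists:
  assumes "nz h"
  obtains h' where "c dvd h * h' - 1" "nz h'"
proof -
  define k where "k = (\<Prod>i<N - 1. (s ^^ Suc i) h)"
  have "norm h = h * k"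
    using N_gt_1 prod.lessThan_Suc_shift[of "\<lambda>i. (s ^^ i) h" "N - 1"] by (simp add: norm_def k_def)
  moreover have "[:inverse (rational_norm h):] * [:rational_norm h:] = (1 :: 'a poly fract poly)"
    using rational_norm_nonzero[OF assms] by (simp add: one_pCons)
  hence "[:inverse (rational_norm h):] * (norm h - [:rational_norm h:]) = [:inverse (rational_norm h):] * norm h - 1"
    by (simp only: right_diff_distrib)
  hence "c dvd [:inverse (rational_norm h):] * norm h - 1"
    using dvd_mult[OF rational_norm[of h], of "[:inverse (rational_norm h):]"] by metis
  ultimately have *: "c dvd h * (k * [:inverse (rational_norm h):]) - 1"
    by (simp only: mult_ac)
  have "nz (h * (k * [:inverse (rational_norm h):]))"
    using nz_cong[OF *] by simp
  thus ?thesis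
    using that[OF *] nz_mult by blast
qed

section \<open>Points of the curve as places\<close>

text \<open>The representative-based counterpart of a point. As inverses exist, it is enough to demand the
  value \<open>1\<close>.\<close>
definition place :: "('a poly fract poly \<Rightarrow> int) \<Rightarrow> bool" where
  "place w \<longleftrightarrow> valuation nz w \<and> (\<forall>k. k \<noteq> 0 \<longrightarrow> w [:to_fract [:k:]:] = 0) \<and> (\<exists>h. nz h \<and> w h = 1)"

definition ord :: "'a point \<Rightarrow> 'a poly fract poly \<Rightarrow> int" where
  "ord P h = P (h mod c)"

abbreviation "points \<equiv> curve_points f N"

lemma nonzero_functions_eq: "nonzero_functions f N = {h. degree h < N \<and> h \<noteq> 0}"
  by (auto simp: nonzero_functions_def function_field_def)

lemma nz_add_null: "\<not> nz g \<Longrightarrow> nz (g + h) \<longleftrightarrow> nz h"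
  by (simp add: nz_def dvd_add_right_iff)

lemma place_ord:
  assumes P: "P \<in> points"
  shows "place (ord P)"
proof -
  have in_nf: "h mod c \<in> nonzero_functions f N" if "nz h" for h
    using that degree_mod_c by (simp add: nonzero_functions_eq nz_iff_mod)
  have "valuation nz (ord P)"
  proof
    fix g h
    show "ord P (g * h) = ord P g + ord P h" if "nz g" "nz h"
    proof -
      have "P ((g mod c) \<otimes>\<^bsub>function_field f N\<^esub> (h mod c)) = P (g mod c) + P (h mod c)"
        using P in_nf[OF that(1)] in_nf[OF that(2)] by (simp add: curve_points_def)
      thus ?thesis
        by (simp add: ord_def function_field_def mod_mult_eq)
    qed
    show "min (ord P g) (ord P h) \<le> ord P (g + h)" if "nz g" "nz h" "nz (g + h)"
      using P in_nf[OF that(1)] in_nf[OF that(2)] that(3)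
      by (auto simp: curve_points_def ord_def poly_mod_add_left nz_iff_mod)
    show "ord P (g + h) = ord P h" if "\<not> nz g" "nz h"
      using that by (simp add: ord_def poly_mod_add_left nz_iff_mod)
  qed (simp_all add: nz_add_null, simp add: nz_def)
  moreover have "ord P [:to_fract [:k:]:] = 0" if "k \<noteq> 0" for k
    using P that N_gt_1 by (simp add: ord_def mod_c_eq curve_points_def const_fun_def)
  moreover have "\<exists>h. nz h \<and> ord P h = 1"
  proof -
    have "1 \<in> P ` nonzero_functions f N"
      using P by (simp add: curve_points_def)
    then obtain h where "h \<in> nonzero_functions f N" "P h = 1" by auto
    thus ?thesis
      by (intro exI[of _ h]) (simp add: nonzero_functions_eq nz_low_degree ord_def mod_c_eq)
  qed
  ultimately show ?thesis
    by (simp add: place_def)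
qed

definition point_of :: "('a poly fract poly \<Rightarrow> int) \<Rightarrow> 'a point" where
  "point_of w = restrict w (nonzero_functions f N)"

lemma place_cong:
  assumes "place w" "nz h" "c dvd g - h"
  shows "w g = w h"
proof -
  interpret valuation nz w using assms by (simp add: place_def)
  have "w ((g - h) + h) = w h"
    by (rule w_add_null) (use assms in \<open>auto simp: nz_def\<close>)
  thus ?thesis by simp
qed

lemma place_inverse:
  assumes "place w" "nz h"
  obtains h' where "nz h'" "w h' = - w h" "c dvd h * h' - 1"
proof -
  interpret valuation nz w using assms by (simp add: place_def)
  obtain h' where h': "c dvd h * h' - 1" "nz h'"
    using inverse_exists[OF assms(2)] .
  have "w (h * h') = 0"
    using place_cong[OF assms(1) _ h'(1)] by simp
  thus ?thesis
    using that[of h'] h' assms(2) by (simp add: w_mult)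
qed

lemma ord_point_of:
  assumes "place w" "nz h"
  shows "ord (point_of w) h = w h"
proof -
  have "ord (point_of w) h = w (h mod c)"
    using assms degree_mod_c by (simp add: ord_def point_of_def nonzero_functions_eq nz_iff_mod)
  also have "\<dots> = w h"
    by (rule place_cong[OF assms]) (metis dvd_minus_mod dvd_diff_commute)
  finally show ?thesis .
qed

lemma point_of_in_points:
  assumes w: "place w"
  shows "point_of w \<in> points"
proof -
  interpret valuation nz w using assms by (simp add: place_def)
  have nf: "nz h" "h mod c = h" if "h \<in> nonzero_functions f N" for h
    using that by (simp_all add: nonzero_functions_eq nz_low_degree mod_c_eq)
  have mod_nf: "h mod c \<in> nonzero_functions f N" if "nz h" for h
    using that degree_mod_c by (simp add: nonzero_functions_eq nz_iff_mod)
  have wmod: "w (h mod c) = w h" if "nz h" for h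
    by (rule place_cong[OF assms that]) (metis dvd_minus_mod dvd_diff_commute)
  have surj: "\<exists>h\<in>nonzero_functions f N. k = w h" for k
  proof -
    obtain h where h: "nz h" "w h = 1"
      using w by (auto simp: place_def)
    obtain h' where h': "nz h'" "w h' = -1"
      using place_inverse[OF w h(1)] h(2) by metis
    define g where "g = (if k \<ge> 0 then h ^ nat k else h' ^ nat (- k))"
    have "nz g" "w g = k"
      using h h' by (auto simp: g_def w_power)
    thus ?thesis
      using mod_nf wmod by (intro bexI[of _ "g mod c"]) auto
  qed
  have "const_fun k \<in> nonzero_functions f N" if "k \<noteq> 0" for k
    using that N_gt_1 by (simp add: const_fun_def nonzero_functions_eq)
  moreover have "g + h \<in> nonzero_functions f N"
    if "g \<in> nonzero_functions f N" "h \<in> nonzero_functions f N" "g + h \<noteq> 0" for g h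
    using that by (simp add: nonzero_functions_eq degree_add_less)
  ultimately show ?thesis
    unfolding curve_points_def point_of_def
    using w w_mult w_add nf mod_nf wmod surj
    by (auto simp: function_field_def place_def const_fun_def image_iff
        simp del: nonzero_functions_eq cong: image_cong_simp)
qed

lemma points_eqI:
  assumes "P \<in> points" "Q \<in> points" "\<And>h. nz h \<Longrightarrow> ord P h = ord Q h"
  shows "P = Q"
proof (rule extensionalityI)
  show "P \<in> extensional (nonzero_functions f N)" "Q \<in> extensional (nonzero_functions f N)"
    using assms by (auto simp: curve_points_def)
  show "P h = Q h" if "h \<in> nonzero_functions f N" for h
    using that assms(3)[of h] by (simp add: nonzero_functions_eq nz_low_degree ord_def mod_c_eq)
qed

abbreviation "\<delta> \<equiv> delta_point f N \<xi>"

lemma ord_delta: "nz h \<Longrightarrow> ord (\<delta> P) h = ord P (s h)"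
  using degree_mod_c[of h]
  by (simp add: ord_def delta_point_def nonzero_functions_eq nz_iff_mod s_mod flip: s_def)

lemma place_s:
  assumes w: "place w"
  shows "place (\<lambda>h. w (s h))"
proof -
  interpret valuation nz w using assms by (simp add: place_def)
  obtain h where h: "nz h" "w h = 1"
    using w by (auto simp: place_def)
  have "s ((s ^^ (N - 1)) h) = h"
    using s_power_N[of h] N_gt_1 by (metis One_nat_def Suc_diff_1 comp_apply funpow.simps(2) less_imp_Suc_add zero_less_Suc less_trans zero_less_one)
  hence "\<exists>h. nz h \<and> w (s h) = 1"
    using h by (intro exI[of _ "(s ^^ (N - 1)) h"]) simp
  moreover have "valuation nz (\<lambda>h. w (s h))"
  proof
    fix g h
    show "min (w (s g)) (w (s h)) \<le> w (s (g + h))" if "nz g" "nz h" "nz (g + h)"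
      using w_add[of "s g" "s h"] that nz_s[of "g + h"] by simp
  qed (simp_all add: nz_add_null w_mult w_add_null)
  ultimately show ?thesis
    using w by (simp add: place_def)
qed

lemma delta_eq_point_of: "\<delta> P = point_of (\<lambda>h. ord P (s h))"
  by (auto simp: delta_point_def point_of_def nonzero_functions_eq restrict_def ord_def
      mod_c_eq simp flip: s_def)

lemma delta_points [simp]: "P \<in> points \<Longrightarrow> \<delta> P \<in> points"
  unfolding delta_eq_point_of by (intro point_of_in_points place_s place_ord)

lemma delta_power_points [simp]: "P \<in> points \<Longrightarrow> (\<delta> ^^ k) P \<in> points"
  by (induction k) auto

lemma ord_delta_power: "P \<in> points \<Longrightarrow> nz h \<Longrightarrow> ord ((\<delta> ^^ k) P) h = ord P ((s ^^ k) h)"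
  by (induction k arbitrary: h) (simp_all add: ord_delta funpow_swap1[of s])

lemma delta_power_N [simp]: "P \<in> points \<Longrightarrow> (\<delta> ^^ N) P = P"
  by (rule points_eqI) (simp_all add: ord_delta_power)

section \<open>Places over the projective line\<close>

text \<open>\<open>m\<close> is the ramification index.\<close>
definition over :: "'a option \<Rightarrow> int \<Rightarrow> ('a poly fract poly \<Rightarrow> int) \<Rightarrow> bool" where
  "over p m w \<longleftrightarrow> m > 0 \<and> (\<forall>u. u \<noteq> 0 \<longrightarrow> w [:u:] = m * order_at p u)"

lemma place_valuation: "place w \<Longrightarrow> valuation nz w"
  by (simp add: place_def)

lemma place_const: "place w \<Longrightarrow> k \<noteq> 0 \<Longrightarrow> w [:to_fract [:k:]:] = 0"
  by (simp add: place_def)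

lemma not_nz_c [simp]: "\<not> nz c"
  by (simp add: nz_def)

lemma value_Y:
  assumes "valuation nz w"
  shows "int N * w Y = w [:to_fract f:]"
proof -
  interpret valuation nz w by fact
  have "w (c + [:to_fract f:]) = w [:to_fract f:]"
    by (rule w_add_null) simp_all
  moreover have "c + [:to_fract f:] = Y ^ N"
    by (simp only: c_eq) simp
  ultimately show ?thesis
    using w_power[of Y N] by simp
qed

text \<open>Otherwise \<open>Y\<close> and hence every function has value at least zero; applied to inverses, every value is
  zero.\<close>
lemma place_nontrivial_on_rational:
  assumes w: "place w"
  obtains u where "u \<noteq> 0" "w [:u:] \<noteq> 0"
proof -
  interpret valuation nz w using w by (rule place_valuation)
  have False if triv: "\<And>u. u \<noteq> 0 \<Longrightarrow> w [:u:] = 0"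
  proof -
    have wY: "w Y = 0"
      using value_Y[OF place_valuation[OF w]] triv[of "to_fract f"] N_gt_1 by simp
    have nonneg: "0 \<le> w h" if "nz h" for h
    proof -
      have "at_least 0 (\<Sum>j<N. [:coeff (h mod c) j:] * Y ^ j)"
      proof (rule at_least_sum)
        fix j show "at_least 0 ([:coeff (h mod c) j:] * Y ^ j)"
          by (cases "coeff (h mod c) j = 0")
             (simp_all add: at_least_def w_mult w_power wY triv del: mult_pCons_left)
      qed
      hence "at_least 0 (h mod c)"
        by (simp only: low_degree_sum[OF degree_mod_c[of h], symmetric])
      hence "0 \<le> w (h mod c)"
        using that by (simp add: at_least_def)
      also have "w (h mod c) = w h"
        by (rule place_cong[OF w that]) (metis dvd_minus_mod dvd_diff_commute)
      finally show ?thesis .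
    qed
    obtain h where h: "nz h" "w h = 1"
      using w by (auto simp: place_def)
    obtain h' where "nz h'" "w h' = -1"
      using place_inverse[OF w h(1)] h(2) by metis
    thus False
      using nonneg[of h'] by simp
  qed
  thus ?thesis using that by blast
qed

lemma overI:
  assumes w: "place w" and m: "m > 0" and lin: "\<And>r. w [:to_fract [:-r, 1:]:] = m * linear_order p r"
  shows "over p m w"
  unfolding over_def
proof (intro conjI allI impI m)
  interpret valuation nz w using w by (rule place_valuation)
  fix u :: "'a poly fract" assume "u \<noteq> 0"
  show "w [:u:] = m * order_at p u"
  proof (rule additive_fract_eqI(2)[OF _ _ _ \<open>u \<noteq> 0\<close>, where w = "\<lambda>u. w [:u:]" and w' = "\<lambda>u. m * order_at p u"])
    show "w [:u * v:] = w [:u:] + w [:v:]" if "u \<noteq> 0" "v \<noteq> 0" for u v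
      using w_mult[of "[:u:]" "[:v:]"] that by (simp add: mult.commute)
    show "m * order_at p (u * v) = m * order_at p u + m * order_at p v" if "u \<noteq> 0" "v \<noteq> 0" for u v
      using that by (simp add: order_at_mult distrib_left)
  qed (simp_all add: place_const[OF w] order_at_const lin order_at_linear)
qed

text \<open>If \<open>X\<close> has a pole, every \<open>X - r\<close> has the same value as \<open>X\<close>. If not, some \<open>X - a\<close> has positive value,
  as otherwise the place would be trivial on \<open>K(X)\<close>; then all other \<open>X - r\<close> differ from it by a nonzero
  constant and have value zero.\<close>
lemma place_over_exists:
  assumes w: "place w"
  shows "\<exists>p m. over p m w"
proof -
  interpret valuation nz w using w by (rule place_valuation)
  define L where "L = (\<lambda>r. [:to_fract [:- r, 1:]:] :: 'a poly fract poly)"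
  have nzL: "nz (L r)" for r
    by (simp add: L_def)
  have diff: "L r = L a + [:to_fract [:a - r:]:]" for a r
    by (simp add: L_def flip: to_fract_add)
  have al: "at_least 0 [:to_fract [:k:]:]" for k
    by (cases "k = 0") (simp_all add: at_least_def place_const[OF w])
  show ?thesis
  proof (cases "w (L 0) < 0")
    case True
    have "w (L r) = w (L 0)" for r
      unfolding diff[of r 0] by (rule dominant_add) (use True al[of "0 - r"] in \<open>auto simp: at_least_def nzL\<close>)
    hence "over None (- w (L 0)) w"
      using True by (intro overI[OF w]) (simp_all add: L_def linear_order_def)
    thus ?thesis by blast
  next
    case False
    hence "at_least 0 (L 0)"
      by (simp add: at_least_def)
    hence "at_least 0 (L r)" for r
      unfolding diff[of r 0] by (intro at_least_add al)
    hence nonneg: "0 \<le> w (L r)" for r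
      using nzL by (simp add: at_least_def)
    show ?thesis
    proof (cases "\<exists>a. w (L a) > 0")
      case True
      then obtain a where a: "w (L a) > 0" by blast
      have val: "w (L r) = w (L a) * linear_order (Some a) r" for r
      proof (cases "a = r")
        case True
        thus ?thesis by (simp add: linear_order_def)
      next
        case False
        have "w ([:to_fract [:a - r:]:] + L a) = w [:to_fract [:a - r:]:]"
          by (rule dominant_add) (use False a place_const[OF w, of "a - r"] in \<open>auto simp: at_least_def\<close>)
        thus ?thesis
          using False place_const[OF w, of "a - r"] diff[of r a] by (simp add: linear_order_def add.commute)
      qed
      have "over (Some a) (w (L a)) w"
      proof (rule overI[OF w a])
        show "w [:to_fract [:- r, 1:]:] = w (L a) * linear_order (Some a) r" for r
          using val[of r] unfolding L_def .
      qed
      thus ?thesis by blast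
    next
      case False
      hence zero: "w (L r) = 0" for r
        using nonneg[of r] by (simp add: not_less antisym)
      have "w [:u:] = 0" if "u \<noteq> 0" for u
      proof (rule additive_fract_eqI(2)[OF _ _ _ that, where w = "\<lambda>u. w [:u:]" and w' = "\<lambda>_. 0"])
        show "w [:u * v:] = w [:u:] + w [:v:]" if "u \<noteq> 0" "v \<noteq> 0" for u v
          using w_mult[of "[:u:]" "[:v:]"] that by (simp add: mult.commute)
        show "w [:to_fract [:- r, 1:]:] = 0" for r
          using zero[of r] unfolding L_def .
      qed (simp_all add: place_const[OF w])
      thus ?thesis
        using place_nontrivial_on_rational[OF w] by metis
    qed
  qed
qed

lemma over_unique:
  assumes "over p m w" "over q m' w"
  shows "p = q"
proof -
  have "m * linear_order p r = m' * linear_order q r" for r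
  proof -
    have "to_fract [:-r, 1:] \<noteq> 0" by simp
    hence "w [:to_fract [:-r, 1:]:] = m * linear_order p r" "w [:to_fract [:-r, 1:]:] = m' * linear_order q r"
      using assms unfolding over_def by (metis order_at_linear)+
    thus ?thesis by simp
  qed
  note eq = this
  have "m > 0" "m' > 0"
    using assms by (auto simp: over_def)
  thus ?thesis
    using eq[of "the p"] eq[of "the q"]
    by (cases p; cases q) (auto simp: linear_order_def split: if_splits)
qed

text \<open>By the formula for the least term two such places are proportional, and both are surjective.\<close>
lemma branch_place_unique:
  assumes p: "branch p" and w: "place w" "over p m w" and w': "place w'" "over p m' w'"
  shows "m = m'" and "nz h \<Longrightarrow> w h = w' h"
proof -
  have proportional: "m' * w h = m * w' h" if "nz h" for h
  proof -
    define g where "g = h mod c"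
    have g: "degree g < N" "g \<noteq> 0" "c dvd g - h"
      using that degree_mod_c by (auto simp: g_def nz_iff_mod)
         (metis dvd_minus_mod dvd_diff_commute)
    obtain j where j: "j < N" "coeff g j \<noteq> 0"
      "\<And>i. i < N \<Longrightarrow> i \<noteq> j \<Longrightarrow> coeff g i \<noteq> 0 \<Longrightarrow>
         int N * order_at p (coeff g j) + int j * order_at p (to_fract f) <
         int N * order_at p (coeff g i) + int i * order_at p (to_fract f)"
      using dominant_term[OF p g(1,2)] by metis
    \<comment> \<open>The value of the least term, up to the scale of the place.\<close>
  define t where "t = int N * order_at p (coeff g j) + int j * order_at p (to_fract f)"
    have "int N * w g = m * t" "int N * w' g = m' * t"
      unfolding t_def
      using valuation_dominant_term(2)[OF place_valuation[OF w(1)] not_nz_c nz_const p _ _ g(1) j]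
        valuation_dominant_term(2)[OF place_valuation[OF w'(1)] not_nz_c nz_const p _ _ g(1) j]
        w(2) w'(2) by (auto simp: over_def)
    hence "int N * (m' * w g) = int N * (m * w' g)"
      by (simp add: algebra_simps)
    hence "m' * w g = m * w' g"
      using N_gt_1 by simp
    thus ?thesis
      using place_cong[OF w(1) that g(3)] place_cong[OF w'(1) that g(3)] by simp
  qed
  have pos: "m > 0" "m' > 0"
    using w w' by (auto simp: over_def)
  obtain h1 h2 where "nz h1" "w h1 = 1" "nz h2" "w' h2 = 1"
    using w(1) w'(1) by (auto simp: place_def)
  hence "m' = m * w' h1" "m' * w h2 = m"
    using proportional[of h1] proportional[of h2] by auto
  hence "m dvd m'" "m' dvd m"
    by (metis dvd_triv_left)+
  thus mm: "m = m'"
    using pos by (simp add: zdvd_antisym_nonneg)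
  show "w h = w' h" if "nz h"
    using proportional[OF that] mm pos by simp
qed

lemma power_multiple:
  assumes "valuation nz w" "nz g"
  shows "\<exists>h. nz h \<and> w h = k * w g"
proof -
  interpret valuation nz w by fact
  obtain g' where g': "c dvd g * g' - 1" "nz g'"
    using inverse_exists[OF assms(2)] .
  have "w ((g * g' - 1) + 1) = 0"
    by (rule trans[OF w_add_null w_1]) (use g' in \<open>auto simp: nz_def[of "g * g' - 1"]\<close>)
  hence wg': "w g' = - w g"
    using assms(2) g' by (simp add: w_mult)
  show ?thesis
  proof (cases "k \<ge> 0")
    case True
    thus ?thesis
      using assms(2) by (intro exI[of _ "g ^ nat k"]) (simp add: w_power)
  next
    case False
    thus ?thesis
      using g' by (intro exI[of _ "g' ^ nat (- k)"]) (simp add: w_power wg')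
  qed
qed

text \<open>The order of the image in \<open>K((t))\<close>. It takes the value \<open>1\<close>: over an unbranched point by the
  local parameter of the line, over a branch point because \<open>w Y = ord f\<close> is coprime to the value \<open>N\<close>
  of that parameter up to sign.\<close>
lemma place_exists: "\<exists>w. place w \<and> over p (if branch p then int N else 1) w"
proof -
  define m where "m = (if branch p then N else 1)"
  have m: "m > 0"
    using N_gt_1 by (simp add: m_def)
  obtain \<phi> :: "'a poly fract poly \<Rightarrow> 'a fls" where \<phi>: "comm_ring_map \<phi>" "\<phi> c = 0"
    "\<And>u. \<phi> [:u:] = 0 \<longleftrightarrow> u = 0"
    "\<And>u. u \<noteq> 0 \<Longrightarrow> fls_subdegree (\<phi> [:u:]) = int m * order_at p u"
    unfolding m_def by (rule embedding_exists[of p]) metis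
  interpret comm_ring_map \<phi> by (rule \<phi>(1))
  have ker: "\<phi> h = 0 \<longleftrightarrow> \<not> nz h" for h
  proof
    assume "\<not> nz h"
    thus "\<phi> h = 0"
      by (auto simp: nz_def dvd_def \<phi>(2))
  next
    assume 0: "\<phi> h = 0"
    show "\<not> nz h"
    proof
      assume "nz h"
      then obtain h' where "c dvd h * h' - 1"
        using inverse_exists by blast
      then obtain k where "h * h' - 1 = c * k"
        by (auto simp: dvd_def)
      hence "\<phi> (h * h' - 1) = \<phi> (c * k)"
        by simp
      thus False
        by (simp add: 0 \<phi>(2))
    qed
  qed
  define w where "w = (\<lambda>h. fls_subdegree (\<phi> h))"
  have val: "valuation nz w"
    unfolding w_def by (rule valuation_fls_subdegree[OF \<phi>(1)]) (simp add: ker)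
  interpret w: valuation nz w by (rule val)
  have wu: "w [:u:] = int m * order_at p u" if "u \<noteq> 0" for u
    using \<phi>(4)[OF that] by (simp add: w_def)
  \<comment> \<open>A function of order \<open>1\<close> or \<open>-1\<close> at \<open>p\<close>; at \<open>\<infinity>\<close> any \<open>X - r\<close> would do.\<close>
  define l where "l = to_fract [:- (case p of None \<Rightarrow> 0 | Some a \<Rightarrow> a), 1:]"
  have l: "l \<noteq> 0" "\<bar>order_at p l\<bar> = 1"
    by (auto simp: l_def order_at_linear linear_order_def split: option.splits)
  have "\<exists>h. nz h \<and> w h = 1"
  proof (cases "branch p")
    case False
    have "w [:l:] = order_at p l"
      using False wu[OF l(1)] by (simp add: m_def)
    hence "order_at p l * w [:l:] = 1"
      using l(2) by (auto simp: abs_if split: if_splits)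
    thus ?thesis
      using power_multiple[OF val, of "[:l:]" "order_at p l"] l(1) by simp
  next
    case True
    have "int N * w Y = int N * order_at p (to_fract f)"
      using True value_Y[OF val] wu[of "to_fract f"] by (simp add: m_def)
    hence wY: "w Y = order_at p (to_fract f)"
      using N_gt_1 by simp
    obtain x y where xy: "x * order_at p (to_fract f) + y * int N = 1"
      using order_at_f_branch[OF True] by (metis bezout_int coprime_iff_gcd_eq_1)
    obtain h1 where h1: "nz h1" "w h1 = x * w Y"
      using power_multiple[OF val nz_Y] by blast
    obtain h2 where h2: "nz h2" "w h2 = (y * order_at p l) * w [:l:]"
      using power_multiple[OF val, of "[:l:]"] l(1) by auto
    have "order_at p l * order_at p l = 1"
      using l(2) by (auto simp: abs_if split: if_splits)
    hence wh2: "w h2 = y * int N"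
      using h2 wu[OF l(1)] True by (simp add: m_def algebra_simps)
    hence "w (h1 * h2) = 1"
      using h1 h2(1) wh2 xy by (simp add: w.w_mult wY)
    thus ?thesis
      using h1 h2 by (intro exI[of _ "h1 * h2"]) simp
  qed
  hence "place w"
    using val wu by (simp add: place_def order_at_const)
  moreover have "over p (int m) w"
    using m wu by (simp add: over_def)
  ultimately show ?thesis
    by (auto simp: m_def)
qed

section \<open>Uniqueness of unbranched places\<close>

definition embed_const :: "'a \<Rightarrow> 'a poly fract poly" where
  "embed_const k = [:to_fract [:k:]:]"

lemma embed_const_hom: "comm_ring_map embed_const"
proof
  show "embed_const 1 = 1"
    by (simp add: embed_const_def one_pCons)
  show "embed_const (a + b) = embed_const a + embed_const b" for a b
    by (simp add: embed_const_def flip: to_fract_add)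
  show "embed_const (a * b) = embed_const a * embed_const b" for a b
    by (simp add: embed_const_def flip: to_fract_mult)
qed

lemma embed_const_diff: "embed_const (a - b) = embed_const a - embed_const b"
  by (rule comm_ring_map.map_diff[OF embed_const_hom])

lemma nz_embed_const [simp]: "nz (embed_const k) \<longleftrightarrow> k \<noteq> 0"
  by (simp add: embed_const_def)

lemma place_embed_const: "place w \<Longrightarrow> k \<noteq> 0 \<Longrightarrow> w (embed_const k) = 0"
  by (simp add: embed_const_def place_const)

text \<open>The function takes the value zero at the point.\<close>
definition vanishes :: "('a poly fract poly \<Rightarrow> int) \<Rightarrow> 'a poly fract poly \<Rightarrow> bool" where
  "vanishes w h \<longleftrightarrow> (nz h \<longrightarrow> 1 \<le> w h)"

lemma vanishes_at_least: "place w \<Longrightarrow> vanishes w h \<longleftrightarrow> valuation.at_least nz w 1 h"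
  by (simp add: vanishes_def valuation.at_least_def[OF place_valuation])

lemma vanishes_unique:
  assumes w: "place w" and "vanishes w (h - embed_const b)" "vanishes w (h - embed_const b')"
  shows "b = b'"
proof (rule ccontr)
  interpret valuation nz w using w by (rule place_valuation)
  assume "b \<noteq> b'"
  have "at_least 1 ((h - embed_const b') + - (h - embed_const b))"
    using assms by (intro at_least_add at_least_minus) (simp_all add: vanishes_at_least)
  hence "at_least 1 (embed_const (b - b'))"
    by (simp add: embed_const_diff algebra_simps)
  thus False
    using \<open>b \<noteq> b'\<close> place_embed_const[OF w, of "b - b'"] by (simp add: at_least_def)
qed

text \<open>Linear factors are split off \<open>q\<close> one at a time. This is where \<open>K\<close> being algebraically closed makes all
  residue fields equal to \<open>K\<close>.\<close>
lemma root_of_vanishing_polynomial: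
  assumes w: "place w" and q: "q \<noteq> 0" "vanishes w (poly (map_poly embed_const q) z)"
  shows "\<exists>b. poly q b = 0 \<and> vanishes w (z - embed_const b)"
  using q
proof (induction "degree q" arbitrary: q)
  case 0
  then obtain k where k: "q = [:k:]" "k \<noteq> 0"
    by (metis degree_eq_zeroE pCons_0_0)
  have "poly (map_poly embed_const q) z = embed_const k"
    using k by (simp add: map_poly_pCons embed_const_def)
  thus ?case
    using 0 k place_embed_const[OF w, of k] by (simp add: vanishes_def)
next
  case (Suc d)
  interpret valuation nz w using w by (rule place_valuation)
  interpret k: comm_ring_map embed_const by (rule embed_const_hom)
  interpret ev: comm_ring_map "\<lambda>q. poly (map_poly embed_const q) z" by (rule k.poly_eval)
  obtain b where b: "poly q b = 0"
    using alg_closed_imp_poly_has_root[of q] Suc.hyps by auto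
  then obtain q' where q': "q = [:-b, 1:] * q'"
    by (auto simp: poly_eq_0_iff_dvd)
  have "q' \<noteq> 0"
    using q' Suc.prems by auto
  moreover have "degree q = degree [:-b, 1:] + degree q'"
    unfolding q' by (rule degree_mult_eq) (use \<open>q' \<noteq> 0\<close> in auto)
  hence "d = degree q'"
    using Suc.hyps(2) by simp
  moreover have "poly (map_poly embed_const [:-b, 1:]) z = z - embed_const b"
    by (simp add: map_poly_pCons)
  hence "at_least 1 ((z - embed_const b) * poly (map_poly embed_const q') z)"
    using Suc.prems(2) unfolding vanishes_at_least[OF w] q' ev.map_mult by simp
  hence "vanishes w (z - embed_const b) \<or> vanishes w (poly (map_poly embed_const q') z)"
    unfolding vanishes_at_least[OF w] by (rule at_least_1_mult_cases)
  ultimately show ?case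
    using Suc.hyps(1)[of q'] b q' by auto
qed

lemma over_at_least_poly:
  assumes w: "place w" and o: "over (Some a) m w"
  shows "valuation.at_least nz w 0 [:to_fract q:]"
proof (cases "q = 0")
  case False
  thus ?thesis
    using o order_at_poly_nonneg[of a q]
    by (simp add: over_def valuation.at_least_def[OF place_valuation[OF w]])
qed (simp add: valuation.at_least_0[OF place_valuation[OF w]])

lemma over_X:
  assumes "over (Some a) m w"
  shows "w [:to_fract [:-a, 1:]:] = m"
  using assms order_at_linear[of "Some a" a] by (simp add: over_def linear_order_def)

lemma f_minus_value: "\<exists>f'. f = [:poly f a:] + [:-a, 1:] * f'"
proof -
  have "poly (f - [:poly f a:]) a = 0" by simp
  then obtain f' where "f - [:poly f a:] = [:-a, 1:] * f'"
    unfolding poly_eq_0_iff_dvd by blast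
  thus ?thesis
    by (intro exI[of _ f']) (simp add: algebra_simps)
qed

text \<open>At the place, \<open>Y\<close> is a zero of \<open>T^N - f(a)\<close>, since \<open>f - f(a)\<close> is divisible by \<open>X - a\<close>.\<close>
lemma Y_value_exists:
  assumes w: "place w" and o: "over (Some a) m w"
  shows "\<exists>b. b ^ N = poly f a \<and> vanishes w (Y - embed_const b)"
proof -
  interpret valuation nz w using w by (rule place_valuation)
  interpret k: comm_ring_map embed_const by (rule embed_const_hom)
  interpret ev: comm_ring_map "\<lambda>q. poly (map_poly embed_const q) Y" by (rule k.poly_eval)
  define q where "q = [:0, 1:] ^ N - [:poly f a:]"
  obtain f' where f': "f = [:poly f a:] + [:-a, 1:] * f'"
    using f_minus_value by blast
  have "to_fract f = to_fract [:poly f a:] + to_fract [:-a, 1:] * to_fract f'"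
    by (metis f' to_fract_add to_fract_mult)
  hence "Y ^ N - embed_const (poly f a) = c + [:to_fract [:-a, 1:]:] * [:to_fract f':]"
    by (simp add: c_eq embed_const_def)
  moreover have "poly (map_poly embed_const q) Y = Y ^ N - embed_const (poly f a)"
    unfolding q_def ev.map_diff ev.map_power by (simp add: map_poly_pCons)
  moreover have "at_least 1 [:to_fract [:-a, 1:]:]"
    using over_X[OF o] o by (simp add: at_least_def over_def)
  from at_least_mult[OF this over_at_least_poly[OF w o, of f']]
  have "at_least 1 (c + [:to_fract [:-a, 1:]:] * [:to_fract f':])"
    by (intro at_least_add) (simp_all add: at_least_def)
  ultimately have van: "vanishes w (poly (map_poly embed_const q) Y)"
    by (simp add: vanishes_at_least[OF w])
  have "degree q = N"
  proof -
    have "degree ([:0, 1:] ^ N + - [:poly f a:]) = degree ([:0, 1 :: 'a:] ^ N)"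
      using N_gt_1 by (intro degree_add_eq_left) (simp add: degree_power_eq)
    thus ?thesis
      unfolding q_def diff_conv_add_uminus by (simp only: degree_power_eq) (simp add: degree_power_eq)
  qed
  hence "q \<noteq> 0" using N_gt_1 by auto
  from root_of_vanishing_polynomial[OF w this van] show ?thesis
    by (auto simp: q_def)
qed

lemma Y_at_least_0:
  assumes w: "place w" and "vanishes w (Y - embed_const b)"
  shows "valuation.at_least nz w 0 Y"
proof -
  interpret valuation nz w using w by (rule place_valuation)
  have "at_least 0 (Y - embed_const b)"
    using assms(2) by (auto simp: vanishes_def at_least_def)
  moreover have "at_least 0 (embed_const b)"
    using place_embed_const[OF w, of b] by (auto simp: at_least_def)
  ultimately have "at_least 0 ((Y - embed_const b) + embed_const b)"
    by (rule at_least_add)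
  thus ?thesis
    by (simp only: diff_add_cancel)
qed

lemma fract_poly_hom: "comm_ring_map (fract_poly :: 'a poly poly \<Rightarrow> _)"
  by unfold_locales simp_all

text \<open>Elements of \<open>K[X][Y]\<close> are regular at the affine points.\<close>
lemma regular_at_least_0:
  assumes w: "place w" and o: "over (Some a) m w" and van: "vanishes w (Y - embed_const b)"
  shows "valuation.at_least nz w 0 (fract_poly H)"
proof -
  interpret valuation nz w using w by (rule place_valuation)
  show ?thesis
  proof (induction H)
    case (pCons q H)
    have eq: "fract_poly (pCons q H) = [:to_fract q:] + Y * fract_poly H"
      by (simp add: map_poly_pCons)
    have "at_least (0 + 0) (Y * fract_poly H)"
      by (rule at_least_mult[OF Y_at_least_0[OF w van] pCons.IH])
    hence "at_least 0 (Y * fract_poly H)"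
      by (simp only: add_0_left)
    thus ?case
      unfolding eq by (rule at_least_add[OF over_at_least_poly[OF w o]])
  qed simp
qed

text \<open>The ideal of the point \<open>(a, b)\<close> in \<open>K[X][Y]\<close> is generated by \<open>X - a\<close> and \<open>Y - b\<close>.\<close>
lemma bivariate_decomposition:
  fixes H :: "'a poly poly"
  obtains A B where "H = [:[:poly (poly H [:b:]) a:]:] + [:[:-a, 1:]:] * A + [:-[:b:], 1:] * B"
proof -
  have "poly (H - [:poly H [:b:]:]) [:b:] = 0" by simp
  then obtain B where B: "H - [:poly H [:b:]:] = [:-[:b:], 1:] * B"
    unfolding poly_eq_0_iff_dvd by blast
  define q where "q = poly H [:b:]"
  have "poly (q - [:poly q a:]) a = 0" by simp
  then obtain A where A: "q - [:poly q a:] = [:-a, 1:] * A"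
    unfolding poly_eq_0_iff_dvd by blast
  have "[:q:] = [:[:poly q a:]:] + [:[:-a, 1:]:] * [:A:]"
    using A by (simp add: algebra_simps)
  moreover have "H = [:q:] + [:-[:b:], 1:] * B"
    using B unfolding q_def by (metis add.commute diff_add_cancel)
  ultimately have "H = [:[:poly q a:]:] + [:[:-a, 1:]:] * [:A:] + [:-[:b:], 1:] * B"
    by metis
  thus ?thesis
    using that unfolding q_def by blast
qed

lemma regular_value_nonzero:
  assumes w: "place w" and o: "over (Some a) m w" and van: "vanishes w (Y - embed_const b)"
    and nonzero: "poly (poly H [:b:]) a \<noteq> 0"
  shows "nz (fract_poly H)" and "w (fract_poly H) = 0"
proof -
  interpret valuation nz w using w by (rule place_valuation)
  interpret fp: comm_ring_map "fract_poly :: 'a poly poly \<Rightarrow> _" by (rule fract_poly_hom)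
  obtain A B where "H = [:[:poly (poly H [:b:]) a:]:] + [:[:-a, 1:]:] * A + [:-[:b:], 1:] * B"
    using bivariate_decomposition .
  hence "fract_poly H = fract_poly [:[:poly (poly H [:b:]) a:]:] + (fract_poly [:[:-a, 1:]:] * fract_poly A
      + fract_poly [:-[:b:], 1:] * fract_poly B)"
    by (metis fp.map_add fp.map_mult add.assoc)
  also have "fract_poly [:[:poly (poly H [:b:]) a:]:] = embed_const (poly (poly H [:b:]) a)"
    by (simp add: embed_const_def map_poly_pCons)
  also have "fract_poly [:[:-a, 1:]:] = [:to_fract [:-a, 1:]:]"
    by (simp add: map_poly_pCons)
  also have "fract_poly [:-[:b:], 1:] = Y - embed_const b"
    by (simp add: map_poly_pCons embed_const_def flip: to_fract_uminus)
  finally have eq: "fract_poly H = embed_const (poly (poly H [:b:]) a) +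
     ([:to_fract [:-a, 1:]:] * fract_poly A + (Y - embed_const b) * fract_poly B)" .
  have "at_least 1 [:to_fract [:-a, 1:]:]"
    using over_X[OF o] o by (simp add: at_least_def over_def)
  from at_least_mult[OF this regular_at_least_0[OF w o van, of A]]
  have "at_least 1 ([:to_fract [:-a, 1:]:] * fract_poly A)" by simp
  moreover have "at_least 1 ((Y - embed_const b) * fract_poly B)"
    using at_least_mult[OF _ regular_at_least_0[OF w o van, of B], of 1 "Y - embed_const b"] van
    by (simp add: vanishes_at_least[OF w])
  ultimately have "at_least (w (embed_const (poly (poly H [:b:]) a)) + 1)
      ([:to_fract [:-a, 1:]:] * fract_poly A + (Y - embed_const b) * fract_poly B)"
    unfolding place_embed_const[OF w nonzero] by (simp add: at_least_add)
  note dom = dominant_add[OF _ this]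
  show "nz (fract_poly H)" "w (fract_poly H) = 0"
    unfolding eq using dom nonzero place_embed_const[OF w nonzero] by simp_all
qed

text \<open>The curve is smooth at \<open>(a, b)\<close>, with parameter \<open>X - a\<close>. With \<open>S = (Y^N - b^N) / (Y - b)\<close>, whose value
  at the point is \<open>N b^(N-1) \<noteq> 0\<close>, the equation of the curve reads \<open>S (Y - b) = f - f(a)\<close>, a multiple of
  \<open>X - a\<close>. Hence a regular function that vanishes at \<open>(a, b)\<close>, multiplied by \<open>S\<close>, is
  divisible by \<open>X - a\<close>.\<close>
lemma divide_out_uniformizer:
  assumes b: "b \<noteq> 0" "b ^ N = poly f a" and H: "poly (poly H [:b:]) a = 0"
  obtains S H' where "poly (poly S [:b:]) a \<noteq> 0"
    "c dvd fract_poly S * fract_poly H - [:to_fract [:-a, 1:]:] * fract_poly H'"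
proof -
  interpret fp: comm_ring_map "fract_poly :: 'a poly poly \<Rightarrow> _" by (rule fract_poly_hom)
  obtain f' where f': "f = [:poly f a:] + [:-a, 1:] * f'"
    using f_minus_value by blast
  define y where "y = ([:0, 1:] :: 'a poly poly)"
  define S where "S = (\<Sum>i<N. [:[:b:]:] ^ (N - Suc i) * y ^ i)"
  obtain A B where AB: "H = [:[:-a, 1:]:] * A + [:-[:b:], 1:] * B"
    using bivariate_decomposition[of H b a] H by auto
  have "poly (poly S [:b:]) a = (\<Sum>i<N. b ^ (N - Suc i) * b ^ i)"
    by (simp add: S_def y_def poly_sum)
  also have "\<dots> = (\<Sum>i<N. b ^ (N - 1))"
    by (intro sum.cong) (simp_all flip: power_add)
  finally have S: "poly (poly S [:b:]) a \<noteq> 0"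
    using b of_nat_N by simp
  have "y ^ N - [:[:b:]:] ^ N = (y - [:[:b:]:]) * S"
    unfolding S_def by (rule power_diff_sumr2)
  moreover have "y - [:[:b:]:] = [:-[:b:], 1:]"
    by (simp add: y_def)
  moreover have "[:[:b:]:] ^ N = [:[:poly f a:]:]"
    by (simp add: poly_const_pow b)
  ultimately have "[:-[:b:], 1:] * S = (y ^ N - [:f:]) + [:[:-a, 1:]:] * [:f':]"
    using f' by (simp add: algebra_simps)
  moreover have "R * (P * C + Q * D) = G * D + P * (R * C + F * D)"
    if "Q * R = G + P * F" for P Q R C D F G :: "'a poly poly"
  proof -
    have "R * (P * C + Q * D) = P * (R * C) + (Q * R) * D"
      by (simp only: algebra_simps)
    thus ?thesis
      by (simp only: that algebra_simps)
  qed
  ultimately have "S * H = (y ^ N - [:f:]) * B + [:[:-a, 1:]:] * (S * A + [:f':] * B)"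
    unfolding AB by blast
  hence "fract_poly S * fract_poly H = fract_poly (y ^ N - [:f:]) * fract_poly B +
      fract_poly [:[:-a, 1:]:] * fract_poly (S * A + [:f':] * B)"
    by (metis fp.map_add fp.map_mult)
  moreover have "fract_poly (y ^ N - [:f:]) = c"
    unfolding c_eq fp.map_diff fp.map_power by (simp add: y_def map_poly_pCons)
  moreover have "fract_poly [:[:-a, 1:]:] = [:to_fract [:-a, 1:]:]"
    by (simp add: map_poly_pCons)
  ultimately have "c dvd fract_poly S * fract_poly H - [:to_fract [:-a, 1:]:] * fract_poly (S * A + [:f':] * B)"
    by simp
  thus ?thesis
    using that S by blast
qed

lemma clear_denominators:
  "\<exists>q H. q \<noteq> 0 \<and> [:to_fract q:] * h = fract_poly (H :: 'a poly poly)"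
proof (induction h)
  case (pCons u h)
  obtain q H where qH: "q \<noteq> 0" "[:to_fract q:] * h = fract_poly H"
    using pCons.IH by blast
  obtain a b where u: "u = Fract a b" "b \<noteq> 0" by (cases u)
  have "to_fract b * u = to_fract a"
    using u by (simp add: Fract_conv_to_fract)
  hence 1: "to_fract (b * q) * u = to_fract (q * a)"
    by (simp add: mult_ac)
  have 2: "[:to_fract (b * q):] * h = fract_poly (smult b H)"
  proof -
    have "[:to_fract (b * q):] * h = [:to_fract b:] * ([:to_fract q:] * h)"
      by (simp add: mult.commute)
    also have "\<dots> = [:to_fract b:] * fract_poly H"
      by (simp only: qH)
    finally show ?thesis by simp
  qed
  have "[:to_fract (b * q):] * pCons u h = pCons (to_fract (b * q) * u) ([:to_fract (b * q):] * h)"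
    by simp
  also have "\<dots> = fract_poly (pCons (q * a) (smult b H))"
    unfolding 1 2 by (simp add: map_poly_pCons)
  finally have "[:to_fract (b * q):] * pCons u h = fract_poly (pCons (q * a) (smult b H))" .
  moreover have "b * q \<noteq> 0"
    using qH(1) u(2) by simp
  ultimately show ?case by blast
qed (rule exI[of _ 1], rule exI[of _ 0], simp)

text \<open>Dividing out \<open>X - a\<close> repeatedly shows that at a regular function both valuations take the same
  multiple of their values at \<open>X - a\<close>. This extends to all functions by clearing denominators; surjectivity
  makes both values at \<open>X - a\<close> equal to \<open>1\<close>.\<close>
lemma unbranched_place_unique:
  assumes b: "b \<noteq> 0" "b ^ N = poly f a"
    and w: "place w" "over (Some a) m w" "vanishes w (Y - embed_const b)"
    and w': "place w'" "over (Some a) m' w'" "vanishes w' (Y - embed_const b)"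
  shows "m = 1" and "nz h \<Longrightarrow> w h = w' h"
proof -
  interpret w: valuation nz w using w(1) by (rule place_valuation)
  interpret w': valuation nz w' using w'(1) by (rule place_valuation)
  define t where "t = [:to_fract [:-a, 1:]:]"
  have t: "nz t" "w t = m" "w' t = m'"
    using over_X w(2) w'(2) by (auto simp: t_def)
  have pos: "m > 0" "m' > 0"
    using w(2) w'(2) by (auto simp: over_def)
  have regular: "\<exists>k. w (fract_poly H) = k * m \<and> w' (fract_poly H) = k * m'" if "nz (fract_poly H)" for H
    using that
  proof (induction "nat (w (fract_poly H))" arbitrary: H rule: less_induct)
    case (less H)
    show ?case
    proof (cases "poly (poly H [:b:]) a = 0")
      case False
      thus ?thesis
        using regular_value_nonzero(2)[OF w False] regular_value_nonzero(2)[OF w' False]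
        by (intro exI[of _ 0]) simp
    next
      case True
      obtain S H' where S: "poly (poly S [:b:]) a \<noteq> 0"
        and dvd: "c dvd fract_poly S * fract_poly H - t * fract_poly H'"
        using divide_out_uniformizer[OF b True] unfolding t_def by blast
      note nzS = regular_value_nonzero(1)[OF w S]
      have nz': "nz (fract_poly H')"
        using nz_cong[OF dvd] nzS less.prems t by simp
      have 1: "w (fract_poly H) = m + w (fract_poly H')"
        using place_cong[OF w(1) _ dvd] nz' t nzS less.prems regular_value_nonzero(2)[OF w S]
        by (simp add: w.w_mult)
      have 2: "w' (fract_poly H) = m' + w' (fract_poly H')"
        using place_cong[OF w'(1) _ dvd] nz' t nzS less.prems regular_value_nonzero(2)[OF w' S]
        by (simp add: w'.w_mult)
      have "0 \<le> w (fract_poly H')"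
        using regular_at_least_0[OF w, of H'] nz' by (simp add: w.at_least_def)
      hence "nat (w (fract_poly H')) < nat (w (fract_poly H))"
        using 1 pos by simp
      then obtain k where "w (fract_poly H') = k * m" "w' (fract_poly H') = k * m'"
        using less.hyps nz' by blast
      thus ?thesis
        using 1 2 by (intro exI[of _ "k + 1"]) (simp add: algebra_simps)
    qed
  qed
  have all: "\<exists>k. w h = k * m \<and> w' h = k * m'" if h: "nz h" for h
  proof -
    obtain q H where qH: "q \<noteq> 0" "[:to_fract q:] * h = fract_poly (H :: 'a poly poly)"
      using clear_denominators by blast
    have nzq: "nz [:to_fract q:]"
      using qH by simp
    have "nz (fract_poly H)"
      unfolding qH(2)[symmetric] nz_mult using nzq h by blast
    then obtain k where k: "w (fract_poly H) = k * m" "w' (fract_poly H) = k * m'"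
      using regular by blast
    have "w [:to_fract q:] = m * order_at (Some a) (to_fract q)"
      "w' [:to_fract q:] = m' * order_at (Some a) (to_fract q)"
      using w(2) w'(2) qH(1) by (simp_all add: over_def)
    thus ?thesis
      using k w.w_mult[OF nzq h] w'.w_mult[OF nzq h] unfolding qH(2)
      by (intro exI[of _ "k - order_at (Some a) (to_fract q)"]) (simp add: algebra_simps)
  qed
  obtain h1 h2 where "nz h1" "w h1 = 1" "nz h2" "w' h2 = 1"
    using w(1) w'(1) by (auto simp: place_def)
  hence "m dvd 1" "m' dvd 1"
    using all[of h1] all[of h2] by (metis dvd_triv_right)+
  hence mm: "m = 1" "m' = 1"
    using pos by simp_all
  show "m = 1" by fact
  show "w h = w' h" if "nz h"
    using all[OF that] mm by auto
qed

section \<open>Fibres over the projective line\<close>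

lemma xi_power_inj: "inj_on (\<lambda>k. \<xi> ^ k) {..<N}"
proof (rule linorder_inj_onI)
  fix i j assume ij: "i < j" "i \<in> {..<N}" "j \<in> {..<N}"
  have "\<xi> ^ j = \<xi> ^ i * \<xi> ^ (j - i)"
    using ij by (simp flip: power_add)
  thus "\<xi> ^ i \<noteq> \<xi> ^ j"
    using xi_power(2)[of "j - i"] ij by auto
qed auto

lemma root_of_unity_power:
  assumes "z ^ N = (1 :: 'a)"
  shows "\<exists>k<N. z = \<xi> ^ k"
proof -
  define q where "q = monom (1 :: 'a) N - 1"
  have deg: "degree q = N"
  proof -
    have "degree (monom (1 :: 'a) N + - 1) = degree (monom (1 :: 'a) N)"
      using N_gt_1 by (intro degree_add_eq_left) (simp add: degree_monom_eq)
    thus ?thesis by (simp add: q_def degree_monom_eq)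
  qed
  hence "q \<noteq> 0" using N_gt_1 by auto
  have "(\<lambda>k. \<xi> ^ k) ` {..<N} \<subseteq> {x. poly q x = 0}"
    by (auto simp: q_def poly_monom power_mult[symmetric] mult.commute[of _ N]) (simp add: power_mult xi_power)
  moreover have "finite {x. poly q x = 0}"
    using \<open>q \<noteq> 0\<close> by (rule poly_roots_finite)
  moreover have "card {x. poly q x = 0} \<le> card ((\<lambda>k. \<xi> ^ k) ` {..<N})"
    using card_poly_roots_bound[OF \<open>q \<noteq> 0\<close>] xi_power_inj by (simp add: card_image deg)
  ultimately have "(\<lambda>k. \<xi> ^ k) ` {..<N} = {x. poly q x = 0}"
    by (intro card_seteq)
  moreover have "poly q z = 0"
    using assms by (simp add: q_def poly_monom)
  ultimately show ?thesis by (auto simp: set_eq_iff image_iff)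
qed

definition fibre :: "'a option \<Rightarrow> 'a point set" where
  "fibre p = {P \<in> points. \<exists>m. over p m (ord P)}"

definition ramification :: "'a option \<Rightarrow> int" where
  "ramification p = (if branch p then int N else 1)"

text \<open>An arbitrary point over \<open>p\<close>, and the only one if \<open>p\<close> is a branch point.\<close>
definition base_point :: "'a option \<Rightarrow> 'a point" where
  "base_point p = (SOME P. P \<in> fibre p)"

lemma fibre_points: "P \<in> fibre p \<Longrightarrow> P \<in> points"
  by (simp add: fibre_def)

lemma base_point: "base_point p \<in> fibre p"
proof -
  obtain w m where w: "place w" "over p m w"
    using place_exists by blast
  have "over p m (ord (point_of w))"
    using w ord_point_of[OF w(1)] by (simp add: over_def)
  hence "point_of w \<in> fibre p"
    using point_of_in_points[OF w(1)] by (auto simp: fibre_def)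
  thus ?thesis
    unfolding base_point_def by (rule someI[of "\<lambda>P. P \<in> fibre p"])
qed

lemma points_fibre: "P \<in> points \<Longrightarrow> \<exists>p. P \<in> fibre p"
  using place_over_exists[OF place_ord] by (auto simp: fibre_def)

lemma fibre_unique: "P \<in> fibre p \<Longrightarrow> P \<in> fibre q \<Longrightarrow> p = q"
  using over_unique by (auto simp: fibre_def)

lemma fibre_over:
  assumes P: "P \<in> fibre p"
  shows "over p (ramification p) (ord P)"
proof -
  obtain m where m: "over p m (ord P)" and pl: "place (ord P)"
    using P place_ord by (auto simp: fibre_def)
  have "m = ramification p"
  proof (cases "branch p")
    case True
    obtain w where "place w" "over p (int N) w"
      using place_exists[of p] True by auto
    thus ?thesis
      using branch_place_unique(1)[OF True pl m] True by (simp add: ramification_def)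
  next
    case False
    then obtain a where a: "p = Some a"
      by (cases p) (auto simp: branch_def)
    obtain b where b: "b ^ N = poly f a" "vanishes (ord P) (Y - embed_const b)"
      using Y_value_exists[OF pl m[unfolded a]] by blast
    have "b \<noteq> 0"
      using b(1) poly_f_unbranched[of a] False a N_gt_1 by (auto simp: zero_power)
    thus ?thesis
      using unbranched_place_unique(1)[OF _ b(1) pl m[unfolded a] b(2) pl m[unfolded a] b(2)] False
      by (simp add: ramification_def)
  qed
  thus ?thesis using m by simp
qed

lemma ord_rational: "P \<in> fibre p \<Longrightarrow> u \<noteq> 0 \<Longrightarrow> ord P [:u:] = ramification p * order_at p u"
  using fibre_over by (simp add: over_def)

lemma fibre_branch:
  assumes "branch p"
  shows "fibre p = {base_point p}"
proof -
  have "P = base_point p" if P: "P \<in> fibre p" for P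
  proof (rule points_eqI)
    show "P \<in> points" "base_point p \<in> points"
      using P base_point fibre_points by blast+
    thus "ord P h = ord (base_point p) h" if "nz h" for h
      using branch_place_unique(2)[OF assms place_ord fibre_over[OF P] place_ord fibre_over[OF base_point] that]
      by simp
  qed
  thus ?thesis
    using base_point by blast
qed

lemma delta_fibre: "P \<in> fibre p \<Longrightarrow> (\<delta> ^^ k) P \<in> fibre p"
proof (induction k)
  case (Suc k)
  have "over p m (ord (\<delta> P))" if "over p m (ord P)" for m P
    using that by (simp add: over_def ord_delta)
  thus ?case
    using Suc by (auto simp: fibre_def)
qed simp

lemma vanishes_delta:
  assumes P: "P \<in> points" and van: "vanishes (ord P) (Y - embed_const b)"
  shows "vanishes (ord ((\<delta> ^^ k) P)) (Y - embed_const (\<xi> ^ k * b))"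
proof (induction k)
  case (Suc k)
  define P' b' where "P' = (\<delta> ^^ k) P" and "b' = \<xi> ^ k * b"
  interpret valuation nz "ord P'"
    unfolding P'_def using P by (intro place_valuation place_ord) simp
  have s: "s (Y - embed_const (\<xi> * b')) = embed_const \<xi> * (Y - embed_const b')"
    unfolding s.map_diff s_Y right_diff_distrib
    by (simp add: embed_const_def flip: to_fract_mult)
  have "vanishes (ord (\<delta> P')) (Y - embed_const (\<xi> * b'))"
    unfolding vanishes_def
  proof
    assume nz: "nz (Y - embed_const (\<xi> * b'))"
    hence "nz (embed_const \<xi> * (Y - embed_const b'))"
      using s nz_s by metis
    hence "ord P' (embed_const \<xi> * (Y - embed_const b')) = ord P' (Y - embed_const b')"
      "1 \<le> ord P' (Y - embed_const b')"
      using Suc P place_embed_const[OF place_ord, of P' \<xi>]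
        w_mult[of "embed_const \<xi>" "Y - embed_const b'"]
      by (auto simp: vanishes_def P'_def b'_def)
    thus "1 \<le> ord (\<delta> P') (Y - embed_const (\<xi> * b'))"
      using nz by (simp only: ord_delta s)
  qed
  thus ?case
    by (simp add: P'_def b'_def mult.assoc)
qed (use van in simp)

text \<open>The points over \<open>a\<close> correspond to the \<open>N\<close> roots \<open>b\<close> of \<open>b^N = f(a)\<close>, and \<open>\<delta>\<close> multiplies \<open>b\<close> by \<open>\<xi>\<close>.\<close>
lemma fibre_unbranched:
  assumes p: "\<not> branch p" and P: "P \<in> fibre p"
  shows "bij_betw (\<lambda>k. (\<delta> ^^ k) P) {..<N} (fibre p)"
proof -
  obtain a where a: "p = Some a"
    using p by (cases p) (auto simp: branch_def)
  have val: "\<exists>b. b \<noteq> 0 \<and> b ^ N = poly f a \<and> vanishes (ord P) (Y - embed_const b)" if P: "P \<in> fibre p" for P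
  proof -
    obtain b where b: "b ^ N = poly f a" "vanishes (ord P) (Y - embed_const b)"
      using Y_value_exists[OF place_ord fibre_over[OF P, unfolded a]] fibre_points[OF P] by blast
    moreover have "b \<noteq> 0"
      using b(1) poly_f_unbranched[of a] p a N_gt_1 by (auto simp: zero_power)
    ultimately show ?thesis by blast
  qed
  obtain b where b: "b \<noteq> 0" "b ^ N = poly f a" "vanishes (ord P) (Y - embed_const b)"
    using val[OF P] by blast
  note van = vanishes_delta[OF fibre_points[OF P] b(3)]
  show ?thesis
    unfolding bij_betw_def
  proof
    show "inj_on (\<lambda>k. (\<delta> ^^ k) P) {..<N}"
    proof (rule inj_onI)
      fix i j assume ij: "i \<in> {..<N}" "j \<in> {..<N}" "(\<delta> ^^ i) P = (\<delta> ^^ j) P"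
      have "\<xi> ^ i * b = \<xi> ^ j * b"
        by (rule vanishes_unique[OF place_ord van van[of j, folded ij(3)]]) (simp add: fibre_points[OF P])
      thus "i = j"
        using inj_onD[OF xi_power_inj] ij b by simp
    qed
    show "(\<lambda>k. (\<delta> ^^ k) P) ` {..<N} = fibre p"
    proof
      show "fibre p \<subseteq> (\<lambda>k. (\<delta> ^^ k) P) ` {..<N}"
      proof
        fix P' assume P': "P' \<in> fibre p"
        obtain b' where b': "b' \<noteq> 0" "b' ^ N = poly f a" "vanishes (ord P') (Y - embed_const b')"
          using val[OF P'] by blast
        have "(b' / b) ^ N = 1"
          using b(1) unfolding power_divide b'(2) b(2)[symmetric] by simp
        then obtain k where k: "k < N" "b' / b = \<xi> ^ k"
          using root_of_unity_power by blast
        hence bk: "b' = \<xi> ^ k * b"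
          using b by (simp add: field_simps)
        have "(\<delta> ^^ k) P = P'"
        proof (rule points_eqI)
          show pts: "(\<delta> ^^ k) P \<in> points" "P' \<in> points"
            using fibre_points P P' by simp_all
          show "ord ((\<delta> ^^ k) P) h = ord P' h" if "nz h" for h
            using unbranched_place_unique(2)[OF b'(1,2) place_ord[OF pts(1)]
              fibre_over[OF delta_fibre[OF P, of k], unfolded a] van[of k, folded bk]
              place_ord[OF pts(2)] fibre_over[OF P', unfolded a] b'(3) that] .
        qed
        thus "P' \<in> (\<lambda>k. (\<delta> ^^ k) P) ` {..<N}"
          using k by blast
      qed
    qed (use delta_fibre[OF P] in blast)
  qed
qed

lemma finite_fibre: "finite (fibre p)"
proof (cases "branch p")
  case False
  thus ?thesis
    using bij_betw_finite[OF fibre_unbranched[OF False base_point]] by simp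
qed (simp add: fibre_branch)

lemma ord_norm:
  assumes P: "P \<in> fibre p" and h: "nz h"
  shows "(\<Sum>k<N. ord ((\<delta> ^^ k) P) h) = ramification p * order_at p (rational_norm h)"
proof -
  note pl = place_ord[OF fibre_points[OF P]]
  interpret valuation nz "ord P"
    using pl by (rule place_valuation)
  have "(\<Sum>k<N. ord ((\<delta> ^^ k) P) h) = ord P (norm h)"
    unfolding norm_def using h by (subst w_prod) (simp_all add: ord_delta_power fibre_points[OF P])
  also have "\<dots> = ord P [:rational_norm h:]"
    by (rule place_cong[OF pl _ rational_norm]) (use rational_norm_nonzero[OF h] in simp)
  also have "\<dots> = ramification p * order_at p (rational_norm h)"
    by (rule ord_rational[OF P rational_norm_nonzero[OF h]])
  finally show ?thesis .
qed

text \<open>Over an unbranched point the fibre is the orbit of a point, and the sum is the order of the norm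
  there. Over a branch point \<open>\<delta>\<close> fixes the only point, so that the norm has \<open>N\<close> times the
  order of \<open>h\<close>; the ramification index is \<open>N\<close> as well.\<close>
lemma sum_fibre:
  assumes h: "nz h"
  shows "(\<Sum>P\<in>fibre p. ord P h) = order_at p (rational_norm h)"
proof (cases "branch p")
  case True
  have "(\<delta> ^^ k) (base_point p) = base_point p" for k
    using delta_fibre[OF base_point] fibre_branch[OF True] by blast
  hence "int N * ord (base_point p) h = int N * order_at p (rational_norm h)"
    using ord_norm[OF base_point[of p] h] True by (simp add: ramification_def)
  thus ?thesis
    using N_gt_1 by (simp add: fibre_branch[OF True])
next
  case False
  show ?thesis
    using sum.reindex_bij_betw[OF fibre_unbranched[OF False base_point], of "\<lambda>P. ord P h"]
      ord_norm[OF base_point[of p] h] False by (simp add: ramification_def)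
qed

lemma finite_branch: "finite {p. branch p}"
proof -
  have "{p. branch p} = insert None ((\<lambda>i. Some (\<alpha> i)) ` {1..n})"
    by (auto simp: branch_def)
  thus ?thesis by simp
qed

text \<open>Over all but finitely many \<open>p\<close> the coefficients of \<open>h\<close> have no pole and the norm has order zero. Then
  the orders of \<open>h\<close> over \<open>p\<close> are nonnegative with sum zero.\<close>
lemma finite_support:
  assumes h: "nz h"
  shows "finite {P \<in> points. ord P h \<noteq> 0}"
proof -
  define g where "g = h mod c"
  \<comment> \<open>Branch points are excluded as well, so that \<open>Y\<close> has order zero.\<close>
  define Z where "Z = {p. order_at p (rational_norm h) \<noteq> 0} \<union> {p. branch p} \<union> (\<Union>j<N. {p. order_at p (coeff g j) \<noteq> 0})"
  have fin: "finite {p. order_at p u \<noteq> 0}" for u :: "'a poly fract"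
  proof (cases "u = 0")
    case True
    have "order_at p (0 :: 'a poly fract) = 0" for p
      using fract_at_eq_0_iff[OF subdegree_local_coord(2)[of 1 p], of 0] by (simp add: order_at_def)
    thus ?thesis using True by simp
  next
    case False
    thus ?thesis by (rule fract_product_formula)
  qed
  have "finite Z"
    by (simp add: Z_def fin finite_branch)
  have zero: "ord P h = 0" if P: "P \<in> fibre p" and p: "p \<notin> Z" for P p
  proof -
    have nonneg: "0 \<le> ord P' h" if P': "P' \<in> fibre p" for P'
    proof -
      note pl = place_ord[OF fibre_points[OF P']]
      interpret valuation nz "ord P'"
        using pl by (rule place_valuation)
      have "int N * ord P' Y = 0"
        using value_Y[OF place_valuation[OF pl]] ord_rational[OF P', of "to_fract f"] p
          order_at_f_unbranched[of p] by (auto simp: Z_def)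
      hence "ord P' Y = 0" using N_gt_1 by simp
      hence "at_least 0 ([:coeff g j:] * Y ^ j)" if "j < N" for j
        using ord_rational[OF P', of "coeff g j"] p that
        by (cases "coeff g j = 0")
           (auto simp: at_least_def w_mult w_power Z_def simp del: mult_pCons_left)
      hence "at_least 0 (\<Sum>j<N. [:coeff g j:] * Y ^ j)"
        by (intro at_least_sum) simp
      hence "at_least 0 g"
        using degree_mod_c[of h] by (simp only: g_def low_degree_sum[OF degree_mod_c[of h], symmetric])
      moreover have "ord P' g = ord P' h"
        by (simp add: g_def ord_def)
      ultimately show ?thesis
        using h by (simp add: at_least_def g_def)
    qed
    have "(\<Sum>P\<in>fibre p. ord P h) = 0"
      using p by (simp add: sum_fibre[OF h] Z_def)
    thus ?thesis
      using sum_nonneg_eq_0_iff[OF finite_fibre, of p "\<lambda>P. ord P h"] nonneg P by blast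
  qed
  have "{P \<in> points. ord P h \<noteq> 0} \<subseteq> (\<Union>p\<in>Z. fibre p)"
  proof clarify
    fix P assume "P \<in> points" "ord P h \<noteq> 0"
    moreover from this obtain p where "P \<in> fibre p"
      using points_fibre by blast
    ultimately show "P \<in> (\<Union>p\<in>Z. fibre p)"
      using zero[of P p] by auto
  qed
  moreover have "finite (\<Union>p\<in>Z. fibre p)"
    by (rule finite_UN_I[OF \<open>finite Z\<close> finite_fibre])
  ultimately show ?thesis
    by (rule finite_subset)
qed

section \<open>Divisors of functions\<close>

definition divisor_of :: "'a poly fract poly \<Rightarrow> ('a point \<Rightarrow>\<^sub>0 int)" where
  "divisor_of h = Abs_poly_mapping (\<lambda>P. if P \<in> points then ord P h else 0)"

lemma lookup_divisor_of: "nz h \<Longrightarrow> Poly_Mapping.lookup (divisor_of h) P = (if P \<in> points then ord P h else 0)"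
  unfolding divisor_of_def
  by (subst Abs_poly_mapping_inverse)
     (use finite_support[of h] in \<open>auto simp: if_distrib conj_commute elim!: rev_finite_subset split: if_splits\<close>)

lemma keys_divisor_of: "nz h \<Longrightarrow> Poly_Mapping.keys (divisor_of h) = {P \<in> points. ord P h \<noteq> 0}"
  by (auto simp: in_keys_iff lookup_divisor_of split: if_splits)

text \<open>The sums over the fibres are the orders of a rational function, so the product formula on the
  projective line applies.\<close>
lemma degree_divisor_of:
  assumes h: "nz h"
  shows "divisor_degree (divisor_of h) = 0"
proof -
  define Z where "Z = {p. order_at p (rational_norm h) \<noteq> 0} \<union> {p. \<exists>P\<in>Poly_Mapping.keys (divisor_of h). P \<in> fibre p}"
  note fpf = fract_product_formula[OF rational_norm_nonzero[OF h]]
  have "{p. \<exists>P\<in>Poly_Mapping.keys (divisor_of h). P \<in> fibre p} \<subseteq>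
      (\<lambda>P. THE p. P \<in> fibre p) ` Poly_Mapping.keys (divisor_of h)"
    using fibre_unique by (force intro!: image_eqI the_equality[symmetric])
  hence "finite {p. \<exists>P\<in>Poly_Mapping.keys (divisor_of h). P \<in> fibre p}"
    by (rule finite_subset) simp
  hence "finite Z"
    using fpf(1) by (simp add: Z_def)
  have disj: "fibre p \<inter> fibre q = {}" if "p \<noteq> q" for p q
    using fibre_unique that by blast
  have "divisor_degree (divisor_of h) = (\<Sum>P\<in>(\<Union>p\<in>Z. fibre p). Poly_Mapping.lookup (divisor_of h) P)"
  proof (rule divisor_degree_superset)
    show "finite (\<Union> (fibre ` Z))"
      by (rule finite_UN_I[OF \<open>finite Z\<close> finite_fibre])
    show "Poly_Mapping.keys (divisor_of h) \<subseteq> \<Union> (fibre ` Z)"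
      using points_fibre by (force simp: Z_def keys_divisor_of[OF h])
  qed
  also have "\<dots> = (\<Sum>P\<in>(\<Union>p\<in>Z. fibre p). ord P h)"
    by (intro sum.cong) (auto simp: lookup_divisor_of[OF h] fibre_points)
  also have "\<dots> = (\<Sum>p\<in>Z. \<Sum>P\<in>fibre p. ord P h)"
    by (rule sum.UNION_disjoint) (use \<open>finite Z\<close> finite_fibre disj in auto)
  also have "\<dots> = (\<Sum>p\<in>Z. order_at p (rational_norm h))"
    by (simp add: sum_fibre[OF h])
  also have "\<dots> = (\<Sum>p | order_at p (rational_norm h) \<noteq> 0. order_at p (rational_norm h))"
    by (rule sum.mono_neutral_right) (use \<open>finite Z\<close> in \<open>auto simp: Z_def\<close>)
  also have "\<dots> = 0"
    by (rule fpf(2))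
  finally show ?thesis .
qed

section \<open>The divisor class group and the action on it\<close>

abbreviation "lk \<equiv> Poly_Mapping.lookup"
abbreviation "Div0 \<equiv> degree_zero_divisors f N"
abbreviation "Princ \<equiv> principal_divisors f N"
abbreviation "cls \<equiv> divisor_class f N"
abbreviation "push \<equiv> delta_divisor f N \<xi>"

lemma divisor_of_mult:
  assumes "nz g" "nz h"
  shows "divisor_of (g * h) = divisor_of g + divisor_of h"
proof (rule poly_mapping_eqI)
  fix P
  show "lk (divisor_of (g * h)) P = lk (divisor_of g + divisor_of h) P"
    using assms valuation.w_mult[OF place_valuation[OF place_ord], of P g h]
    by (simp add: lookup_divisor_of lookup_add)
qed

lemma divisor_of_cong:
  assumes "c dvd g - h"
  shows "divisor_of g = divisor_of h"
proof -
  have "g mod c = h mod c"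
    using assms by (simp add: mod_eq_dvd_iff)
  hence "ord P g = ord P h" for P
    by (simp add: ord_def)
  thus ?thesis
    by (simp add: divisor_of_def cong: if_cong)
qed

lemma divisor_of_const:
  assumes "k \<noteq> 0"
  shows "divisor_of (embed_const k) = 0"
  by (rule poly_mapping_eqI) (use assms place_embed_const[OF place_ord] in \<open>simp add: lookup_divisor_of\<close>)

lemma divisor_of_inverse:
  assumes "nz h"
  obtains h' where "nz h'" "divisor_of h' = - divisor_of h"
proof -
  obtain h' where h': "c dvd h * h' - 1" "nz h'"
    using inverse_exists[OF assms] .
  have "embed_const 1 = 1"
    by (simp add: embed_const_def one_pCons)
  hence "divisor_of h + divisor_of h' = 0"
    using divisor_of_cong[OF h'(1)] divisor_of_const[of 1] by (simp add: divisor_of_mult assms h')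
  thus ?thesis
    using that[of h'] h' by (simp add: eq_neg_iff_add_eq_0 add.commute)
qed

lemma principal_divisors_eq: "Princ = divisor_of ` {h. nz h}"
proof (rule subset_antisym; rule subsetI)
  fix D assume "D \<in> Princ"
  then obtain h where D: "Poly_Mapping.keys D \<subseteq> points" and h: "h \<in> nonzero_functions f N"
    and lk: "\<And>P. P \<in> points \<Longrightarrow> lk D P = P h"
    by (auto simp: principal_divisors_def)
  have nz: "nz h" and low: "h mod c = h"
    using h by (simp_all add: nonzero_functions_eq nz_low_degree mod_c_eq)
  have "D = divisor_of h"
  proof (rule poly_mapping_eqI)
    fix P show "lk D P = lk (divisor_of h) P"
      using D lk by (cases "P \<in> points") (auto simp: lookup_divisor_of nz ord_def low in_keys_iff)
  qed
  thus "D \<in> divisor_of ` {h. nz h}"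
    using nz by blast
next
  fix D assume "D \<in> divisor_of ` {h. nz h}"
  then obtain h where h: "nz h" "D = divisor_of h" by blast
  have "h mod c \<in> nonzero_functions f N"
    using h degree_mod_c by (simp add: nonzero_functions_eq nz_iff_mod)
  thus "D \<in> Princ"
    unfolding principal_divisors_def using h
    by (auto simp: keys_divisor_of lookup_divisor_of ord_def intro!: bexI[of _ "h mod c"])
qed

lemma mem_Div0: "D \<in> carrier Div0 \<longleftrightarrow> Poly_Mapping.keys D \<subseteq> points \<and> divisor_degree D = 0"
  by (simp add: degree_zero_divisors_def)

lemma mult_Div0 [simp]: "D \<otimes>\<^bsub>Div0\<^esub> E = D + E"
  by (simp add: degree_zero_divisors_def)

lemma one_Div0 [simp]: "\<one>\<^bsub>Div0\<^esub> = 0"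
  by (simp add: degree_zero_divisors_def)

lemma Div0_add: "D \<in> carrier Div0 \<Longrightarrow> E \<in> carrier Div0 \<Longrightarrow> D + E \<in> carrier Div0"
  using Poly_Mapping.keys_add[of D E] by (auto simp: mem_Div0 divisor_degree_add)

lemma Div0_minus: "D \<in> carrier Div0 \<Longrightarrow> - D \<in> carrier Div0"
  by (auto simp: mem_Div0)

lemma Div0_diff: "D \<in> carrier Div0 \<Longrightarrow> E \<in> carrier Div0 \<Longrightarrow> D - E \<in> carrier Div0"
  using Div0_add[OF _ Div0_minus, of D E] by simp

lemma Div0_0: "0 \<in> carrier Div0"
  by (simp add: mem_Div0)

lemma comm_group_Div0: "comm_group Div0"
proof (rule comm_groupI)
  show "\<exists>E\<in>carrier Div0. E \<otimes>\<^bsub>Div0\<^esub> D = \<one>\<^bsub>Div0\<^esub>" if "D \<in> carrier Div0" for D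
    using Div0_minus[OF that] by (intro bexI[of _ "- D"]) simp_all
qed (simp_all add: Div0_add Div0_0 add.assoc add.commute)

lemma inv_Div0: "D \<in> carrier Div0 \<Longrightarrow> inv\<^bsub>Div0\<^esub> D = - D"
  using comm_group_Div0 Div0_minus by (intro group.inv_equality) (auto simp: comm_group_def)

lemma subgroup_Div0I:
  assumes "H \<subseteq> carrier Div0" "0 \<in> H" "\<And>D. D \<in> H \<Longrightarrow> - D \<in> H"
    "\<And>D E. D \<in> H \<Longrightarrow> E \<in> H \<Longrightarrow> D + E \<in> H"
  shows "subgroup H Div0"
  using assms by unfold_locales (auto simp: inv_Div0 subset_iff)

lemma divisor_of_Div0: "nz h \<Longrightarrow> divisor_of h \<in> carrier Div0"
  by (auto simp: mem_Div0 degree_divisor_of keys_divisor_of)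

lemma subgroup_Princ: "subgroup Princ Div0"
proof (rule subgroup_Div0I)
  show "Princ \<subseteq> carrier Div0"
    using divisor_of_Div0 by (auto simp: principal_divisors_eq)
  show "0 \<in> Princ"
    using divisor_of_const[of 1] nz_embed_const[of 1] unfolding principal_divisors_eq
    by (metis image_eqI mem_Collect_eq zero_neq_one)
  show "- D \<in> Princ" if "D \<in> Princ" for D
    using that unfolding principal_divisors_eq by (auto elim: divisor_of_inverse)
      (metis image_eqI mem_Collect_eq divisor_of_inverse)
  show "D + E \<in> Princ" if "D \<in> Princ" "E \<in> Princ" for D E
    using that unfolding principal_divisors_eq by (auto simp flip: divisor_of_mult)
qed

lemma Princ_0: "0 \<in> Princ"
  using subgroup.one_closed[OF subgroup_Princ] by simp

lemma Princ_add: "D \<in> Princ \<Longrightarrow> E \<in> Princ \<Longrightarrow> D + E \<in> Princ"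
  using subgroup.m_closed[OF subgroup_Princ] by simp

lemma Princ_Div0: "D \<in> Princ \<Longrightarrow> D \<in> carrier Div0"
  using subgroup.subset[OF subgroup_Princ] by blast

lemma Princ_minus: "D \<in> Princ \<Longrightarrow> - D \<in> Princ"
  using subgroup.m_inv_closed[OF subgroup_Princ] inv_Div0 Princ_Div0 by metis

lemma normal_Princ: "Princ \<lhd> Div0"
  by (rule comm_group.subgroup_imp_normal[OF comm_group_Div0 subgroup_Princ])

lemma comm_group_Pic0: "comm_group (Pic0 f N)"
  unfolding Pic0_def by (rule comm_group.abelian_FactGroup[OF comm_group_Div0 subgroup_Princ])

lemma cls_eq: "cls D = (\<lambda>E. E + D) ` Princ"
  by (auto simp: divisor_class_def r_coset_def)

lemma carrier_Pic0: "carrier (Pic0 f N) = cls ` carrier Div0"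
  by (simp add: Pic0_def carrier_FactGroup divisor_class_def)

lemma cls_mult: "D \<in> carrier Div0 \<Longrightarrow> E \<in> carrier Div0 \<Longrightarrow> cls D \<otimes>\<^bsub>Pic0 f N\<^esub> cls E = cls (D + E)"
  using normal.rcos_sum[OF normal_Princ] by (simp add: Pic0_def divisor_class_def)

lemma cls_eq_iff: "cls D = cls E \<longleftrightarrow> D - E \<in> Princ"
proof
  assume "cls D = cls E"
  moreover have "0 + D \<in> cls D"
    unfolding cls_eq using Princ_0 by blast
  ultimately obtain G where "G \<in> Princ" "0 + D = G + E"
    unfolding cls_eq by blast
  thus "D - E \<in> Princ" by simp
next
  have sub: "cls D \<subseteq> cls E" if "D - E \<in> Princ" for D E
  proof
    fix x assume "x \<in> cls D"
    then obtain G where G: "G \<in> Princ" "x = G + D"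
      by (auto simp: cls_eq)
    have "x = (G + (D - E)) + E"
      using G by simp
    thus "x \<in> cls E"
      unfolding cls_eq using Princ_add[OF G(1) that] by blast
  qed
  assume "D - E \<in> Princ"
  moreover from Princ_minus[OF this] have "E - D \<in> Princ" by simp
  ultimately show "cls D = cls E"
    using sub by blast
qed

lemma group_hom_cls: "group_hom Div0 (Pic0 f N) cls"
proof -
  have "group Div0" "group (Pic0 f N)"
    using comm_group_Div0 comm_group_Pic0 by (simp_all add: comm_group_def)
  moreover have "cls \<in> hom Div0 (Pic0 f N)"
    by (rule homI) (auto simp: carrier_Pic0 cls_mult)
  ultimately show ?thesis
    by (simp add: group_hom_def group_hom_axioms_def)
qed

lemma push_add: "push (D + E) = push D + push E"
  by (simp add: delta_divisor_def frag_extend_add)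

lemma push_minus: "push (- D) = - push D"
  by (simp add: delta_divisor_def frag_extend_minus)

lemma push_diff: "push (D - E) = push D - push E"
  using push_add[of D "- E"] by (simp add: push_minus)

lemma push_frag_of: "push (frag_of P) = frag_of (\<delta> P)"
  by (simp add: delta_divisor_def)

lemma push_0 [simp]: "push 0 = 0"
  by (simp add: delta_divisor_def)

lemma delta_inj:
  assumes "P \<in> points" "Q \<in> points" "\<delta> P = \<delta> Q"
  shows "P = Q"
proof -
  have "(\<delta> ^^ (N - 1)) (\<delta> R) = R" if "R \<in> points" for R
    using delta_power_N[OF that] N_gt_1 by (metis Suc_diff_1 funpow_Suc_right comp_apply less_trans zero_less_one)
  thus ?thesis
    using assms by metis
qed

lemma delta_surj:
  assumes "P \<in> points"
  obtains Q where "Q \<in> points" "\<delta> Q = P"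
proof -
  have "\<delta> ((\<delta> ^^ (N - 1)) P) = P"
    using delta_power_N[OF assms] N_gt_1 by (metis Suc_diff_1 funpow.simps(2) comp_apply less_trans zero_less_one)
  thus ?thesis
    using that[of "(\<delta> ^^ (N - 1)) P"] assms by simp
qed

lemma lookup_push:
  assumes "Poly_Mapping.keys D \<subseteq> points" and P: "P \<in> points"
  shows "lk (push D) (\<delta> P) = lk D P"
  using assms(1)
proof (induction rule: free_Abelian_group_induct[consumes 1, case_names zero diff of])
  case (diff x y)
  thus ?case by (simp add: push_diff lookup_minus)
next
  case (of a)
  thus ?case
    using delta_inj[OF P of] by (auto simp: push_frag_of)
qed simp

lemma invariant_lookup_power:
  assumes "Poly_Mapping.keys D \<subseteq> points" "push D = D" and P: "P \<in> points"
  shows "lk D ((\<delta> ^^ k) P) = lk D P"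
proof (induction k)
  case (Suc k)
  thus ?case
    using lookup_push[OF assms(1), of "(\<delta> ^^ k) P"] assms(2) P by simp
qed simp

lemma keys_push: "Poly_Mapping.keys D \<subseteq> points \<Longrightarrow> Poly_Mapping.keys (push D) \<subseteq> points"
proof (induction rule: free_Abelian_group_induct[consumes 1, case_names zero diff of])
  case (diff x y)
  thus ?case
    using keys_diff[of "push x" "push y"] by (auto simp: push_diff)
qed (simp_all add: push_frag_of)

lemma lookup_outside: "Poly_Mapping.keys D \<subseteq> points \<Longrightarrow> P \<notin> points \<Longrightarrow> lk D P = 0"
  by (metis in_keys_iff subsetD)

lemma divisor_eqI:
  assumes "Poly_Mapping.keys D \<subseteq> points" "Poly_Mapping.keys E \<subseteq> points" "\<And>P. P \<in> points \<Longrightarrow> lk D P = lk E P"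
  shows "D = E"
proof (rule poly_mapping_eqI)
  fix P show "lk D P = lk E P"
    using assms by (cases "P \<in> points") (simp_all add: lookup_outside)
qed

text \<open>Push-forward undoes pull-back.\<close>
lemma push_divisor_of:
  assumes h: "nz h"
  shows "push (divisor_of (s h)) = divisor_of h"
proof (rule divisor_eqI)
  have keys: "Poly_Mapping.keys (divisor_of (s h)) \<subseteq> points"
    using h by (auto simp: keys_divisor_of)
  thus "Poly_Mapping.keys (push (divisor_of (s h))) \<subseteq> points"
    by (rule keys_push)
  show "Poly_Mapping.keys (divisor_of h) \<subseteq> points"
    using h by (auto simp: keys_divisor_of)
  fix P assume "P \<in> points"
  then obtain Q where Q: "Q \<in> points" "\<delta> Q = P"
    using delta_surj by metis
  have "lk (push (divisor_of (s h))) (\<delta> Q) = lk (divisor_of h) (\<delta> Q)"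
    unfolding lookup_push[OF keys Q(1)] using Q(1) h by (simp add: lookup_divisor_of ord_delta)
  thus "lk (push (divisor_of (s h))) P = lk (divisor_of h) P"
    by (simp add: Q)
qed

lemma s_surj: "\<exists>g. s g = h"
proof -
  have "s ((s ^^ (N - 1)) h) = h"
    using s_power_N[of h] N_gt_1 by (metis Suc_diff_1 funpow.simps(2) comp_apply less_trans zero_less_one)
  thus ?thesis by blast
qed

lemma push_Princ: "push ` Princ = Princ"
proof
  show "push ` Princ \<subseteq> Princ"
  proof clarify
    fix D assume "D \<in> Princ"
    then obtain h where h: "nz h" "D = divisor_of h"
      by (auto simp: principal_divisors_eq)
    obtain g where g: "s g = h" using s_surj by blast
    hence "nz g" using h nz_s by metis
    thus "push D \<in> Princ"
      using push_divisor_of[of g] h g by (auto simp: principal_divisors_eq)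
  qed
  show "Princ \<subseteq> push ` Princ"
  proof
    fix D assume "D \<in> Princ"
    then obtain h where h: "nz h" "D = divisor_of h"
      by (auto simp: principal_divisors_eq)
    thus "D \<in> push ` Princ"
      using push_divisor_of[OF h(1)] unfolding principal_divisors_eq
      by (intro image_eqI[of _ _ "divisor_of (s h)"]) auto
  qed
qed

lemma delta_jac_cls: "delta_jac f N \<xi> (cls D) = cls (push D)"
proof -
  have "delta_jac f N \<xi> (cls D) = (\<lambda>E. E + push D) ` push ` Princ"
    by (simp add: delta_jac_def cls_eq image_image push_add)
  thus ?thesis
    by (simp add: push_Princ cls_eq)
qed

text \<open>Push-forward maps cosets of the principal divisors to such cosets, so it can be tested on one
  representative whether a class is fixed.\<close>
lemma fixed_classes_eq: "fixed_classes f N \<xi> = cls ` {D \<in> carrier Div0. push D - D \<in> Princ}"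
proof -
  have "delta_jac f N \<xi> (cls D) = cls D \<longleftrightarrow> push D - D \<in> Princ" for D
    unfolding delta_jac_cls by (rule cls_eq_iff)
  thus ?thesis
    unfolding fixed_classes_def carrier_Pic0 by blast
qed

lemma subgroup_fixed: "subgroup (fixed_classes f N \<xi>) (Pic0 f N)"
  unfolding fixed_classes_eq
proof (rule group_hom.subgroup_img_is_subgroup[OF group_hom_cls], rule subgroup_Div0I)
  show "- D \<in> {D \<in> carrier Div0. push D - D \<in> Princ}" if "D \<in> {D \<in> carrier Div0. push D - D \<in> Princ}" for D
  proof -
    have "push D - D \<in> Princ"
      using that by blast
    hence "- (push D - D) \<in> Princ"
      by (rule Princ_minus)
    moreover have "- (push D - D) = push (- D) - (- D)"
      by (simp add: push_minus)
    ultimately have "push (- D) - (- D) \<in> Princ"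
      by (simp only:)
    thus ?thesis
      using that Div0_minus[of D] by blast
  qed
  show "D + E \<in> {D \<in> carrier Div0. push D - D \<in> Princ}"
    if "D \<in> {D \<in> carrier Div0. push D - D \<in> Princ}" "E \<in> {D \<in> carrier Div0. push D - D \<in> Princ}" for D E
  proof -
    have "push D - D \<in> Princ" "push E - E \<in> Princ"
      using that by blast+
    hence "(push D - D) + (push E - E) \<in> Princ"
      by (rule Princ_add)
    moreover have "(push D - D) + (push E - E) = push (D + E) - (D + E)"
      by (simp add: push_add)
    ultimately have "push (D + E) - (D + E) \<in> Princ"
      by (simp only:)
    thus ?thesis
      using that Div0_add[of D E] by blast
  qed
qed (auto simp: Div0_0 Princ_0)

section \<open>Branch points and branch divisors\<close>

lemma branch_None: "branch None"
  and branch_alpha: "i \<in> {1..n} \<Longrightarrow> branch (Some (\<alpha> i))"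
  by (auto simp: branch_def)

definition "Qinf = base_point None"
definition "Q i = base_point (Some (\<alpha> i))"

lemma Q_points: "Qinf \<in> points" "Q i \<in> points"
  unfolding Qinf_def Q_def using base_point fibre_points by blast+

lemma value_low_degree: "degree h < N \<Longrightarrow> P h = ord P h"
  by (simp add: ord_def mod_c_eq)

lemma ord_X_minus:
  assumes "P \<in> fibre p"
  shows "ord P (X_fun - const_fun a) = ramification p * linear_order p a"
proof -
  have "X_fun - const_fun a = [:to_fract [:-a, 1:]:]"
    by (simp add: X_fun_def const_fun_def flip: to_fract_diff)
  thus ?thesis
    using ord_rational[OF assms, of "to_fract [:-a, 1:]"] by (simp add: order_at_linear)
qed

lemma ramification_pos: "ramification p > 0"
  using N_gt_1 by (simp add: ramification_def)

lemma infinity_point_eq: "infinity_point f N = Qinf"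
proof -
  have X: "X_fun = (X_fun - const_fun 0 :: 'a poly fract poly)"
    by (simp add: const_fun_def)
  have deg: "degree (X_fun - const_fun 0 :: 'a poly fract poly) < N"
    using N_gt_1 by (simp add: X_fun_def const_fun_def)
  have iff: "P X_fun < 0 \<longleftrightarrow> p = None" if "P \<in> fibre p" for P p
    by (subst X, subst value_low_degree[OF deg])
       (use ramification_pos[of p] in \<open>auto simp: ord_X_minus[OF that] linear_order_def split: option.splits\<close>)
  have "P \<in> points \<and> P X_fun < 0 \<longleftrightarrow> P = Qinf" for P
    using iff fibre_branch[OF branch_None] points_fibre[of P] fibre_points[of P]
    unfolding Qinf_def by blast
  thus ?thesis
    unfolding infinity_point_def by simp
qed

lemma ord_Y:
  assumes "P \<in> fibre p"
  shows "int N * ord P Y = ramification p * order_at p (to_fract f)"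
  using value_Y[OF place_valuation[OF place_ord[OF fibre_points[OF assms]]]] ord_rational[OF assms, of "to_fract f"]
  by simp

lemma ord_Y_branch: "branch p \<Longrightarrow> ord (base_point p) Y = order_at p (to_fract f)"
  using ord_Y[OF base_point[of p]] N_gt_1 by (simp add: ramification_def)

lemma ord_Y_unbranched: "\<not> branch p \<Longrightarrow> P \<in> fibre p \<Longrightarrow> ord P Y = 0"
  using ord_Y[of P p] order_at_f_unbranched[of p] N_gt_1 by simp

lemma affine_point_eq:
  assumes i: "i \<in> {1..n}"
  shows "affine_point f N (\<alpha> i) 0 = Q i"
proof -
  have degX: "degree (X_fun - const_fun a :: 'a poly fract poly) < N" for a
    using N_gt_1 by (simp add: X_fun_def const_fun_def)
  have Y: "Y_fun - const_fun 0 = (Y :: 'a poly fract poly)" "degree Y < N"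
    using N_gt_1 by (simp_all add: Y_fun_def const_fun_def)
  have iff: "P (X_fun - const_fun (\<alpha> i)) > 0 \<longleftrightarrow> p = Some (\<alpha> i)" if "P \<in> fibre p" for P p
    by (subst value_low_degree[OF degX])
       (use ramification_pos[of p] in \<open>auto simp: ord_X_minus[OF that] linear_order_def split: option.splits if_splits\<close>)
  have "Q i Y = int (e i)"
    by (subst value_low_degree[OF Y(2)])
       (simp only: Q_def ord_Y_branch[OF branch_alpha[OF i]] order_at_f_alpha[OF i])
  hence "Q i (Y_fun - const_fun 0) > 0"
    unfolding Y(1) using e_pos[OF i] by simp
  hence "P \<in> points \<and> P (X_fun - const_fun (\<alpha> i)) > 0 \<and> P (Y_fun - const_fun 0) > 0 \<longleftrightarrow> P = Q i" for P
    using iff fibre_branch[OF branch_alpha[OF i]] points_fibre[of P] fibre_points[of P]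
    unfolding Q_def by blast
  thus ?thesis
    unfolding affine_point_def by simp
qed

lemma Q_distinct: "i \<in> {1..n} \<Longrightarrow> j \<in> {1..n} \<Longrightarrow> Q i = Q j \<longleftrightarrow> i = j"
  "Q i \<noteq> Qinf"
proof -
  have "base_point p = base_point q \<longleftrightarrow> p = q" for p q
    using fibre_unique[OF base_point, of p q] base_point[of q] by metis
  thus "i \<in> {1..n} \<Longrightarrow> j \<in> {1..n} \<Longrightarrow> Q i = Q j \<longleftrightarrow> i = j" "Q i \<noteq> Qinf"
    using inj_alpha by (auto simp: Q_def Qinf_def inj_on_eq_iff)
qed

text \<open>The coefficient at \<open>\<infinity>\<close> is forced by the degree, so branch divisors are parametrised by the other
  coefficients.\<close>
definition branch_divisor :: "(nat \<Rightarrow> int) \<Rightarrow> ('a point \<Rightarrow>\<^sub>0 int)" where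
  "branch_divisor a = frag_cmul (- (\<Sum>i=1..n. a i)) (frag_of Qinf) + (\<Sum>i=1..n. frag_cmul (a i) (frag_of (Q i)))"

lemma branch_classes_eq: "branch_classes f N n \<alpha> = range (\<lambda>a. cls (branch_divisor a))"
proof -
  have sum: "(\<Sum>i=1..n. frag_cmul (a i) (frag_of (affine_point f N (\<alpha> i) 0))) =
      (\<Sum>i=1..n. frag_cmul (a i) (frag_of (Q i)))" for a
    by (intro sum.cong) (simp_all add: affine_point_eq)
  show ?thesis
    unfolding branch_classes_def infinity_point_eq sum branch_divisor_def
    by (auto simp: add_eq_0_iff2 intro!: exI)
qed

lemma lookup_branch_divisor_Q: "i \<in> {1..n} \<Longrightarrow> lk (branch_divisor a) (Q i) = a i"
proof -
  assume i: "i \<in> {1..n}"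
  have "(\<Sum>j=1..n. a j * (if Q i = Q j then 1 else 0)) = (\<Sum>j=1..n. if i = j then a j else 0)"
    by (intro sum.cong) (use Q_distinct(1) i in auto)
  thus ?thesis
    using i Q_distinct(2)[of i] by (simp add: branch_divisor_def lookup_add lookup_sum)
qed

lemma keys_branch_divisor: "Poly_Mapping.keys (branch_divisor a) \<subseteq> insert Qinf (Q ` {1..n})"
proof
  fix P assume "P \<in> Poly_Mapping.keys (branch_divisor a)"
  moreover have "lk (branch_divisor a) P = 0" if "P \<noteq> Qinf" "\<And>i. i \<in> {1..n} \<Longrightarrow> P \<noteq> Q i"
    using that by (auto simp: branch_divisor_def lookup_add lookup_sum intro!: sum.neutral)
  ultimately show "P \<in> insert Qinf (Q ` {1..n})"
    by (metis image_eqI in_keys_iff insertCI)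
qed

lemma branch_divisor_Div0: "branch_divisor a \<in> carrier Div0"
proof -
  have "divisor_degree (branch_divisor a) = 0"
    by (simp add: branch_divisor_def divisor_degree_add divisor_degree_sum)
  thus ?thesis
    using keys_branch_divisor[of a] Q_points by (auto simp: mem_Div0)
qed

lemma push_branch_divisor: "push (branch_divisor a) = branch_divisor a"
proof -
  have cmul: "push (frag_cmul k D) = frag_cmul k (push D)" for k D
    by (simp add: delta_divisor_def frag_extend_cmul)
  have sum: "push (sum D A) = (\<Sum>i\<in>A. push (D i))" for D and A :: "nat set"
    by (induction A rule: infinite_finite_induct) (simp_all add: push_add)
  have "\<delta> (base_point p) = base_point p" if "branch p" for p
    using delta_fibre[OF base_point, of 1 p] fibre_branch[OF that] by simp
  hence "\<delta> Qinf = Qinf" "\<And>i. i \<in> {1..n} \<Longrightarrow> \<delta> (Q i) = Q i"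
    by (simp_all add: Qinf_def Q_def branch_None branch_alpha)
  thus ?thesis
    by (simp add: branch_divisor_def push_add cmul sum push_frag_of)
qed

lemma branch_divisor_diff: "branch_divisor (\<lambda>i. a i - b i) = branch_divisor a - branch_divisor b"
  by (rule poly_mapping_eqI)
     (simp add: branch_divisor_def lookup_add lookup_minus lookup_sum sum_subtractf algebra_simps)

lemma degree_zero_eqI:
  assumes "D \<in> carrier Div0" "E \<in> carrier Div0" "\<And>P. P \<in> points \<Longrightarrow> P \<noteq> Qinf \<Longrightarrow> lk D P = lk E P"
  shows "D = E"
proof -
  define G where "G = D - E"
  have G: "G \<in> carrier Div0"
    unfolding G_def using assms Div0_diff by blast
  have zero: "lk G P = 0" if "P \<noteq> Qinf" for P
    using assms that by (cases "P \<in> points") (simp_all add: G_def lookup_minus mem_Div0 lookup_outside)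
  hence "Poly_Mapping.keys G \<subseteq> {Qinf}"
    by (auto simp: in_keys_iff)
  hence "divisor_degree G = lk G Qinf"
    using divisor_degree_superset[of "{Qinf}" G] by simp
  hence "lk G Qinf = 0"
    using G by (simp add: mem_Div0)
  hence "G = 0"
    using zero by (intro poly_mapping_eqI) (metis lookup_zero)
  thus ?thesis by (simp add: G_def)
qed

lemma supported_on_branch:
  assumes D: "D \<in> carrier Div0" and zero: "\<And>P p. P \<in> fibre p \<Longrightarrow> \<not> branch p \<Longrightarrow> lk D P = 0"
  shows "D = branch_divisor (\<lambda>i. lk D (Q i))"
proof (rule degree_zero_eqI[OF D branch_divisor_Div0])
  fix P assume P: "P \<in> points" "P \<noteq> Qinf"
  then obtain p where p: "P \<in> fibre p"
    using points_fibre by blast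
  show "lk D P = lk (branch_divisor (\<lambda>i. lk D (Q i))) P"
  proof (cases "branch p")
    case True
    hence "P = base_point p"
      using p fibre_branch by blast
    then obtain i where "i \<in> {1..n}" "P = Q i"
      using True P by (auto simp: branch_def Qinf_def Q_def)
    thus ?thesis
      by (simp add: lookup_branch_divisor_Q)
  next
    case False
    have "P \<notin> insert Qinf (Q ` {1..n})"
    proof
      assume "P \<in> insert Qinf (Q ` {1..n})"
      hence "\<exists>q. branch q \<and> P = base_point q"
        unfolding Qinf_def Q_def using branch_None branch_alpha by blast
      then obtain q where "branch q" "P = base_point q" by blast
      thus False
        using fibre_unique[OF p] base_point False by blast
    qed
    hence "P \<notin> Poly_Mapping.keys (branch_divisor (\<lambda>i. lk D (Q i)))"
      using keys_branch_divisor by blast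
    thus ?thesis
      using zero[OF p False] by (simp add: in_keys_iff)
  qed
qed

section \<open>Hilbert 90 and invariant divisors\<close>

text \<open>The sum is the order at \<open>P\<close> of the norm. A rational function without zeros and poles on the affine
  line is constant.\<close>
lemma norm_constant:
  assumes h: "nz h" and zero: "\<And>P. P \<in> points \<Longrightarrow> (\<Sum>k<N. ord ((\<delta> ^^ k) P) h) = 0"
  obtains k where "k \<noteq> 0" "c dvd norm h - embed_const k"
proof -
  have "order_at (Some a) (rational_norm h) = 0" for a
    using ord_norm[OF base_point h, of "Some a"] zero[of "base_point (Some a)"]
      ramification_pos[of "Some a"] fibre_points[OF base_point] by simp
  then obtain k where k: "k \<noteq> 0" "rational_norm h = to_fract [:k:]"
    using fract_without_zeros_const[OF rational_norm_nonzero[OF h]] by blast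
  show ?thesis
    using that[OF k(1)] rational_norm[of h] by (simp add: k(2) embed_const_def)
qed

lemma s_power_mult: "(s ^^ k) (g * h) = (s ^^ k) g * (s ^^ k) h"
  by (induction k) simp_all

lemma s_power_const: "(s ^^ k) (embed_const a) = embed_const a"
  by (induction k) (simp_all add: embed_const_def)

lemma norm_mult: "norm (g * h) = norm g * norm h"
  by (simp add: norm_def s_power_mult prod.distrib)

lemma embed_const_power: "embed_const (a ^ k) = embed_const a ^ k"
  by (rule comm_ring_map.map_power[OF embed_const_hom])

lemma embed_const_mult: "embed_const (a * b) = embed_const a * embed_const b"
  by (rule comm_ring_map.map_mult[OF embed_const_hom])

lemma embed_const_1 [simp]: "embed_const 1 = 1"
  by (rule comm_ring_map.map_1[OF embed_const_hom])

lemma embed_const_0 [simp]: "embed_const 0 = 0"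
  by (rule comm_ring_map.map_0[OF embed_const_hom])

lemma s_power_Y: "(s ^^ k) (Y ^ j) = embed_const (\<xi> ^ (k * j)) * Y ^ j"
proof (induction k)
  case (Suc k)
  have "s (Y ^ j) = embed_const (\<xi> ^ j) * Y ^ j"
    by (simp only: s.map_power s_Y power_mult_distrib embed_const_power) (simp only: embed_const_def)
  moreover have "s (embed_const b) = embed_const b" for b
    by (simp add: embed_const_def)
  ultimately have "(s ^^ Suc k) (Y ^ j) = embed_const (\<xi> ^ (k * j)) * (embed_const (\<xi> ^ j) * Y ^ j)"
    using Suc by (simp only: funpow.simps comp_apply s.map_mult)
  thus ?case
    by (simp only: mult.assoc[symmetric] embed_const_mult[symmetric] power_add[symmetric] mult_Suc add.commute)
qed (simp add: embed_const_def one_pCons)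

lemma sum_root_of_unity_powers:
  assumes "z ^ N = (1 :: 'a)" "z \<noteq> 1"
  shows "(\<Sum>j<N. z ^ j) = 0"
  using power_diff_1_eq[of z N] assms by simp

text \<open>With \<open>a k = h \<cdot> s h \<cdots> s^(k-1) h\<close>, the resolvent \<open>g = \<Sum>k<N. a k \<cdot> s^k(Y^j)\<close> satisfies \<open>h \<cdot> s g = g\<close>,
  because multiplying by \<open>h\<close> and applying \<open>s\<close> shifts the summands and \<open>a N = 1 = a 0\<close>. Some \<open>j\<close> gives
  \<open>g \<noteq> 0\<close>: here \<open>g = b j \<cdot> Y^j\<close>, and the sum of all \<open>b j\<close> is \<open>N a 0 = N \<noteq> 0\<close> by the
  orthogonality of the powers of \<open>\<xi>\<close>.\<close>
lemma hilbert_90: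
  assumes norm1: "c dvd norm h - 1"
  obtains g where "nz g" "c dvd h * s g - g"
proof -
  define a where "a = (\<lambda>k. \<Prod>i<k. (s ^^ i) h)"
  define F where "F = (\<lambda>j k. a k * (s ^^ k) (Y ^ j))"
  define g where "g = (\<lambda>j. \<Sum>k<N. F j k)"
  have a_Suc: "h * s (a k) = a (Suc k)" for k
    unfolding a_def s.map_prod prod.lessThan_Suc_shift by simp
  have step: "h * s (F j k) = F j (Suc k)" for j k
    unfolding F_def s.map_mult by (simp add: a_Suc[symmetric] mult.assoc)
  have dvd: "c dvd h * s (g j) - g j" for j
  proof -
    have "h * s (g j) - g j = (\<Sum>k<N. F j (Suc k) - F j k)"
      by (simp add: g_def s.map_sum sum_distrib_left step sum_subtractf)
    also have "\<dots> = F j N - F j 0"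
      by (rule sum_lessThan_telescope)
    also have "\<dots> = (norm h - 1) * Y ^ j"
      by (simp add: F_def a_def norm_def left_diff_distrib)
    finally show ?thesis
      using norm1 by simp
  qed
  have "\<exists>j<N. nz (g j)"
  proof (rule ccontr)
    assume none: "\<not> (\<exists>j<N. nz (g j))"
    define b where "b = (\<lambda>j. \<Sum>k<N. a k * embed_const ((\<xi> ^ k) ^ j))"
    have "\<not> nz (b j)" if "j < N" for j
    proof -
      have "g j = b j * Y ^ j"
        by (simp add: g_def b_def F_def s_power_Y sum_distrib_right mult.assoc power_mult)
      moreover have "\<not> nz (g j)"
        using none that by blast
      ultimately show ?thesis
        using nz_Y_power[of j] by simp
    qed
    hence "c dvd (\<Sum>j<N. b j)"
      by (intro dvd_sum) (simp add: nz_def)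
    also have "(\<Sum>j<N. b j) = (\<Sum>k<N. a k * embed_const (\<Sum>j<N. (\<xi> ^ k) ^ j))"
      unfolding b_def by (subst sum.swap) (simp add: comm_ring_map.map_sum[OF embed_const_hom] sum_distrib_left)
    also have "\<dots> = (\<Sum>k<N. if k = 0 then embed_const (of_nat N) else 0)"
    proof (rule sum.cong)
      fix k assume k: "k \<in> {..<N}"
      show "a k * embed_const (\<Sum>j<N. (\<xi> ^ k) ^ j) = (if k = 0 then embed_const (of_nat N) else 0)"
      proof (cases "k = 0")
        case True
        thus ?thesis by (simp add: a_def)
      next
        case False
        have "(\<xi> ^ k) ^ N = 1"
          by (metis power_commutes power_mult mult.commute power_one xi_power(1))
        hence "(\<Sum>j<N. (\<xi> ^ k) ^ j) = 0"
          using False k xi_power(2)[of k] by (intro sum_root_of_unity_powers) auto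
        thus ?thesis
          using False by simp
      qed
    qed simp
    also have "\<dots> = embed_const (of_nat N)"
      using N_gt_1 by simp
    finally show False
      using nz_embed_const[of "of_nat N"] of_nat_N by (simp add: nz_def)
  qed
  thus ?thesis
    using that dvd by blast
qed

text \<open>From \<open>h = g / s g\<close> one gets \<open>\<delta> D - D = div g - div (s g)\<close>. Since \<open>\<delta>\<close> maps \<open>div (s g)\<close> to \<open>div g\<close>,
  the divisor \<open>D - div (s g)\<close> is invariant.\<close>
lemma invariant_representative:
  assumes D: "D \<in> carrier Div0" and fixed: "push D - D \<in> Princ"
  obtains D' where "D' \<in> carrier Div0" "push D' = D'" "D - D' \<in> Princ"
proof -
  obtain h where h: "nz h" "push D - D = divisor_of h"
    using fixed by (auto simp: principal_divisors_eq)
  have keys: "Poly_Mapping.keys D \<subseteq> points"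
    using D by (simp add: mem_Div0)
  have "(\<Sum>k<N. ord ((\<delta> ^^ k) P) h) = 0" if P: "P \<in> points" for P
  proof -
    obtain R where R: "R \<in> points" "\<delta> R = P"
      using delta_surj[OF P] .
    have "ord ((\<delta> ^^ k) P) h = lk D ((\<delta> ^^ k) R) - lk D ((\<delta> ^^ Suc k) R)" for k
    proof -
      have eq: "(\<delta> ^^ k) P = \<delta> ((\<delta> ^^ k) R)"
        using R(2) by (simp add: funpow_swap1)
      have "ord ((\<delta> ^^ k) P) h = lk (push D - D) ((\<delta> ^^ k) P)"
        using P h by (simp add: lookup_divisor_of)
      thus ?thesis
        using lookup_push[OF keys, of "(\<delta> ^^ k) R"] R by (simp add: eq lookup_minus)
    qed
    hence "(\<Sum>k<N. ord ((\<delta> ^^ k) P) h) = (\<Sum>k<N. lk D ((\<delta> ^^ k) R) - lk D ((\<delta> ^^ Suc k) R))"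
      by simp
    also have "\<dots> = lk D ((\<delta> ^^ 0) R) - lk D ((\<delta> ^^ N) R)"
      by (rule sum_lessThan_telescope')
    finally show ?thesis
      using R by simp
  qed
  then obtain k where k: "k \<noteq> 0" "c dvd norm h - embed_const k"
    using norm_constant[OF h(1)] by blast
  obtain t where t: "t ^ N = inverse k"
    using nth_root_exists[of N "inverse k"] N_gt_1 by auto
  have "t \<noteq> 0"
    using t k N_gt_1 by (auto simp: zero_power)
  \<comment> \<open>Scaled to have norm \<open>1\<close>, with the same divisor.\<close>
  define h1 where "h1 = embed_const t * h"
  have "norm (embed_const t) = embed_const (inverse k)"
    by (simp add: norm_def s_power_const t flip: embed_const_power)
  moreover have "embed_const (inverse k) * embed_const k = 1"
    using k by (simp flip: embed_const_mult)
  ultimately have "norm h1 - 1 = embed_const (inverse k) * (norm h - embed_const k)"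
    by (simp add: h1_def norm_mult right_diff_distrib)
  hence "c dvd norm h1 - 1"
    using k(2) by simp
  then obtain g where g: "nz g" "c dvd h1 * s g - g"
    using hilbert_90 by blast
  have "divisor_of h1 = divisor_of h"
    using h(1) \<open>t \<noteq> 0\<close> by (simp add: h1_def divisor_of_mult divisor_of_const)
  hence eq: "divisor_of h + divisor_of (s g) = divisor_of g"
    using divisor_of_cong[OF g(2)] g(1) h(1) \<open>t \<noteq> 0\<close> divisor_of_mult[of h1 "s g"] by (simp add: h1_def)
  define D' where "D' = D - divisor_of (s g)"
  have "push D' = D + divisor_of h - divisor_of g"
    using h(2) push_divisor_of[OF g(1)] by (simp add: D'_def push_diff algebra_simps)
  also have "\<dots> = D'"
    unfolding D'_def eq[symmetric] by simp
  finally have "push D' = D'" .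
  moreover have "divisor_of (s g) \<in> Princ"
    using g(1) by (auto simp: principal_divisors_eq)
  hence "D' \<in> carrier Div0" "D - D' \<in> Princ"
    using D Princ_Div0 by (auto simp: D'_def intro: Div0_diff)
  ultimately show ?thesis
    using that by blast
qed

lemma invariant_constant_on_fibre:
  assumes D: "D \<in> carrier Div0" "push D = D" and P: "P \<in> fibre p"
  shows "lk D P = lk D (base_point p)"
proof (cases "branch p")
  case True
  thus ?thesis
    using P fibre_branch[OF True] by simp
next
  case False
  obtain k where "P = (\<delta> ^^ k) (base_point p)"
    using P bij_betw_imp_surj_on[OF fibre_unbranched[OF False base_point]] by blast
  thus ?thesis
    using invariant_lookup_power[of D "base_point p" k] D fibre_points[OF base_point]
    by (simp add: mem_Div0)
qed

text \<open>Outside the branch points \<open>X - a\<close> is a local parameter at every point over \<open>a\<close>. So a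
  rational function with order \<open>D(P)\<close> at \<open>a\<close>, for \<open>P\<close> over \<open>a\<close>, has the same divisor as \<open>D\<close> there.\<close>
lemma invariant_divisor_equivalent_to_branch:
  assumes D: "D \<in> carrier Div0" "push D = D"
  shows "\<exists>a. D - branch_divisor a \<in> Princ"
proof -
  define A where "A = {a. \<not> branch (Some a) \<and> lk D (base_point (Some a)) \<noteq> 0}"
  have inj: "inj_on (\<lambda>a. base_point (Some a)) A"
    by (rule inj_onI) (metis base_point fibre_unique option.inject)
  have "(\<lambda>a. base_point (Some a)) ` A \<subseteq> Poly_Mapping.keys D"
    by (auto simp: A_def in_keys_iff)
  hence "finite A"
    using inj finite_imageD finite_subset[OF _ finite_keys] by blast
  then obtain u where u: "u \<noteq> 0"
    "\<And>b. order_at (Some b) u = (if b \<in> A then lk D (base_point (Some b)) else 0)"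
    using fract_with_orders[of A "\<lambda>b. lk D (base_point (Some b))"] by blast
  define E where "E = D - divisor_of [:u:]"
  have nz: "nz [:u:]" using u by simp
  have Princ: "divisor_of [:u:] \<in> Princ"
    using nz by (auto simp: principal_divisors_eq)
  have E: "E \<in> carrier Div0"
    unfolding E_def using D Princ Princ_Div0 Div0_diff by blast
  have "E = branch_divisor (\<lambda>i. lk E (Q i))"
  proof (rule supported_on_branch[OF E])
    fix P p assume P: "P \<in> fibre p" and p: "\<not> branch p"
    then obtain a where a: "p = Some a"
      by (cases p) (auto simp: branch_def)
    have "ord P [:u:] = order_at p u"
      using ord_rational[OF P u(1)] p by (simp add: ramification_def)
    also have "\<dots> = lk D (base_point p)"
      using p a by (simp add: u(2) A_def)
    also have "\<dots> = lk D P"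
      using invariant_constant_on_fibre[OF D P] by simp
    finally show "lk E P = 0"
      using nz fibre_points[OF P] by (simp add: E_def lookup_minus lookup_divisor_of)
  qed
  hence "D - branch_divisor (\<lambda>i. lk E (Q i)) = divisor_of [:u:]"
    by (simp add: E_def algebra_simps)
  thus ?thesis
    using Princ by metis
qed

lemma fixed_eq_branch: "fixed_classes f N \<xi> = branch_classes f N n \<alpha>"
proof
  show "fixed_classes f N \<xi> \<subseteq> branch_classes f N n \<alpha>"
  proof
    fix x assume "x \<in> fixed_classes f N \<xi>"
    then obtain D where D: "D \<in> carrier Div0" "push D - D \<in> Princ" "x = cls D"
      by (auto simp: fixed_classes_eq)
    obtain D' where D': "D' \<in> carrier Div0" "push D' = D'" "D - D' \<in> Princ"
      using invariant_representative[OF D(1,2)] .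
    obtain a where a: "D' - branch_divisor a \<in> Princ"
      using invariant_divisor_equivalent_to_branch[OF D'(1,2)] by blast
    have "cls D = cls (branch_divisor a)"
      using D'(3) a cls_eq_iff by metis
    thus "x \<in> branch_classes f N n \<alpha>"
      by (simp add: branch_classes_eq D(3))
  qed
  show "branch_classes f N n \<alpha> \<subseteq> fixed_classes f N \<xi>"
    unfolding branch_classes_eq fixed_classes_eq
    using branch_divisor_Div0 Princ_0 by (auto simp: push_branch_divisor)
qed

section \<open>Principal branch divisors\<close>

lemma effective_degree_zero:
  assumes "D \<in> carrier Div0" "\<And>P. P \<in> points \<Longrightarrow> 0 \<le> lk D P"
  shows "D = 0"
proof -
  have "(\<Sum>P\<in>Poly_Mapping.keys D. lk D P) = 0"
    using assms(1) by (simp add: mem_Div0 divisor_degree_def)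
  moreover have "0 \<le> lk D P" if "P \<in> Poly_Mapping.keys D" for P
    using assms that by (auto simp: mem_Div0)
  ultimately have "\<forall>P\<in>Poly_Mapping.keys D. lk D P = 0"
    by (subst (asm) sum_nonneg_eq_0_iff) auto
  thus ?thesis
    by (metis in_keys_iff keys_eq_empty equals0I)
qed

text \<open>The sum is \<open>N\<close> times the projection of \<open>h\<close> to the eigenspace of \<open>s\<close> for the eigenvalue \<open>\<xi>^j\<close>, by
  orthogonality of the powers of \<open>\<xi>\<close>.\<close>
lemma isotypic_component:
  assumes h: "degree h < N" and j: "j < N"
  shows "embed_const (of_nat N) * ([:coeff h j:] * Y ^ j) =
    (\<Sum>k<N. embed_const (inverse (\<xi> ^ j) ^ k) * (s ^^ k) h)"
proof (rule poly_eqI)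
  fix i
  have coeff_const: "coeff (embed_const a * g) i = to_fract [:a:] * coeff g i" for a g i
    by (simp add: embed_const_def)
  have ks: "to_fract [:a:] * (to_fract [:b:] * u) = to_fract [:a * b:] * u" for a b :: 'a and u
    by (simp add: mult.assoc[symmetric] flip: to_fract_mult)
  have sum_const: "(\<Sum>k<N. to_fract [:a k:] * u) = to_fract [:\<Sum>k<N. a k:] * u" for a :: "nat \<Rightarrow> 'a" and u
  proof -
    have "(\<Sum>k<M. to_fract [:a k:]) = to_fract [:\<Sum>k<M. a k:]" for M
      by (induction M) (simp_all flip: to_fract_add)
    thus ?thesis
      by (simp flip: sum_distrib_right)
  qed
  define z where "z = inverse (\<xi> ^ j) * \<xi> ^ i"
  have zN: "z ^ N = 1"
  proof -
    have "(\<xi> ^ l) ^ N = 1" for l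
      by (metis power_commutes power_mult mult.commute power_one xi_power(1))
    moreover have "z ^ N = inverse ((\<xi> ^ j) ^ N) * (\<xi> ^ i) ^ N"
      by (simp only: z_def power_mult_distrib power_inverse)
    ultimately show ?thesis by simp
  qed
  have "coeff (\<Sum>k<N. embed_const (inverse (\<xi> ^ j) ^ k) * (s ^^ k) h) i =
      (\<Sum>k<N. to_fract [:z ^ k:] * coeff h i)"
    unfolding coeff_sum coeff_const coeff_s_power ks
    by (simp add: z_def power_mult_distrib power_mult)
  also have "\<dots> = to_fract [:\<Sum>k<N. z ^ k:] * coeff h i"
    by (rule sum_const)
  also have "\<dots> = coeff (embed_const (of_nat N) * ([:coeff h j:] * Y ^ j)) i"
  proof (cases "i = j")
    case True
    hence "z = 1" by (simp add: z_def)
    moreover have "[:coeff h j:] * Y ^ j = monom (coeff h j) j"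
      by (simp only: monom_eq)
    ultimately show ?thesis
      unfolding coeff_const using True by simp
  next
    case False
    have rhs: "coeff (embed_const (of_nat N) * ([:coeff h j:] * Y ^ j)) i = 0"
      unfolding coeff_const monom_eq[symmetric] using False by simp
    show ?thesis
    proof (cases "i < N")
      case True
      hence "\<xi> ^ i \<noteq> \<xi> ^ j"
        using inj_onD[OF xi_power_inj, of i j] False j by auto
      hence "z \<noteq> 1"
        by (simp add: z_def field_simps)
      thus ?thesis
        unfolding rhs using sum_root_of_unity_powers[OF zN] by simp
    next
      case False
      thus ?thesis
        unfolding rhs using h by (simp add: coeff_eq_0)
    qed
  qed
  finally show "coeff (embed_const (of_nat N) * ([:coeff h j:] * Y ^ j)) i =
     coeff (\<Sum>k<N. embed_const (inverse (\<xi> ^ j) ^ k) * (s ^^ k) h) i" by simp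
qed

text \<open>Each term of \<open>h\<close> is a combination of the \<open>s^k h\<close>, all of which have the divisor of \<open>h\<close>. So its
  divisor is at least that of \<open>h\<close>, and equal to it since both have degree zero. Any nonzero term will do;
  the proof takes the leading one.\<close>
lemma invariant_principal_monomial:
  assumes h: "nz h" and inv: "push (divisor_of h) = divisor_of h"
  obtains u j where "j < N" "u \<noteq> 0" "divisor_of h = divisor_of ([:u:] * Y ^ j)"
proof -
  define g where "g = h mod c"
  have "c dvd g - h"
    unfolding g_def by (metis dvd_minus_mod dvd_diff_commute)
  hence g: "nz g" "degree g < N" "divisor_of g = divisor_of h"
    using h degree_mod_c by (simp_all add: g_def divisor_of_cong)
  have "g \<noteq> 0" using g by (auto simp: nz_low_degree)
  define j where "j = degree g"
  define u where "u = coeff g j"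
  have u: "u \<noteq> 0" "j < N"
    using \<open>g \<noteq> 0\<close> g by (auto simp: u_def j_def)
  define t where "t = [:u:] * Y ^ j"
  have t: "nz t"
    using u by (simp add: t_def del: mult_pCons_left)
  have nonneg: "0 \<le> lk (divisor_of t - divisor_of g) P" if P: "P \<in> points" for P
  proof -
    note pl = place_ord[OF P]
    interpret valuation nz "ord P"
      using pl by (rule place_valuation)
    have "lk (divisor_of g) ((\<delta> ^^ k) P) = lk (divisor_of g) P" for k
      using invariant_lookup_power[of "divisor_of g" P k] P divisor_of_Div0[OF g(1)] inv g(3) by (simp add: mem_Div0)
    hence same: "ord P ((s ^^ k) g) = ord P g" for k
      using P g(1) by (simp add: lookup_divisor_of ord_delta_power)
    have "at_least (ord P g) (\<Sum>k<N. embed_const (inverse (\<xi> ^ j) ^ k) * (s ^^ k) g)"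
    proof (rule at_least_sum)
      fix k
      have "nz (embed_const (inverse (\<xi> ^ j) ^ k))" "ord P (embed_const (inverse (\<xi> ^ j) ^ k)) = 0"
        using place_embed_const[OF pl] by simp_all
      thus "at_least (ord P g) (embed_const (inverse (\<xi> ^ j) ^ k) * (s ^^ k) g)"
        using g(1) by (simp add: at_least_def w_mult same)
    qed
    hence "at_least (ord P g) (embed_const (of_nat N) * t)"
      using isotypic_component[OF g(2) u(2)] by (simp only: t_def u_def)
    hence "ord P g \<le> ord P t"
      using t of_nat_N place_embed_const[OF pl of_nat_N] by (simp add: at_least_def w_mult)
    thus ?thesis
      using P g(1) t by (simp add: lookup_minus lookup_divisor_of)
  qed
  have "divisor_of t - divisor_of g = 0"
    by (rule effective_degree_zero[OF Div0_diff nonneg]) (use divisor_of_Div0[OF t] divisor_of_Div0[OF g(1)] in blast)+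
  thus ?thesis
    using that[of j u] u g by (simp add: t_def)
qed

lemma lookup_monomial_Q:
  assumes i: "i \<in> {1..n}" and u: "u \<noteq> 0"
  shows "lk (divisor_of ([:u:] * Y ^ j)) (Q i) = int N * order_at (Some (\<alpha> i)) u + int j * int (e i)"
proof -
  interpret valuation nz "ord (Q i)"
    by (rule place_valuation[OF place_ord[OF Q_points(2)]])
  have "ord (Q i) [:u:] = int N * order_at (Some (\<alpha> i)) u"
    using ord_rational[OF base_point u, of "Some (\<alpha> i)"] branch_alpha[OF i]
    by (simp add: Q_def ramification_def)
  moreover have "ord (Q i) Y = int (e i)"
    using ord_Y_branch[OF branch_alpha[OF i]] order_at_f_alpha[OF i] by (simp add: Q_def)
  ultimately have "ord (Q i) ([:u:] * Y ^ j) = int N * order_at (Some (\<alpha> i)) u + int j * int (e i)"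
    using u by (simp add: w_mult w_power del: mult_pCons_left)
  thus ?thesis
    using u Q_points(2)[of i] by (simp add: lookup_divisor_of del: mult_pCons_left)
qed

lemma branch_divisor_principal_iff:
  "branch_divisor a \<in> Princ \<longleftrightarrow> (\<exists>j m. \<forall>i\<in>{1..n}. a i = int N * m i + j * int (e i))"
proof
  assume "branch_divisor a \<in> Princ"
  then obtain h where h: "nz h" "branch_divisor a = divisor_of h"
    by (auto simp: principal_divisors_eq)
  have "push (divisor_of h) = divisor_of h"
    using push_branch_divisor[of a] by (simp add: h(2))
  then obtain u j where u: "u \<noteq> 0" "divisor_of h = divisor_of ([:u:] * Y ^ j)"
    using invariant_principal_monomial[OF h(1)] by blast
  have "a i = int N * order_at (Some (\<alpha> i)) u + int j * int (e i)" if "i \<in> {1..n}" for i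
    using lookup_branch_divisor_Q[OF that, of a] lookup_monomial_Q[OF that u(1), of j]
    by (simp only: h(2) u(2))
  thus "\<exists>j m. \<forall>i\<in>{1..n}. a i = int N * m i + j * int (e i)"
    by (intro exI[of _ "int j"] exI[of _ "\<lambda>i. order_at (Some (\<alpha> i)) u"]) blast
next
  assume "\<exists>j m. \<forall>i\<in>{1..n}. a i = int N * m i + j * int (e i)"
  then obtain j m where jm: "\<And>i. i \<in> {1..n} \<Longrightarrow> a i = int N * m i + j * int (e i)"
    by blast
  define l where "l = nat (j mod int N)"
  \<comment> \<open>Replacing \<open>j\<close> by its residue \<open>l \<ge> 0\<close> changes \<open>m i\<close> by a multiple of \<open>e i\<close>.\<close>
  define r where "r = (\<lambda>x. let i = the_inv_into {1..n} \<alpha> x in m i + (j div int N) * int (e i))"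
  have r: "r (\<alpha> i) = m i + (j div int N) * int (e i)" if "i \<in> {1..n}" for i
    using the_inv_into_f_f[OF inj_alpha that] by (simp add: r_def)
  obtain u where u: "u \<noteq> 0" "\<And>b. order_at (Some b) u = (if b \<in> \<alpha> ` {1..n} then r b else 0)"
    using fract_with_orders[of "\<alpha> ` {1..n}" r] by blast
  define h where "h = [:u:] * Y ^ l"
  have h: "nz h"
    using u by (simp add: h_def del: mult_pCons_left)
  have "divisor_of h = branch_divisor (\<lambda>i. lk (divisor_of h) (Q i))"
  proof (rule supported_on_branch[OF divisor_of_Div0[OF h]])
    fix P p assume P: "P \<in> fibre p" and p: "\<not> branch p"
    then obtain b where b: "p = Some b"
      by (cases p) (auto simp: branch_def)
    interpret valuation nz "ord P"
      by (rule place_valuation[OF place_ord[OF fibre_points[OF P]]])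
    have "b \<notin> \<alpha> ` {1..n}"
      using p b by (auto simp: branch_def)
    hence "ord P [:u:] = 0"
      using ord_rational[OF P u(1)] by (simp add: b u(2))
    hence "ord P h = 0"
      using u(1) ord_Y_unbranched[OF p P] by (simp add: h_def w_mult w_power del: mult_pCons_left)
    thus "lk (divisor_of h) P = 0"
      using h by (simp add: lookup_divisor_of)
  qed
  moreover have "lk (divisor_of h) (Q i) = a i" if i: "i \<in> {1..n}" for i
  proof -
    have "int l = j mod int N"
      using N_gt_1 by (simp add: l_def)
    hence "lk (divisor_of h) (Q i) = int N * (m i + (j div int N) * int (e i)) + (j mod int N) * int (e i)"
      using lookup_monomial_Q[OF i u(1), of l] i by (simp add: h_def u(2) r del: mult_pCons_left)
    also have "\<dots> = int N * m i + (int N * (j div int N) + j mod int N) * int (e i)"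
      by (simp only: algebra_simps)
    also have "\<dots> = a i"
      using jm[OF i] by simp
    finally show ?thesis .
  qed
  hence "branch_divisor (\<lambda>i. lk (divisor_of h) (Q i)) = branch_divisor a"
    by (simp add: branch_divisor_def)
  ultimately have "branch_divisor a = divisor_of h"
    by simp
  thus "branch_divisor a \<in> Princ"
    unfolding principal_divisors_eq using h by blast
qed

lemma cls_branch_eq_iff:
  "cls (branch_divisor a) = cls (branch_divisor b) \<longleftrightarrow>
     (\<exists>j m. \<forall>i\<in>{1..n}. a i - b i = int N * m i + j * int (e i))"
  unfolding cls_eq_iff branch_divisor_diff[symmetric] by (rule branch_divisor_principal_iff)

lemma branch_divisor_add: "branch_divisor (\<lambda>i. a i + b i) = branch_divisor a + branch_divisor b"
  by (rule poly_mapping_eqI)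
     (simp add: branch_divisor_def lookup_add lookup_sum sum.distrib algebra_simps)

section \<open>The structure of the group of fixed classes\<close>

definition extend_by_zero :: "(nat \<Rightarrow> int) \<Rightarrow> nat \<Rightarrow> int" where
  "extend_by_zero z i = (if i \<in> {1..n - 1} then z i else 0)"

text \<open>The map sends \<open>z\<close> to the class of \<open>\<Sum>i<n. z i (Q i - \<infinity>)\<close>. In a relation with coefficient zero
  at \<open>Q n\<close> the multiple \<open>j\<close> of the vector \<open>(e 1, \<dots>, e n)\<close> is divisible by \<open>N\<close>, since \<open>e n\<close> is a unit
  modulo \<open>N\<close>; this gives injectivity. Conversely, subtracting \<open>j = a n / e n\<close> times this vector
  clears the coefficient at \<open>Q n\<close>; this gives surjectivity.\<close>
lemma branch_classes_iso:
  "(Pic0 f N)\<lparr>carrier := branch_classes f N n \<alpha>\<rparr> \<cong> product_group {1..n - 1} (\<lambda>_. integer_mod_group N)"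
proof -
  let ?G = "product_group {1..n - 1} (\<lambda>_. integer_mod_group N)"
  let ?H = "(Pic0 f N)\<lparr>carrier := branch_classes f N n \<alpha>\<rparr>"
  define T where "T = (\<lambda>z. cls (branch_divisor (extend_by_zero z)))"
  have carrier: "z \<in> carrier ?G \<longleftrightarrow> z \<in> (\<Pi>\<^sub>E i\<in>{1..n - 1}. {0..<int N})" for z
    using N_gt_1 by (simp add: carrier_integer_mod_group)
  have n: "n \<in> {1..n}" "n \<notin> {1..n - 1}"
    using n_pos by auto
  have "T \<in> hom ?G ?H"
  proof (rule homI)
    fix x y
    show "T x \<in> carrier ?H"
      by (simp add: T_def branch_classes_eq)
    have "T (x \<otimes>\<^bsub>?G\<^esub> y) = cls (branch_divisor (\<lambda>i. extend_by_zero x i + extend_by_zero y i))"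
      unfolding T_def cls_branch_eq_iff
    proof (intro exI[of _ 0] exI[of _ "\<lambda>i. - ((extend_by_zero x i + extend_by_zero y i) div int N)"] ballI)
      fix i
      have "extend_by_zero (x \<otimes>\<^bsub>?G\<^esub> y) i = (extend_by_zero x i + extend_by_zero y i) mod int N"
        by (simp add: extend_by_zero_def)
      thus "extend_by_zero (x \<otimes>\<^bsub>?G\<^esub> y) i - (extend_by_zero x i + extend_by_zero y i) =
          int N * - ((extend_by_zero x i + extend_by_zero y i) div int N) + 0 * int (e i)"
        by (simp add: minus_div_mult_eq_mod[symmetric] algebra_simps)
    qed
    also have "\<dots> = T x \<otimes>\<^bsub>?H\<^esub> T y"
      using cls_mult[OF branch_divisor_Div0 branch_divisor_Div0] by (simp add: T_def branch_divisor_add)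
    finally show "T (x \<otimes>\<^bsub>?G\<^esub> y) = T x \<otimes>\<^bsub>?H\<^esub> T y" .
  qed
  moreover have "inj_on T (carrier ?G)"
  proof (rule inj_onI)
    fix x y assume x: "x \<in> carrier ?G" and y: "y \<in> carrier ?G" and eq: "T x = T y"
    obtain j m where jm: "\<And>i. i \<in> {1..n} \<Longrightarrow>
        extend_by_zero x i - extend_by_zero y i = int N * m i + j * int (e i)"
      using eq unfolding T_def cls_branch_eq_iff by blast
    have "extend_by_zero z n = 0" for z
      using n(2) by (simp only: extend_by_zero_def if_False)
    hence "0 = int N * m n + j * int (e n)"
      using jm[OF n(1)] by simp
    hence "int N dvd j * int (e n)"
      by (metis dvd_add_right_iff dvd_0_right dvd_triv_left)
    hence j: "int N dvd j"
      using coprime_e[OF n(1)] by (metis coprime_commute coprime_dvd_mult_left_iff coprime_int_iff)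
    show "x = y"
    proof (rule PiE_ext)
      show "x \<in> (\<Pi>\<^sub>E i\<in>{1..n - 1}. {0..<int N})" "y \<in> (\<Pi>\<^sub>E i\<in>{1..n - 1}. {0..<int N})"
        using x y carrier by blast+
      fix i assume i: "i \<in> {1..n - 1}"
      have "int N dvd int N * m i + j * int (e i)"
        using j by simp
      moreover have "i \<in> {1..n}"
        using i by auto
      ultimately have "int N dvd x i - y i"
        using jm[of i] i by (simp add: extend_by_zero_def)
      hence "x i mod int N = y i mod int N"
        by (simp add: mod_eq_dvd_iff)
      moreover have "x i \<in> {0..<int N}" "y i \<in> {0..<int N}"
        using x y i unfolding carrier by (auto simp: PiE_iff)
      ultimately show "x i = y i" by simp
    qed
  qed
  moreover have "T ` carrier ?G = carrier ?H"
  proof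
    show "T ` carrier ?G \<subseteq> carrier ?H"
      by (auto simp: T_def branch_classes_eq)
    show "carrier ?H \<subseteq> T ` carrier ?G"
    proof
      fix x assume "x \<in> carrier ?H"
      then obtain a where a: "x = cls (branch_divisor a)"
        by (auto simp: branch_classes_eq)
      have "coprime (int (e n)) (int N)"
        using coprime_e[OF n(1)] by simp
      then obtain p q where pq: "p * int (e n) + q * int N = 1"
        by (metis bezout_int coprime_iff_gcd_eq_1)
      \<comment> \<open>\<open>p\<close> is the inverse of \<open>e n\<close> modulo \<open>N\<close>.\<close>
      define j where "j = a n * p"
      define z where "z = restrict (\<lambda>i. (a i - j * int (e i)) mod int N) {1..n - 1}"
      have "z \<in> carrier ?G"
        unfolding carrier using N_gt_1 by (auto simp: z_def)
      moreover have "x = T z"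
        unfolding a T_def cls_branch_eq_iff
      proof (intro exI[of _ j] exI ballI)
        fix i assume i: "i \<in> {1..n}"
        show "a i - extend_by_zero z i =
          int N * (if i = n then a n * q else (a i - j * int (e i)) div int N) + j * int (e i)"
        proof (cases "i = n")
          case True
          have "a n * (p * int (e n) + q * int N) = a n"
            by (simp add: pq)
          moreover have "extend_by_zero z n = 0"
            using n(2) by (simp only: extend_by_zero_def if_False)
          ultimately show ?thesis
            using True by (simp add: j_def algebra_simps)
        next
          case False
          hence "i \<in> {1..n - 1}" using i by auto
          thus ?thesis
            using False by (simp add: extend_by_zero_def z_def minus_div_mult_eq_mod[symmetric] algebra_simps)
        qed
      qed
      ultimately show "x \<in> T ` carrier ?G" by blast
    qed
  qed
  ultimately have "T \<in> iso ?G ?H"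
    by (simp add: iso_def bij_betw_def)
  hence "?G \<cong> ?H"
    by (auto simp: is_iso_def)
  moreover have "group ?G" by simp
  ultimately show ?thesis
    by (rule group.iso_sym[rotated])
qed

end

theorem theorem3p5:
  fixes f :: "'a :: alg_closed_field poly"
    and N n :: nat
    and \<xi> :: 'a
    and \<alpha> :: "nat \<Rightarrow> 'a"
    and e :: "nat \<Rightarrow> nat"
  assumes "N > 1" and "of_nat N \<noteq> (0 :: 'a)"
    and "primitive_root_of_unity N \<xi>"
    and "inj_on \<alpha> {1..n}"
    and "\<And>i. i \<in> {1..n} \<Longrightarrow> e i \<ge> 1"
    and "f = (\<Prod>i=1..n. [:- \<alpha> i, 1:] ^ e i)"
    and "coprime (degree f) N"
    and "\<And>i. i \<in> {1..n} \<Longrightarrow> coprime (e i) N"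
  shows "subgroup (fixed_classes f N \<xi>) (Pic0 f N) \<and>
         fixed_classes f N \<xi> = branch_classes f N n \<alpha> \<and>
         (Pic0 f N)\<lparr>carrier := branch_classes f N n \<alpha>\<rparr> \<cong>
           product_group {1..n - 1} (\<lambda>_. integer_mod_group N)"
proof -
  interpret superelliptic f N n \<xi> \<alpha> e
    using assms by unfold_locales
  show ?thesis
    using subgroup_fixed fixed_eq_branch branch_classes_iso by blast
qed

end
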